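(* Let $A\in\mathcal A$ and let $f$ satisfy assumption (F) stated in the context. Then there exist constants $c_s>0$ and $c_z>0$ such that the equation $u_t=[A(u)]_{xx}+f(u)$ has traveling waves as follows. (i) It has a sharp wave $Q_{c_s}(x-c_st)$, with $Q_{c_s}(-\infty)=s_1$, $Q_{c_s}'(\xi)<0$ for $\xi<0$, $Q_{c_s}(\xi)=0$ for $\xi\ge0$, and $c_s=-[\Lambda(Q_{c_s})]'(0-0)$. (ii) It has a unique (up to translation) traveling wave $Q_{c_z}(x-c_zt)$, with $Q_{c_z}(-\infty)=1$, $Q_{c_z}(+\infty)=s_1$, $Q_{c_z}'(\xi)<0$ for $\xi\in\mathbb R$. (iii) In the case where $c_s<c_z$, there exists $c_b\in(c_s,c_z)$ such that the equation has a sharp wave $Q_{c_b}(x-c_bt)$, with $Q_{c_b}(-\infty)=1$, $Q_{c_b}'(\xi)<0$ for $\xi<0$, $Q_{c_b}(\xi)=0$ for $\xi\ge0$, and $c_b=-[\Lambda(Q_{c_b})]'(0-0)$.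
   Context: Class $\mathcal A$: all $A\in C^1([0,\infty))\cap C^\infty((0,\infty))$ with $A(u),A'(u),A''(u)>0$ for $u>0$, $A(0)=A'(0)=0$, $\int_0^1\frac{A'(r)}{r}dr<\infty$, and $\frac{rA''(r)}{A'(r)}\to A_*$ as $r\to0+0$ for some constant $A_*>0$. Assumption (F): $f\in C^2([0,\infty))$ has exactly four zeros $0<s_1<s_2<1$ (the zeros being $0,s_1,s_2,1$), $f'(0)>0>f'(s_1)$, $f'(1)<0$, $f$ is of monostable type in $[0,s_1]$ (i.e. $f>0$ in $(0,s_1)$) and of bistable type in $[s_1,1]$ (i.e. $f<0$ in $(s_1,s_2)$, $f>0$ in $(s_2,1)$), and $\int_{s_1}^1A'(s)f(s)\,ds>0$. A traveling wave of speed $c>0$ is $u(x,t)=Q_c(x-ct)$ with $Q_c\in C(\mathbb R)$ satisfying $$\int_{\mathbb R}[A(Q_c)\varphi''-cQ_c\varphi'+f(Q_c)\varphi]\,d\xi=0\qquad\text{for all }\varphi\in C_c^\infty(\mathbb R).$$ $\Lambda(u)=\int_0^u\frac{A'(r)}{r}dr$, and $[\,\cdot\,]'(0-0)$ denotes the left derivative at $0$. A sharp wave is a traveling wave whose profile is positive and decreasing on $(-\infty,0)$, zero on $[0,\infty)$, and satisfies Darcy's law $c=-[\Lambda(Q_c)]'(0-0)$. *)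

theory Defs
  imports "HOL-Analysis.Analysis"
begin

text \<open>
  Nonlinearities live on the half-line \<open>[0,\<infinity>)\<close> and are represented by total functions
  \<open>real \<Rightarrow> real\<close> whose values at negative arguments are never used. Derivatives are therefore taken
  relative to a set, so that the derivative at \<open>0\<close> within \<open>{0..}\<close> is the one-sided one.
\<close>

definition deriv_within :: "real set \<Rightarrow> (real \<Rightarrow> real) \<Rightarrow> real \<Rightarrow> real" where
  "deriv_within S f x = vector_derivative f (at x within S)"

definition Ck_on :: "nat \<Rightarrow> real set \<Rightarrow> (real \<Rightarrow> real) \<Rightarrow> bool" where
  "Ck_on k S f \<longleftrightarrow>
     (\<forall>j<k. (deriv_within S ^^ j) f differentiable_on S) \<and> continuous_on S ((deriv_within S ^^ k) f)"

definition smooth_on :: "real set \<Rightarrow> (real \<Rightarrow> real) \<Rightarrow> bool" where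
  "smooth_on S f \<longleftrightarrow> (\<forall>k. Ck_on k S f)"

abbreviation hderiv :: "(real \<Rightarrow> real) \<Rightarrow> real \<Rightarrow> real" where
  "hderiv \<equiv> deriv_within {0..}"

lemma deriv_within_interior:
  assumes "x \<in> interior S" "f differentiable (at x)"
  shows "deriv_within S f x = deriv f x"
proof -
  have "at x within S = at x"
    using assms(1) by (rule at_within_interior)
  moreover have "(f has_vector_derivative deriv f x) (at x)"
    using assms(2)
    by (simp add: DERIV_deriv_iff_real_differentiable
        has_real_derivative_iff_has_vector_derivative [symmetric])
  ultimately show ?thesis
    by (simp add: deriv_within_def vector_derivative_at)
qed

definition class_A :: "(real \<Rightarrow> real) \<Rightarrow> bool" where
  "class_A A \<longleftrightarrow>
     Ck_on 1 {0..} A \<and> smooth_on {0<..} A \<and>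
     (\<forall>u>0. A u > 0 \<and> hderiv A u > 0 \<and> hderiv (hderiv A) u > 0) \<and>
     A 0 = 0 \<and> hderiv A 0 = 0 \<and>
     (\<lambda>r. hderiv A r / r) absolutely_integrable_on {0..1} \<and>
     (\<exists>Astar>0. ((\<lambda>r. r * hderiv (hderiv A) r / hderiv A r) \<longlongrightarrow> Astar) (at_right 0))"

definition assumption_F :: "(real \<Rightarrow> real) \<Rightarrow> (real \<Rightarrow> real) \<Rightarrow> real \<Rightarrow> real \<Rightarrow> bool" where
  "assumption_F A f s1 s2 \<longleftrightarrow>
     Ck_on 2 {0..} f \<and>
     0 < s1 \<and> s1 < s2 \<and> s2 < 1 \<and>
     {u. u \<ge> 0 \<and> f u = 0} = {0, s1, s2, 1} \<and>
     hderiv f 0 > 0 \<and> hderiv f s1 < 0 \<and> hderiv f 1 < 0 \<and>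
     (\<forall>u\<in>{0<..<s1}. f u > 0) \<and> (\<forall>u\<in>{s1<..<s2}. f u < 0) \<and> (\<forall>u\<in>{s2<..<1}. f u > 0) \<and>
     integral {s1..1} (\<lambda>s. hderiv A s * f s) > 0"

definition test_function :: "(real \<Rightarrow> real) \<Rightarrow> bool" where
  "test_function \<phi> \<longleftrightarrow> smooth_on UNIV \<phi> \<and> compact (closure {\<xi>. \<phi> \<xi> \<noteq> 0})"

text \<open>
  The equation is \<open>u\<^sub>t = [A(u)]\<^sub>x\<^sub>x + f(u)\<close>; the wave is \<open>u(x,t) = Q(x - c t)\<close>.
  The requirement \<open>Q \<ge> 0\<close> is implicit in \<open>A\<close> and \<open>f\<close> being defined on \<open>[0,\<infinity>)\<close> only.
\<close>

definition traveling_wave ::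
    "(real \<Rightarrow> real) \<Rightarrow> (real \<Rightarrow> real) \<Rightarrow> real \<Rightarrow> (real \<Rightarrow> real) \<Rightarrow> bool" where
  "traveling_wave A f c Q \<longleftrightarrow>
     c > 0 \<and> continuous_on UNIV Q \<and> (\<forall>\<xi>. Q \<xi> \<ge> 0) \<and>
     (\<forall>\<phi>. test_function \<phi> \<longrightarrow>
       ((\<lambda>\<xi>. A (Q \<xi>) * deriv (deriv \<phi>) \<xi> - c * Q \<xi> * deriv \<phi> \<xi> + f (Q \<xi>) * \<phi> \<xi>)
          has_integral 0) UNIV)"

definition Lam :: "(real \<Rightarrow> real) \<Rightarrow> real \<Rightarrow> real" where
  "Lam A u = integral {0..u} (\<lambda>r. hderiv A r / r)"

definition darcy_law :: "(real \<Rightarrow> real) \<Rightarrow> real \<Rightarrow> (real \<Rightarrow> real) \<Rightarrow> bool" where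
  "darcy_law A c Q \<longleftrightarrow> ((\<lambda>\<xi>. Lam A (Q \<xi>)) has_real_derivative (- c)) (at_left 0)"

definition sharp_wave ::
    "(real \<Rightarrow> real) \<Rightarrow> (real \<Rightarrow> real) \<Rightarrow> real \<Rightarrow> (real \<Rightarrow> real) \<Rightarrow> bool" where
  "sharp_wave A f c Q \<longleftrightarrow>
     traveling_wave A f c Q \<and>
     (\<forall>\<xi><0. Q \<xi> > 0) \<and> strict_antimono_on {..<0} Q \<and> (\<forall>\<xi>\<ge>0. Q \<xi> = 0) \<and>
     darcy_law A c Q"

definition neg_deriv_on :: "real set \<Rightarrow> (real \<Rightarrow> real) \<Rightarrow> bool" where
  "neg_deriv_on S Q \<longleftrightarrow> (\<forall>\<xi>\<in>S. Q differentiable (at \<xi>) \<and> deriv Q \<xi> < 0)"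

text \<open>A traveling wave with \<open>Q(-\<infinity>) = a\<close>, \<open>Q(+\<infinity>) = b\<close> and \<open>Q' < 0\<close> everywhere.\<close>

definition decreasing_wave ::
    "(real \<Rightarrow> real) \<Rightarrow> (real \<Rightarrow> real) \<Rightarrow> real \<Rightarrow> real \<Rightarrow> real \<Rightarrow> (real \<Rightarrow> real) \<Rightarrow> bool" where
  "decreasing_wave A f a b c Q \<longleftrightarrow>
     traveling_wave A f c Q \<and> (Q \<longlongrightarrow> a) at_bot \<and> (Q \<longlongrightarrow> b) at_top \<and> neg_deriv_on UNIV Q"

text \<open>
  A traveling wave is the solution \<open>u(x,t) = Q(x - c t)\<close>, i.e. the pair of speed and profile, so
  uniqueness up to translation is uniqueness of the speed together with that of the profile
  modulo shifts.
\<close>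

definition unique_wave_up_to_translation ::
    "(real \<Rightarrow> (real \<Rightarrow> real) \<Rightarrow> bool) \<Rightarrow> real \<Rightarrow> (real \<Rightarrow> real) \<Rightarrow> bool" where
  "unique_wave_up_to_translation W c Q \<longleftrightarrow>
     W c Q \<and> (\<forall>c' Q'. W c' Q' \<longrightarrow> c' = c \<and> (\<exists>h. \<forall>\<xi>. Q' \<xi> = Q (\<xi> + h)))"

end

theory Submission
  imports Defs
begin

text \<open>
  In the phase plane a wave is a curve. Along a decreasing profile \<open>Q\<close> of speed \<open>c\<close> let \<open>P u\<close> be the
  value of the momentum \<open>- (A \<circ> Q)'\<close> at the point where \<open>Q = u\<close>. The wave equation
  \<open>(A \<circ> Q)'' + c Q' + f Q = 0\<close> then becomes \<open>P' = c - g / P\<close> with \<open>g = A' f\<close>, and the energy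
  \<open>y = P\<^sup>2 / 2\<close> satisfies \<open>y' = c sqrt (2 y) - g\<close>. A wave that leaves the rest state \<open>b\<close> at \<open>-\<infinity>\<close>
  has \<open>y b = 0\<close>. The right-hand side is not Lipschitz where \<open>y\<close> vanishes, but it is nondecreasing in
  \<open>y\<close>. Solved in the direction of decreasing \<open>u\<close>, the problem with terminal value \<open>y b = 0\<close> has
  therefore exactly one solution \<open>y\<^sub>c\<close>, which depends on \<open>c\<close> in a nonincreasing and continuous way
  (\<open>energy_profile_exists\<close>, \<open>energy_profile_mono\<close>, \<open>energy_profile_continuous_in_speed\<close>). All three
  speeds are found by shooting with this family.

  For the first wave take \<open>b = s1\<close>. At \<open>c = 0\<close> the value \<open>y\<^sub>c 0\<close> is positive, and for large \<open>c\<close> it is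
  zero; \<open>cs\<close> is the first zero of \<open>c \<mapsto> y\<^sub>c 0\<close>. For the second wave take \<open>b = 1\<close>. Now \<open>y\<^sub>c s1\<close> is
  the integral of \<open>g\<close> at \<open>c = 0\<close>, which is positive, and it is negative for large \<open>c\<close>; \<open>cz\<close> is a zero
  of \<open>c \<mapsto> y\<^sub>c s1\<close>. Two zeros are impossible: where \<open>g < 0\<close>, the difference of two momenta with
  different speeds is strictly monotone, so that it cannot vanish at \<open>s1\<close> and have the sign that the
  comparison principle dictates (\<open>bistable_speed_unique\<close>). For the third wave keep \<open>b = 1\<close> and
  follow \<open>y\<^sub>c 0\<close> for \<open>c\<close> between \<open>cs\<close> and \<open>cz\<close>. At \<open>cz\<close> it is zero, by comparison with the first
  wave. At \<open>cs\<close> it is positive: the curve from \<open>1\<close> starts strictly above the first wave at \<open>s1\<close>, and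
  the integrability of \<open>A' u / u\<close> prevents this gap from closing at \<open>0\<close>
  (\<open>profile_gap_survives\<close>). The first zero is \<open>cb\<close>.

  A curve that ends at the origin belongs to a sharp wave if it does so with slope \<open>c\<close>, since the
  left derivative of \<open>\<Lambda> \<circ> Q\<close> is the limit of \<open>- P u / u\<close>. This happens at a threshold speed
  (\<open>threshold_momentum_slope\<close>). For slower speeds the curve passes above the origin, and
  because \<open>g u = o(u)\<close> it cannot cross a ray of small slope downwards; so these curves stay above a
  fixed ray near \<open>0\<close>, and so does their limit. On such a curve \<open>g / P \<longlonglongrightarrow> 0\<close>, hence
  \<open>P' \<longlonglongrightarrow> c\<close>. The same lemma gives \<open>cb < cz\<close>: if \<open>cb = cz\<close>, the curve at \<open>cz\<close> would have slope
  \<open>cz\<close> at the origin while lying below a curve of slope \<open>cs\<close>.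

  It remains to pass between curves and weak solutions. From \<open>P\<close> the profile is recovered as the
  inverse of a function \<open>X\<close> with \<open>X' = - A' / P\<close>; linear bounds for \<open>P\<close> at a rest state other than
  \<open>0\<close> make \<open>X\<close> infinite there, whereas at \<open>0\<close> the integrability of \<open>A' u / u\<close> keeps it finite, and the
  wave is zero from some point on. Conversely, an arbitrary monotone weak solution is shown to be
  classical by a du Bois-Reymond argument (\<open>first_order_system_of_weak_form\<close>), its momentum vanishes
  at both ends (\<open>energy_profile_of_wave\<close>), and so its curve is the one found by shooting. This gives
  uniqueness up to translation.
\<close>

section \<open>Global solutions of Lipschitz equations\<close>

text \<open>
  Banach's fixed point theorem in the norm \<open>sup \<bar>exp (- lam t) x t\<bar>\<close>. The weight makes the integral
  operator a contraction on the whole interval, so no short-time solutions have to be glued.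
\<close>
lemma picard_on_interval:
  fixes F :: "real \<Rightarrow> real \<Rightarrow> real"
  assumes L: "0 \<le> L" and K: "0 < K"
    and contF: "\<And>x. continuous_on {0..L} x \<Longrightarrow> continuous_on {0..L} (\<lambda>s. F s (x s))"
    and lip: "\<And>s x y. s \<in> {0..L} \<Longrightarrow> \<bar>F s x - F s y\<bar> \<le> K * \<bar>x - y\<bar>"
  shows "\<exists>x. continuous_on {0..L} x \<and> x 0 = 0 \<and>
           (\<forall>t\<in>{0..L}. (x has_real_derivative F t (x t)) (at t within {0..L}))"
proof -
  \<comment> \<open>With this weight the contraction factor is \<open>K / lam = 1 / 2\<close>.\<close>
  define lam where "lam = 2 * K"
  \<comment> \<open>Bounded continuous functions live on the whole line, so functions on the interval are extended
    by constants through the projection \<open>cl\<close>.\<close>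
  define cl where "cl t = max 0 (min L t)" for t :: real
  have cl_in: "cl t \<in> {0..L}" for t using L by (auto simp: cl_def)
  have cl_id: "t \<in> {0..L} \<Longrightarrow> cl t = t" for t by (auto simp: cl_def)
  have cl_cont: "continuous_on UNIV cl" unfolding cl_def by (intro continuous_intros)
  define G where "G z s = F s (exp (lam * s) * z s)" for z s
  define T0 where "T0 z t = exp (- lam * t) * integral {0..t} (G z)" for z t
  have Gc: "continuous_on {0..L} (G z)" if "continuous_on {0..L} z" for z
    unfolding G_def by (intro contF continuous_intros that)
  have dI: "((\<lambda>t. integral {0..t} (G z)) has_real_derivative G z t) (at t within {0..L})"
    if "continuous_on {0..L} z" "t \<in> {0..L}" for z t
    using integral_has_real_derivative[OF Gc[OF that(1)] that(2)] .
  have T0c: "continuous_on {0..L} (T0 z)" if "continuous_on {0..L} z" for z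
  proof -
    have "continuous_on {0..L} (\<lambda>t. integral {0..t} (G z))"
      by (rule DERIV_continuous_on) (rule dI[OF that])
    then show ?thesis unfolding T0_def by (intro continuous_intros)
  qed
  have Tb: "(\<lambda>t. T0 z (cl t)) \<in> bcontfun" if "continuous_on {0..L} z" for z
  proof -
    have "continuous_on UNIV (\<lambda>t. T0 z (cl t))"
      by (rule continuous_on_compose2[OF T0c[OF that] cl_cont]) (use cl_in in blast)
    moreover have "bounded (T0 z ` {0..L})"
      using compact_continuous_image[OF T0c[OF that]] compact_imp_bounded by blast
    then have "bounded (range (\<lambda>t. T0 z (cl t)))"
      by (rule bounded_subset) (use cl_in in auto)
    ultimately show ?thesis by (simp add: bcontfun_def)
  qed
  define T where "T z = Bcontfun (\<lambda>t. T0 (apply_bcontfun z) (cl t))" for z :: "real \<Rightarrow>\<^sub>C real"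
  have T: "apply_bcontfun (T z) t = T0 (apply_bcontfun z) (cl t)" for z t
    unfolding T_def by (subst Bcontfun_inverse) (auto intro!: Tb)
  have contr: "dist (T z) (T w) \<le> 1/2 * dist z w" for z w
  proof (rule dist_bound)
    fix t0 :: real
    define t where "t = cl t0"
    have t: "t \<in> {0..L}" using cl_in t_def by auto
    have zc: "continuous_on {0..L} (apply_bcontfun z)" "continuous_on {0..L} (apply_bcontfun w)" by auto
    have ints: "G z integrable_on {0..t}" "G w integrable_on {0..t}"
      by (rule integrable_continuous_real, rule continuous_on_subset[OF Gc], use t in auto)+
    have e: "((\<lambda>s. K * dist z w * exp (lam * s)) has_integral
          K * dist z w * exp (lam * t) / lam - K * dist z w * exp (lam * 0) / lam) {0..t}"
      by (rule fundamental_theorem_of_calculus)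
         (use t K in \<open>auto simp: lam_def has_real_derivative_iff_has_vector_derivative[symmetric]
            intro!: derivative_eq_intros\<close>)
    have "norm (integral {0..t} (\<lambda>s. G z s - G w s)) \<le> integral {0..t} (\<lambda>s. K * dist z w * exp (lam * s))"
    proof (rule integral_norm_bound_integral)
      show "(\<lambda>s. G z s - G w s) integrable_on {0..t}" using ints by (intro integrable_diff)
      show "(\<lambda>s. K * dist z w * exp (lam * s)) integrable_on {0..t}" using e by blast
      fix s assume s: "s \<in> {0..t}"
      have "\<bar>G z s - G w s\<bar> \<le> K * \<bar>exp (lam * s) * z s - exp (lam * s) * w s\<bar>"
        unfolding G_def by (rule lip) (use s t in auto)
      also have "\<dots> = K * (exp (lam * s) * dist (z s) (w s))"
        by (simp add: dist_real_def abs_mult right_diff_distrib[symmetric])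
      also have "\<dots> \<le> K * (exp (lam * s) * dist z w)"
        using K by (intro mult_left_mono dist_bounded) auto
      finally show "norm (G z s - G w s) \<le> K * dist z w * exp (lam * s)" by (simp add: ac_simps)
    qed
    also have "\<dots> = K * dist z w * exp (lam * t) / lam - K * dist z w * exp (lam * 0) / lam"
      using e by (rule integral_unique)
    also have "\<dots> \<le> dist z w / 2 * exp (lam * t)"
      using K by (simp add: lam_def)
    finally have *: "\<bar>integral {0..t} (G z) - integral {0..t} (G w)\<bar> \<le> dist z w / 2 * exp (lam * t)"
      using ints by (simp add: integral_diff)
    have "dist (T z t0) (T w t0) = exp (- lam * t) * \<bar>integral {0..t} (G z) - integral {0..t} (G w)\<bar>"
      by (simp add: T T0_def t_def[symmetric] dist_real_def abs_mult right_diff_distrib[symmetric])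
    also have "\<dots> \<le> exp (- lam * t) * (dist z w / 2 * exp (lam * t))"
      using * by (intro mult_left_mono) auto
    also have "\<dots> = 1/2 * dist z w" by (simp add: exp_minus field_simps)
    finally show "dist (T z t0) (T w t0) \<le> 1/2 * dist z w" .
  qed
  obtain z where z: "T z = z"
    using banach_fix_type[of "1/2" T] contr by auto
  have zeq: "z t = exp (- lam * t) * integral {0..t} (G z)" if "t \<in> {0..L}" for t
    using T[of z t] that by (simp add: z cl_id T0_def)
  define x where "x t = integral {0..t} (G z)" for t
  have Gx: "G z t = F t (x t)" if "t \<in> {0..L}" for t
    using zeq[OF that] unfolding x_def G_def[of z t] by (simp add: exp_minus field_simps)
  have zc: "continuous_on {0..L} (apply_bcontfun z)" by auto
  have d: "(x has_real_derivative F t (x t)) (at t within {0..L})" if "t \<in> {0..L}" for t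
    using dI[OF zc that] Gx[OF that] unfolding x_def[abs_def] by simp
  have "continuous_on {0..L} x" by (rule DERIV_continuous_on) (rule d)
  moreover have "x 0 = 0" by (simp add: x_def)
  ultimately show ?thesis using d by blast
qed

section \<open>Backward shooting in the phase plane\<close>

text \<open>
  The only comparison argument for the phase plane: if \<open>D\<close> were positive somewhere, it would be
  nondecreasing up to its next zero, which is absurd. The derivative is controlled only where
  \<open>D > 0\<close>, which is where the sign of a difference of two solutions is known.
\<close>
lemma nonpos_backward:
  fixes D :: "real \<Rightarrow> real"
  assumes cont: "continuous_on {a..b} D"
    and der: "\<And>u. a < u \<Longrightarrow> u < b \<Longrightarrow> D u > 0 \<Longrightarrow> \<exists>d\<ge>0. (D has_real_derivative d) (at u)"
    and b: "D b \<le> 0" and u: "u \<in> {a..b}"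
  shows "D u \<le> 0"
proof (rule ccontr)
  assume "\<not> D u \<le> 0"
  then have pos: "D u > 0" by simp
  define S where "S = {u..b} \<inter> D -` {..0}"
  have cub: "continuous_on {u..b} D" using cont by (rule continuous_on_subset) (use u in auto)
  have "closed S" unfolding S_def by (rule continuous_closed_preimage[OF cub]) auto
  moreover have "b \<in> S" using b u by (auto simp: S_def)
  moreover have bb: "bdd_below S" unfolding S_def by auto
  ultimately have v: "Inf S \<in> S" using closed_contains_Inf by blast
  have vS: "u \<le> Inf S" "Inf S \<le> b" "D (Inf S) \<le> 0" using v unfolding S_def by auto
  have below: "D x > 0" if "u \<le> x" "x < Inf S" for x
    using that cInf_lower[OF _ bb, of x] vS by (force simp: S_def)
  have uv: "u < Inf S" using vS pos by (metis not_le order_le_less)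
  have "D u \<le> D (Inf S)"
  proof (rule DERIV_nonneg_imp_increasing_open[where f = D])
    show "continuous_on {u..Inf S} D" using cub by (rule continuous_on_subset) (use vS in auto)
    show "\<exists>y. (D has_real_derivative y) (at x) \<and> 0 \<le> y" if "u < x" "x < Inf S" for x
      using der[of x] below[of x] that u vS by force
  qed (use uv in auto)
  then show False using vS pos by simp
qed

lemma nonpos_forward:
  fixes D :: "real \<Rightarrow> real"
  assumes cont: "continuous_on {a..b} D"
    and der: "\<And>u. a < u \<Longrightarrow> u < b \<Longrightarrow> D u > 0 \<Longrightarrow> \<exists>d\<le>0. (D has_real_derivative d) (at u)"
    and a: "D a \<le> 0" and u: "u \<in> {a..b}"
  shows "D u \<le> 0"
proof -
  have "D (- (- u)) \<le> 0"
  proof (rule nonpos_backward[where D = "\<lambda>v. D (- v)" and a = "-b" and b = "-a"])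
    show "continuous_on {-b..-a} (\<lambda>v. D (- v))"
      by (rule continuous_on_compose2[OF cont]) (auto intro!: continuous_intros)
    fix v assume v: "-b < v" "v < -a" "D (- v) > 0"
    then obtain d where "d \<le> 0" "(D has_real_derivative d) (at (- v))" using der[of "-v"] by auto
    then show "\<exists>d\<ge>0. ((\<lambda>v. D (- v)) has_real_derivative d) (at v)"
      by (intro exI[of _ "-d"]) (auto simp: DERIV_mirror[symmetric])
  qed (use a u in auto)
  then show ?thesis by simp
qed

text \<open>
  The equation for the energy \<open>y = P\<^sup>2 / 2\<close>. Cutting off at zero keeps the right-hand side
  nondecreasing in \<open>y\<close> and lets solutions pass through zero, so that shooting never breaks down.
\<close>
definition energy_profile :: "(real \<Rightarrow> real) \<Rightarrow> real \<Rightarrow> real \<Rightarrow> real \<Rightarrow> (real \<Rightarrow> real) \<Rightarrow> bool" where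
  "energy_profile g c a b y \<longleftrightarrow> continuous_on {a..b} y \<and>
     (\<forall>u\<in>{a<..<b}. (y has_real_derivative c * sqrt (2 * max (y u) 0) - g u) (at u))"

lemma energy_profile_subinterval:
  assumes "energy_profile g c a b y" "a \<le> a'" "b' \<le> b"
  shows "energy_profile g c a' b' y"
  using assms unfolding energy_profile_def by (auto intro: continuous_on_subset)

lemma sqrt_max_mono: "x \<le> y \<Longrightarrow> sqrt (2 * max x 0) \<le> sqrt (2 * max y 0)" for x y :: real
  by auto

text \<open>
  Where \<open>y2 > y1\<close>, the derivative of \<open>y2 - y1\<close> is nonnegative, because the nonlinearity grows both
  with \<open>y\<close> and with the speed.
\<close>
lemma energy_profile_mono:
  assumes y1: "energy_profile g c1 a b y1" and y2: "energy_profile g c2 a b y2"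
    and c: "0 \<le> c1" "c1 \<le> c2" and b: "y2 b \<le> y1 b" and u: "u \<in> {a..b}"
  shows "y2 u \<le> y1 u"
proof -
  have "y2 u - y1 u \<le> 0"
  proof (rule nonpos_backward[where D = "\<lambda>v. y2 v - y1 v" and a = a and b = b])
    show "continuous_on {a..b} (\<lambda>v. y2 v - y1 v)"
      using y1 y2 by (auto simp: energy_profile_def intro!: continuous_intros)
    fix v assume v: "a < v" "v < b" "y2 v - y1 v > 0"
    have "c1 * sqrt (2 * max (y1 v) 0) \<le> c2 * sqrt (2 * max (y2 v) 0)"
      using v c by (intro mult_mono sqrt_max_mono) auto
    moreover have "((\<lambda>v. y2 v - y1 v) has_real_derivative
       (c2 * sqrt (2 * max (y2 v) 0) - g v) - (c1 * sqrt (2 * max (y1 v) 0) - g v)) (at v)"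
      using y1 y2 v by (intro DERIV_diff) (auto simp: energy_profile_def)
    ultimately show "\<exists>d\<ge>0. ((\<lambda>v. y2 v - y1 v) has_real_derivative d) (at v)"
      by (intro exI[of _ "(c2 * sqrt (2 * max (y2 v) 0) - g v) - (c1 * sqrt (2 * max (y1 v) 0) - g v)"]) simp
  qed (use b u in auto)
  then show ?thesis by simp
qed

lemma energy_profile_unique:
  assumes "energy_profile g c a b y1" "energy_profile g c a b y2" "0 \<le> c"
    "y1 b = y2 b" "u \<in> {a..b}"
  shows "y1 u = y2 u"
  using energy_profile_mono[OF assms(1,2,3) order_refl] energy_profile_mono[OF assms(2,1,3) order_refl] assms
  by force

lemma sqrt_shift_lipschitz:
  fixes x y e :: real
  assumes "0 < e"
  shows "\<bar>sqrt (2 * max x 0 + e\<^sup>2) - sqrt (2 * max y 0 + e\<^sup>2)\<bar> \<le> (1 / e) * \<bar>x - y\<bar>"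
proof -
  define p q where "p = sqrt (2 * max x 0 + e\<^sup>2)" and "q = sqrt (2 * max y 0 + e\<^sup>2)"
  have pq: "p \<ge> e" "q \<ge> e" unfolding p_def q_def using assms by (auto intro!: real_le_rsqrt)
  have "p\<^sup>2 - q\<^sup>2 = 2 * max x 0 - 2 * max y 0" unfolding p_def q_def by simp
  then have "(p - q) * (p + q) = 2 * (max x 0 - max y 0)"
    by (simp add: power2_eq_square algebra_simps)
  then have "\<bar>p - q\<bar> * \<bar>p + q\<bar> = 2 * \<bar>max x 0 - max y 0\<bar>"
    by (metis abs_mult abs_numeral)
  then have "\<bar>p - q\<bar> * (p + q) \<le> 2 * \<bar>x - y\<bar>"
    using pq assms by (simp add: max_def split: if_splits)
  moreover have "\<bar>p - q\<bar> * (2 * e) \<le> \<bar>p - q\<bar> * (p + q)"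
    by (intro mult_left_mono) (use pq in auto)
  ultimately have "\<bar>p - q\<bar> * e \<le> \<bar>x - y\<bar>" by simp
  then show ?thesis using assms unfolding p_def q_def by (simp add: field_simps)
qed

lemma sqrt_shift_close:
  fixes x e :: real
  assumes "0 \<le> e"
  shows "sqrt (2 * max x 0) \<le> sqrt (2 * max x 0 + e\<^sup>2)"
    "sqrt (2 * max x 0 + e\<^sup>2) \<le> sqrt (2 * max x 0) + e"
  using assms sqrt_add_le_add_sqrt[of "2 * max x 0" "e\<^sup>2"] by auto

lemma sqrt_max_hoelder:
  fixes p q :: real
  shows "sqrt (2 * max p 0) \<le> sqrt (2 * max q 0) + sqrt (2 * \<bar>p - q\<bar>)"
proof -
  have "sqrt (2 * max p 0) \<le> sqrt (2 * max q 0 + 2 * \<bar>p - q\<bar>)" by (auto simp: max_def abs_real_def)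
  also have "\<dots> \<le> sqrt (2 * max q 0) + sqrt (2 * \<bar>p - q\<bar>)"
    by (rule sqrt_add_le_add_sqrt) auto
  finally show ?thesis .
qed

text \<open>
  Replacing \<open>sqrt (2 y)\<close> by \<open>sqrt (2 y + e\<^sup>2)\<close> makes the right-hand side Lipschitz; the substitution
  \<open>t = b - u\<close> turns the terminal condition into an initial one.
\<close>
lemma regularized_profile_exists:
  assumes ab: "a \<le> b" and e: "0 < e" and c: "0 \<le> c" and g: "continuous_on {a..b} g"
  shows "\<exists>y. continuous_on {a..b} y \<and> y b = 0 \<and> (\<forall>u\<in>{a<..<b}.
     (y has_real_derivative c * sqrt (2 * max (y u) 0 + e\<^sup>2) - g u) (at u))"
proof -
  define F where "F s x = g (b - s) - c * sqrt (2 * max x 0 + e\<^sup>2)" for s x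
  have "\<exists>x. continuous_on {0..b-a} x \<and> x 0 = 0 \<and>
           (\<forall>t\<in>{0..b-a}. (x has_real_derivative F t (x t)) (at t within {0..b-a}))"
  proof (rule picard_on_interval[where K = "c / e + 1"])
    fix x :: "real \<Rightarrow> real" assume x: "continuous_on {0..b-a} x"
    have "continuous_on {0..b-a} (\<lambda>s. g (b - s))"
      by (rule continuous_on_compose2[OF g]) (auto intro!: continuous_intros)
    then show "continuous_on {0..b-a} (\<lambda>s. F s (x s))"
      unfolding F_def by (intro continuous_intros x)
  next
    fix s x y :: real
    have "\<bar>F s x - F s y\<bar> = c * \<bar>sqrt (2 * max x 0 + e\<^sup>2) - sqrt (2 * max y 0 + e\<^sup>2)\<bar>"
    proof -
      have "F s x - F s y = - (c * (sqrt (2 * max x 0 + e\<^sup>2) - sqrt (2 * max y 0 + e\<^sup>2)))"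
        unfolding F_def by (simp add: algebra_simps)
      then show ?thesis using c by (simp only: abs_minus_cancel abs_mult abs_of_nonneg)
    qed
    also have "\<dots> \<le> c * ((1 / e) * \<bar>x - y\<bar>)"
      by (intro mult_left_mono sqrt_shift_lipschitz e c)
    also have "\<dots> \<le> (c / e + 1) * \<bar>x - y\<bar>" by (simp add: algebra_simps)
    finally show "\<bar>F s x - F s y\<bar> \<le> (c / e + 1) * \<bar>x - y\<bar>" .
  qed (use ab c e in \<open>auto intro: add_nonneg_pos\<close>)
  then obtain x where x: "continuous_on {0..b-a} x" "x 0 = 0"
    "\<And>t. t \<in> {0..b-a} \<Longrightarrow> (x has_real_derivative F t (x t)) (at t within {0..b-a})" by blast
  define y where "y u = x (b - u)" for u
  have "continuous_on {a..b} y"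
    unfolding y_def by (rule continuous_on_compose2[OF x(1)]) (auto intro!: continuous_intros)
  moreover have "(y has_real_derivative c * sqrt (2 * max (y u) 0 + e\<^sup>2) - g u) (at u)"
    if "u \<in> {a<..<b}" for u
  proof -
    have "b - u \<in> interior {0..b-a}" using that by simp
    then have "(x has_real_derivative F (b - u) (x (b - u))) (at (b - u))"
      using x(3)[of "b - u"] that by (metis at_within_interior interior_subset subsetD)
      then have "((\<lambda>u. x (b - u)) has_real_derivative F (b - u) (x (b - u)) * (-1)) (at u)"
      by (rule DERIV_chain2) (auto intro!: derivative_eq_intros)
    then show ?thesis unfolding y_def F_def by simp
  qed
  ultimately show ?thesis using x(2) by (intro exI[of _ y]) (auto simp: y_def)
qed

text \<open>
  The regularized solutions converge uniformly without any compactness argument: the comparison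
  principle bounds the distance of two of them by \<open>c (b - a)\<close> times the larger parameter. The
  derivatives converge uniformly as well, since the square root is Hoelder continuous.
\<close>
lemma energy_profile_exists:
  assumes ab: "a \<le> b" and c: "0 \<le> c" and g: "continuous_on {a..b} g"
  shows "\<exists>y. energy_profile g c a b y \<and> y b = 0"
proof -
  define e where "e n = 1 / real (Suc n)" for n
  have e: "e n > 0" for n by (simp add: e_def)
  define s where "s n x = sqrt (2 * max x 0 + (e n)\<^sup>2)" for n x
  define s0 where "s0 x = sqrt (2 * max x 0)" for x :: real
  have s_bd: "s0 x \<le> s n x" "s n x \<le> s0 x + e n" for n x
    unfolding s_def s0_def using sqrt_shift_close[of "e n" x] e[of n] by auto
  have s0_mono: "x \<le> y \<Longrightarrow> s0 x \<le> s0 y" for x y unfolding s0_def by (rule sqrt_max_mono)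
  have "\<forall>n. \<exists>y. continuous_on {a..b} y \<and> y b = 0 \<and> (\<forall>u\<in>{a<..<b}.
     (y has_real_derivative c * s n (y u) - g u) (at u))"
    unfolding s_def using regularized_profile_exists[OF ab e c g] by blast
  then obtain Y where Yc: "\<And>n. continuous_on {a..b} (Y n)" and Yb: "\<And>n. Y n b = 0"
    and Yd: "\<And>n u. u \<in> {a<..<b} \<Longrightarrow> (Y n has_real_derivative c * s n (Y n u) - g u) (at u)"
    by metis
  have close: "Y m u - Y n u \<le> c * e n * (b - a)" if "u \<in> {a..b}" for m n u
  proof -
    have "Y m u - Y n u - c * e n * (b - u) \<le> 0"
    proof (rule nonpos_backward[where D = "\<lambda>u. Y m u - Y n u - c * e n * (b - u)" and a = a and b = b])
      show "continuous_on {a..b} (\<lambda>u. Y m u - Y n u - c * e n * (b - u))"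
        by (intro continuous_intros Yc)
      fix v assume v: "a < v" "v < b" "Y m v - Y n v - c * e n * (b - v) > 0"
      have "0 \<le> c * e n * (b - v)"
        using c less_imp_le[OF e[of n]] v by (intro mult_nonneg_nonneg) auto
      then have "Y n v \<le> Y m v" using v by simp
      then have "s n (Y n v) \<le> s m (Y m v) + e n"
        using s_bd(2)[where n=n and x="Y n v"] s_bd(1)[where n=m and x="Y m v"] s0_mono by force
      then have "c * s n (Y n v) \<le> c * (s m (Y m v) + e n)"
        using c by (rule mult_left_mono)
      moreover have "((\<lambda>u. Y m u - Y n u - c * e n * (b - u)) has_real_derivative
         (c * s m (Y m v) - g v) - (c * s n (Y n v) - g v) - c * e n * (0 - 1)) (at v)"
        using v by (intro DERIV_diff Yd DERIV_cmult DERIV_const DERIV_ident) auto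
      ultimately show "\<exists>d\<ge>0. ((\<lambda>u. Y m u - Y n u - c * e n * (b - u)) has_real_derivative d) (at v)"
        by (intro exI[of _ "(c * s m (Y m v) - g v) - (c * s n (Y n v) - g v) - c * e n * (0 - 1)"])
           (auto simp: algebra_simps)
    qed (use that Yb in auto)
    also have "c * e n * (b - u) \<le> c * e n * (b - a)"
      using c e[of n] that by (intro mult_left_mono) auto
    ultimately show ?thesis by linarith
  qed
  have e0: "e \<longlonglongrightarrow> 0" unfolding e_def by (rule LIMSEQ_Suc[OF lim_1_over_n])
  have small: "(\<lambda>n. c * e n * (b - a)) \<longlonglongrightarrow> 0"
    using tendsto_mult_left_zero[OF tendsto_mult_right_zero[OF e0]] by simp
  have ucauchy: "uniformly_Cauchy_on {a..b} Y"
  proof (rule uniformly_Cauchy_onI)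
    fix r :: real assume "r > 0"
    then obtain M where M: "\<And>n. n \<ge> M \<Longrightarrow> c * e n * (b - a) < r"
      using order_tendstoD(2)[OF small] by (auto simp: eventually_sequentially)
    have "dist (Y m u) (Y n u) < r" if "u \<in> {a..b}" "m \<ge> M" "n \<ge> M" for u m n
      using close[OF that(1), of m n] close[OF that(1), of n m] M[OF that(2)] M[OF that(3)]
      by (auto simp: dist_real_def)
    then show "\<exists>M. \<forall>x\<in>{a..b}. \<forall>m\<ge>M. \<forall>n\<ge>M. dist (Y m x) (Y n x) < r" by blast
  qed
  then obtain y where y: "uniform_limit {a..b} Y y sequentially"
    using uniformly_convergent_eq_Cauchy uniformly_convergent_on_def by metis
  have yc: "continuous_on {a..b} y"
    by (rule uniform_limit_theorem[OF _ y]) (use Yc in auto)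
  have yl: "(\<lambda>n. Y n u) \<longlonglongrightarrow> y u" if "u \<in> {a..b}" for u
    using tendsto_uniform_limitI[OF y that] .
  define del where "del n = c * e n * (b - a)" for n
  have yclose: "\<bar>Y n u - y u\<bar> \<le> del n" if u: "u \<in> {a..b}" for n u
  proof -
    have "y u - Y n u \<le> del n"
      by (rule LIMSEQ_le_const2[OF tendsto_diff[OF yl[OF u] tendsto_const]])
         (use close[OF u] in \<open>simp add: del_def\<close>)
    moreover have "Y n u - y u \<le> del n + 0"
    proof (rule LIMSEQ_le[where X = "\<lambda>m. Y n u - Y m u" and Y = "\<lambda>m. del n + del m"])
      show "(\<lambda>m. Y n u - Y m u) \<longlonglongrightarrow> Y n u - y u" by (intro tendsto_intros yl u)
      show "(\<lambda>m. del n + del m) \<longlonglongrightarrow> del n + 0"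
        unfolding del_def[abs_def] by (intro tendsto_intros small)
      have "del n \<ge> 0" using c e[of n] ab by (simp add: del_def)
      then show "\<exists>N. \<forall>m\<ge>N. Y n u - Y m u \<le> del n + del m"
        using close[OF u] by (intro exI[of _ 0] allI impI) (simp add: del_def add_increasing)
    qed
    ultimately show ?thesis by linarith
  qed
  \<comment> \<open>A bound for the distance of the derivatives: \<open>e n\<close> from the regularization, the square root from
    the distance \<open>del n\<close> of the solutions.\<close>
  define eta where "eta n = c * (e n + sqrt (2 * del n))" for n
  have eta0: "eta \<longlonglongrightarrow> 0"
  proof -
    have "(\<lambda>n. c * (e n + sqrt (2 * del n))) \<longlonglongrightarrow> c * (0 + sqrt (2 * 0))"
      unfolding del_def by (intro tendsto_intros e0 small)
    then show ?thesis by (simp add: eta_def[abs_def])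
  qed
  have sclose: "\<bar>c * s n (Y n u) - c * s0 (y u)\<bar> \<le> eta n" if u: "u \<in> {a..b}" for n u
  proof -
    have h: "sqrt (2 * \<bar>Y n u - y u\<bar>) \<le> sqrt (2 * del n)" using yclose[OF u, of n] by simp
    have "s0 (Y n u) \<le> s0 (y u) + sqrt (2 * del n)"
      unfolding s0_def using sqrt_max_hoelder[of "Y n u" "y u"] h by linarith
    moreover have "s0 (y u) \<le> s0 (Y n u) + sqrt (2 * del n)"
      using sqrt_max_hoelder[of "y u" "Y n u"] h
      unfolding s0_def abs_minus_commute[of "y u" "Y n u"] by linarith
    ultimately have "\<bar>s n (Y n u) - s0 (y u)\<bar> \<le> e n + sqrt (2 * del n)"
      using s_bd[where n=n and x="Y n u"] e[of n] by (simp add: abs_le_iff)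
    then have "c * \<bar>s n (Y n u) - s0 (y u)\<bar> \<le> eta n"
      unfolding eta_def using c by (rule mult_left_mono)
    then show ?thesis using c by (simp add: abs_mult flip: right_diff_distrib)
  qed
  have seq: "\<exists>z. \<forall>x\<in>{a<..<b}. (\<lambda>n. Y n x) \<longlonglongrightarrow> z x \<and>
      (z has_derivative (\<lambda>h. (c * s0 (y x) - g x) * h)) (at x within {a<..<b})"
    if x0: "x0 \<in> {a<..<b}" for x0
  proof (rule has_derivative_sequence[OF _ _ _ x0 yl])
    show "(Y n has_derivative (\<lambda>h. (c * s n (Y n x) - g x) * h)) (at x within {a<..<b})"
      if "x \<in> {a<..<b}" for n x
      using Yd[OF that, of n] by (auto simp: has_field_derivative_def intro: has_derivative_at_withinI)
    fix r :: real assume "r > 0"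
    then have "\<forall>\<^sub>F n in sequentially. eta n < r" using order_tendstoD(2)[OF eta0] by blast
    then show "\<forall>\<^sub>F n in sequentially. \<forall>x\<in>{a<..<b}. \<forall>h.
       norm ((c * s n (Y n x) - g x) * h - (c * s0 (y x) - g x) * h) \<le> r * norm h"
    proof (eventually_elim, safe)
      fix n x h assume n: "eta n < r" and x: "x \<in> {a<..<b}"
      have "norm ((c * s n (Y n x) - g x) * h - (c * s0 (y x) - g x) * h)
          = \<bar>c * s n (Y n x) - c * s0 (y x)\<bar> * \<bar>h\<bar>"
        by (simp add: abs_mult flip: left_diff_distrib)
      also have "\<dots> \<le> r * \<bar>h\<bar>"
        using sclose[of x n] x n by (intro mult_right_mono) auto
      finally show "norm ((c * s n (Y n x) - g x) * h - (c * s0 (y x) - g x) * h) \<le> r * norm h" by simp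
    qed
  qed (use x0 in auto)
  have yd: "(y has_real_derivative c * s0 (y x) - g x) (at x)" if x: "x \<in> {a<..<b}" for x
  proof -
    obtain z where z: "\<And>x. x \<in> {a<..<b} \<Longrightarrow> (\<lambda>n. Y n x) \<longlonglongrightarrow> z x"
      "(z has_derivative (\<lambda>h. (c * s0 (y x) - g x) * h)) (at x within {a<..<b})"
      using seq[OF x] x by blast
    have zy: "z v = y v" if "v \<in> {a<..<b}" for v
      using LIMSEQ_unique[OF z(1)[OF that] yl] that by auto
    have "(z has_real_derivative c * s0 (y x) - g x) (at x)"
      using z(2) x by (simp add: has_field_derivative_def at_within_open[OF x])
    then show ?thesis
      by (rule has_field_derivative_transform_within_open[OF _ open_greaterThanLessThan x]) (rule zy)
  qed
  have "y b = 0" using LIMSEQ_unique[OF yl[of b]] ab Yb by auto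
  then show ?thesis using yc yd unfolding energy_profile_def s0_def by blast
qed

section \<open>Sign, size and dependence on the speed\<close>

text \<open>
  At a first zero a function that was positive before cannot have a positive derivative.
\<close>
lemma no_downcrossing:
  fixes z :: "real \<Rightarrow> real"
  assumes cont: "continuous_on {a..b} z" and a: "z a > 0"
    and up: "\<And>u. a < u \<Longrightarrow> u < b \<Longrightarrow> z u = 0 \<Longrightarrow> \<exists>d>0. (z has_real_derivative d) (at u)"
    and u: "a \<le> u" "u < b"
  shows "z u > 0"
proof (rule ccontr)
  assume "\<not> z u > 0"
  then have nonpos: "z u \<le> 0" by simp
  define S where "S = {a..u} \<inter> z -` {..0}"
  have cau: "continuous_on {a..u} z" using cont by (rule continuous_on_subset) (use u in auto)
  have "closed S" unfolding S_def by (rule continuous_closed_preimage[OF cau]) auto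
  moreover have "u \<in> S" using nonpos u by (auto simp: S_def)
  moreover have bb: "bdd_below S" unfolding S_def by auto
  ultimately have v: "Inf S \<in> S" using closed_contains_Inf by blast
  have vS: "a \<le> Inf S" "Inf S \<le> u" "z (Inf S) \<le> 0" using v unfolding S_def by auto
  have below: "z x > 0" if "a \<le> x" "x < Inf S" for x
    using that cInf_lower[OF _ bb, of x] vS by (force simp: S_def)
  have av: "a < Inf S" using vS a by (metis not_le order_le_less)
  have "\<exists>x\<ge>a. x \<le> Inf S \<and> z x = 0"
    by (rule IVT2') (use vS a av in \<open>auto intro!: continuous_on_subset[OF cau]\<close>)
  then have v0: "z (Inf S) = 0" using below by (metis less_irrefl order_le_less)
  then obtain d where "d > 0" "(z has_real_derivative d) (at (Inf S))" using up av vS u by force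
  then obtain r where r: "r > 0" "\<And>h. 0 < h \<Longrightarrow> h < r \<Longrightarrow> z (Inf S - h) < z (Inf S)"
    using DERIV_pos_inc_left by blast
  define h where "h = min (r/2) (Inf S - a)"
  have "0 < h" "h < r" "a \<le> Inf S - h" using r(1) av by (auto simp: h_def)
  then show False using r(2)[of h] below[of "Inf S - h"] v0 by simp
qed

lemma energy_profile_deriv:
  assumes "energy_profile g c a b y" "a < u" "u < b"
  shows "(y has_real_derivative c * sqrt (2 * max (y u) 0) - g u) (at u)"
  using assms by (simp add: energy_profile_def)

lemma energy_profile_continuous: "energy_profile g c a b y \<Longrightarrow> continuous_on {a..b} y"
  by (simp add: energy_profile_def)

lemma energy_profile_nonneg:
  assumes y: "energy_profile g c a b y" and g: "\<And>u. a < u \<Longrightarrow> u < b \<Longrightarrow> g u \<ge> 0"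
    and b: "0 \<le> y b" and c: "0 \<le> c" and u: "u \<in> {a..b}"
  shows "0 \<le> y u"
proof -
  have "- y u \<le> 0"
  proof (rule nonpos_backward[where D = "\<lambda>u. - y u" and a = a and b = b])
    show "continuous_on {a..b} (\<lambda>u. - y u)" using y by (auto simp: energy_profile_def intro: continuous_intros)
    fix v assume v: "a < v" "v < b" "- y v > 0"
    have "((\<lambda>u. - y u) has_real_derivative - (c * sqrt (2 * max (y v) 0) - g v)) (at v)"
      by (rule DERIV_minus[OF energy_profile_deriv[OF y v(1,2)]])
    then show "\<exists>d\<ge>0. ((\<lambda>u. - y u) has_real_derivative d) (at v)"
      using g[of v] v by (intro exI[of _ "- (c * sqrt (2 * max (y v) 0) - g v)"]) (simp add: max_def)
  qed (use b u in auto)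
  then show ?thesis by simp
qed

text \<open>
  An interior zero of a nonnegative profile would be a minimum, but the equation gives it the
  derivative \<open>- g u \<noteq> 0\<close>.
\<close>
lemma energy_profile_pos:
  assumes y: "energy_profile g c a b y" and g: "\<And>u. a < u \<Longrightarrow> u < b \<Longrightarrow> g u > 0"
    and b: "0 \<le> y b" and c: "0 \<le> c" and u: "a < u" "u < b"
  shows "0 < y u"
proof (rule ccontr)
  have nn: "0 \<le> y v" if "v \<in> {a..b}" for v
    using energy_profile_nonneg[OF y _ b c that] g less_imp_le by blast
  assume "\<not> 0 < y u"
  then have y0: "y u = 0" using nn[of u] u by auto
  have d: "(y has_real_derivative - g u) (at u)"
    using energy_profile_deriv[OF y u] y0 by simp
  have "- g u = 0"
    by (rule DERIV_local_min[OF d, of "min (u - a) (b - u)"]) (use u y0 in \<open>auto intro!: nn\<close>)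
  then show False using g u by force
qed

lemma energy_profile_speed_gap:
  assumes y1: "energy_profile g c1 a b y1" and y2: "energy_profile g c2 a b y2"
    and c: "0 \<le> c1" "c1 \<le> c2" and b: "y1 b = y2 b" and u: "u \<in> {a..b}"
    and S: "\<And>v. v \<in> {a..b} \<Longrightarrow> sqrt (2 * max (y1 v) 0) \<le> S"
  shows "y1 u - y2 u \<le> (c2 - c1) * S * (b - u)"
proof -
  have S0: "0 \<le> S" using S[OF u] by (meson order_trans real_sqrt_ge_zero max.cobounded2 mult_nonneg_nonneg zero_le_numeral)
  have "y1 u - y2 u - (c2 - c1) * S * (b - u) \<le> 0"
  proof (rule nonpos_backward[where D = "\<lambda>v. y1 v - y2 v - (c2 - c1) * S * (b - v)" and a = a and b = b])
    show "continuous_on {a..b} (\<lambda>v. y1 v - y2 v - (c2 - c1) * S * (b - v))"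
      using y1 y2 by (auto simp: energy_profile_def intro!: continuous_intros)
    fix v assume v: "a < v" "v < b"
    have "y2 v \<le> y1 v" using energy_profile_mono[OF y1 y2 c] b v by auto
    then have "c2 * sqrt (2 * max (y2 v) 0) \<le> c2 * sqrt (2 * max (y1 v) 0)"
      using c by (intro mult_left_mono sqrt_max_mono) auto
    moreover have "(c2 - c1) * sqrt (2 * max (y1 v) 0) \<le> (c2 - c1) * S"
      using c S[of v] v by (intro mult_left_mono) auto
    moreover define d where "d = (c1 * sqrt (2 * max (y1 v) 0) - g v) - (c2 * sqrt (2 * max (y2 v) 0) - g v)
        - (c2 - c1) * S * (0 - 1)"
    ultimately have "0 \<le> d" by (simp add: algebra_simps)
    moreover have "((\<lambda>v. y1 v - y2 v - (c2 - c1) * S * (b - v)) has_real_derivative d) (at v)"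
      unfolding d_def using y1 y2 v
      by (intro DERIV_diff DERIV_cmult DERIV_const DERIV_ident) (auto simp: energy_profile_def)
    ultimately show "\<exists>d\<ge>0. ((\<lambda>v. y1 v - y2 v - (c2 - c1) * S * (b - v)) has_real_derivative d) (at v)"
      by blast
  qed (use b u in auto)
  then show ?thesis by simp
qed

text \<open>
  The family is Lipschitz in the speed: all members lie below the one of speed \<open>0\<close>, which bounds
  \<open>sqrt (2 y)\<close> uniformly, and then \<open>energy_profile_speed_gap\<close> applies.
\<close>
lemma energy_profile_continuous_in_speed:
  assumes Y: "\<And>c. 0 \<le> c \<Longrightarrow> energy_profile g c a b (Y c)" and Yb: "\<And>c. 0 \<le> c \<Longrightarrow> Y c b = 0"
    and u: "u \<in> {a..b}"
  shows "continuous_on {0..} (\<lambda>c. Y c u)"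
proof -
  have "compact (Y 0 ` {a..b})"
    using Y[of 0] by (intro compact_continuous_image) (auto simp: energy_profile_def)
  then have "bdd_above (Y 0 ` {a..b})"
    by (intro bounded_imp_bdd_above compact_imp_bounded)
  then obtain M where M: "\<And>v. v \<in> {a..b} \<Longrightarrow> Y 0 v \<le> M" unfolding bdd_above_def by (metis imageI)
  define S where "S = sqrt (2 * max M 0)"
  have S0: "0 \<le> S" by (simp add: S_def)
  have S: "sqrt (2 * max (Y c v) 0) \<le> S" if "0 \<le> c" "v \<in> {a..b}" for c v
    unfolding S_def
    by (rule sqrt_max_mono) (use energy_profile_mono[OF Y Y, of 0 c] that M[of v] Yb in force)
  have gap: "\<bar>Y c1 u - Y c2 u\<bar> \<le> (c2 - c1) * S * (b - u)" if "0 \<le> c1" "c1 \<le> c2" for c1 c2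
    using energy_profile_speed_gap[OF Y Y that _ u S[of c1]] energy_profile_mono[OF Y Y that _ u] that Yb
    by auto
  have gap': "dist (Y c1 u) (Y c2 u) \<le> (S * (b - u)) * dist c1 c2" if "0 \<le> c1" "0 \<le> c2" for c1 c2
  proof (cases "c1 \<le> c2")
    case True
    then show ?thesis using gap[of c1 c2] that by (simp add: dist_real_def ac_simps)
  next
    case False
    then show ?thesis using gap[of c2 c1] that by (simp add: dist_real_def ac_simps abs_minus_commute)
  qed
  have "(S * (b - u))-lipschitz_on {0..} (\<lambda>c. Y c u)"
    by (rule lipschitz_onI) (use gap' S0 u in auto)
  then show ?thesis by (rule lipschitz_on_continuous_on)
qed

text \<open>
  For speed \<open>2 sqrt K\<close> the line \<open>P = sqrt K (u - a)\<close> is a supersolution. This is the bound that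
  ends the shooting interval; \<open>2 sqrt K\<close> is the classical Fisher-KPP speed.
\<close>
lemma energy_profile_hits_zero_fast:
  assumes y: "energy_profile g c a b y" and K: "0 < K" and c: "c = 2 * sqrt K"
    and g: "\<And>u. a < u \<Longrightarrow> u < b \<Longrightarrow> g u \<le> K * (u - a)"
    and b: "y b \<le> 0" and ab: "a \<le> b"
  shows "y a \<le> 0"
proof -
  have "y a - K * (a - a)\<^sup>2 / 2 \<le> 0"
  proof (rule nonpos_backward[where D = "\<lambda>u. y u - K * (u - a)\<^sup>2 / 2" and a = a and b = b])
    show "continuous_on {a..b} (\<lambda>u. y u - K * (u - a)\<^sup>2 / 2)"
      using y by (auto simp: energy_profile_def intro!: continuous_intros)
    fix v assume v: "a < v" "v < b" "y v - K * (v - a)\<^sup>2 / 2 > 0"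
    define d where "d = (c * sqrt (2 * max (y v) 0) - g v) - K * (v - a)"
    have "sqrt (K * (v - a)\<^sup>2) \<le> sqrt (2 * max (y v) 0)"
      using v by (intro real_sqrt_le_mono) (auto simp: max_def)
    then have "sqrt K * (v - a) \<le> sqrt (2 * max (y v) 0)" using v by (simp add: real_sqrt_mult)
    then have "c * (sqrt K * (v - a)) \<le> c * sqrt (2 * max (y v) 0)"
      using c K by (intro mult_left_mono) auto
    moreover have "c * (sqrt K * (v - a)) = 2 * K * (v - a)" using c K by simp
    ultimately have "0 \<le> d" using g[of v] v by (simp add: d_def)
    moreover have "((\<lambda>u. y u - K * (u - a)\<^sup>2 / 2) has_real_derivative d) (at v)"
      unfolding d_def using y v
      by (intro DERIV_diff) (auto simp: energy_profile_def power2_eq_square intro!: derivative_eq_intros)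
    ultimately show "\<exists>d\<ge>0. ((\<lambda>u. y u - K * (u - a)\<^sup>2 / 2) has_real_derivative d) (at v)" by blast
  next
    have "0 \<le> K * (b - a)\<^sup>2 / 2" using K by simp
    then show "y b - K * (b - a)\<^sup>2 / 2 \<le> 0" using b by linarith
  qed (use ab in auto)
  then show ?thesis by simp
qed

lemma energy_profile_quadratic_bound:
  assumes y: "energy_profile g c a b y" and c: "0 \<le> c"
    and g: "\<And>u. a < u \<Longrightarrow> u < b \<Longrightarrow> g u \<le> K * (b - u)"
    and b: "y b \<le> 0" and u: "u \<in> {a..b}"
  shows "y u \<le> K * (b - u)\<^sup>2 / 2"
proof -
  have "y u - K * (b - u)\<^sup>2 / 2 \<le> 0"
  proof (rule nonpos_backward[where D = "\<lambda>u. y u - K * (b - u)\<^sup>2 / 2" and a = a and b = b])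
    show "continuous_on {a..b} (\<lambda>u. y u - K * (b - u)\<^sup>2 / 2)"
      using y by (auto simp: energy_profile_def intro!: continuous_intros)
    fix v assume v: "a < v" "v < b"
    define d where "d = (c * sqrt (2 * max (y v) 0) - g v) - (- K * (b - v))"
    have "0 \<le> c * sqrt (2 * max (y v) 0)" using c by simp
    then have "0 \<le> d" using g[of v] v unfolding d_def by linarith
    moreover have "((\<lambda>u. y u - K * (b - u)\<^sup>2 / 2) has_real_derivative d) (at v)"
      unfolding d_def using y v
      by (intro DERIV_diff)
         (auto simp: energy_profile_def power2_eq_square field_simps intro!: derivative_eq_intros)
    ultimately show "\<exists>d\<ge>0. ((\<lambda>u. y u - K * (b - u)\<^sup>2 / 2) has_real_derivative d) (at v)" by blast
  qed (use b u in auto)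
  then show ?thesis by simp
qed

section \<open>Momentum curves\<close>

lemma momentum_deriv:
  assumes "energy_profile g c a b y" "a < u" "u < b" "0 < y u"
  shows "((\<lambda>v. sqrt (2 * y v)) has_real_derivative c - g u / sqrt (2 * y u)) (at u)"
proof -
  have "(y has_real_derivative c * sqrt (2 * y u) - g u) (at u)"
    using energy_profile_deriv[OF assms(1-3)] assms(4) by (simp add: max_def)
  then have "((\<lambda>v. sqrt (2 * y v)) has_real_derivative
      (2 * (c * sqrt (2 * y u) - g u)) * (inverse (sqrt (2 * y u)) / 2)) (at u)"
    using assms(4) by (auto intro!: derivative_eq_intros)
  moreover have "(2 * (c * sqrt (2 * y u) - g u)) * (inverse (sqrt (2 * y u)) / 2) = c - g u / sqrt (2 * y u)"
    using assms(4) by (simp add: field_simps)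
  ultimately show ?thesis by (simp only:)
qed

text \<open>
  Above the ray of slope \<open>c + K + 1\<close> the momentum grows with rate at most \<open>c + K\<close>, so a curve
  starting at its foot never gets above it.
\<close>
lemma momentum_linear_bound_left:
  assumes y: "energy_profile g c a b y" and c: "0 \<le> c" and K: "0 \<le> K"
    and pos: "\<And>u. a < u \<Longrightarrow> u < b \<Longrightarrow> 0 < y u"
    and g: "\<And>u. a < u \<Longrightarrow> u < b \<Longrightarrow> - g u \<le> K * (u - a)"
    and a: "y a = 0" and u: "u \<in> {a..b}"
  shows "sqrt (2 * y u) \<le> (c + K + 1) * (u - a)"
proof -
  define C where "C = c + K + 1"
  have "sqrt (2 * y u) - C * (u - a) \<le> 0"
  proof (rule nonpos_forward[where D = "\<lambda>u. sqrt (2 * y u) - C * (u - a)" and a = a and b = b])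
    show "continuous_on {a..b} (\<lambda>u. sqrt (2 * y u) - C * (u - a))"
      using y by (auto simp: energy_profile_def intro!: continuous_intros)
    fix v assume v: "a < v" "v < b" "sqrt (2 * y v) - C * (v - a) > 0"
    have P: "0 < sqrt (2 * y v)" using pos v by simp
    have "(v - a) \<le> C * (v - a)"
      using v c K mult_right_mono[of 1 C "v - a"] by (simp add: C_def)
    then have "v - a \<le> sqrt (2 * y v)" using v(3) by linarith
    then have "K * (v - a) \<le> K * sqrt (2 * y v)" using K by (rule mult_left_mono)
    then have "- g v \<le> K * sqrt (2 * y v)" using g[of v] v by simp
    then have "- g v / sqrt (2 * y v) \<le> K" using P by (simp only: divide_le_eq) simp
    then have "c - g v / sqrt (2 * y v) - C * (1 - 0) \<le> 0" by (simp add: C_def)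
    moreover have "((\<lambda>u. sqrt (2 * y u) - C * (u - a)) has_real_derivative
        c - g v / sqrt (2 * y v) - C * (1 - 0)) (at v)"
      by (intro DERIV_diff DERIV_cmult DERIV_ident DERIV_const momentum_deriv[OF y]) (use v pos in auto)
    ultimately show "\<exists>d\<le>0. ((\<lambda>u. sqrt (2 * y u) - C * (u - a)) has_real_derivative d) (at v)" by blast
  qed (use a u in auto)
  then show ?thesis by (simp add: C_def)
qed

text \<open>
  Where \<open>g \<le> 0\<close> the term \<open>- g / P\<close> is larger on the lower curve. So \<open>P1 - P2\<close> has a derivative of at
  most \<open>c1 - c2 < 0\<close>, starts from zero and must become negative, against \<open>y2 \<le> y1\<close>.
\<close>
lemma speed_of_profile_vanishing_left_unique:
  assumes y1: "energy_profile g c1 a b y1" and y2: "energy_profile g c2 a b y2"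
    and c: "c1 < c2" and ab: "a < b"
    and g: "\<And>u. a < u \<Longrightarrow> u < b \<Longrightarrow> g u \<le> 0"
    and pos: "\<And>u. a < u \<Longrightarrow> u < b \<Longrightarrow> 0 < y2 u"
    and le: "\<And>u. u \<in> {a..b} \<Longrightarrow> y2 u \<le> y1 u"
    and a: "y1 a = 0" "y2 a = 0"
  shows False
proof -
  have "sqrt (2 * y1 a) - sqrt (2 * y2 a) > sqrt (2 * y1 b) - sqrt (2 * y2 b)"
  proof (rule DERIV_neg_imp_decreasing_open[where f = "\<lambda>u. sqrt (2 * y1 u) - sqrt (2 * y2 u)", OF ab])
    show "continuous_on {a..b} (\<lambda>u. sqrt (2 * y1 u) - sqrt (2 * y2 u))"
      using y1 y2 by (auto simp: energy_profile_def intro!: continuous_intros)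
    fix u assume u: "a < u" "u < b"
    have p: "0 < y2 u" "0 < y1 u" using pos[OF u] le[of u] u by auto
    have "- g u / sqrt (2 * y1 u) \<le> - g u / sqrt (2 * y2 u)"
      using g[OF u] p le[of u] u by (intro divide_left_mono) auto
    then have "(c1 - g u / sqrt (2 * y1 u)) - (c2 - g u / sqrt (2 * y2 u)) < 0" using c by simp
    moreover have "((\<lambda>u. sqrt (2 * y1 u) - sqrt (2 * y2 u)) has_real_derivative
       (c1 - g u / sqrt (2 * y1 u)) - (c2 - g u / sqrt (2 * y2 u))) (at u)"
      by (intro DERIV_diff momentum_deriv[OF y1] momentum_deriv[OF y2] u p)
    ultimately show "\<exists>d. ((\<lambda>u. sqrt (2 * y1 u) - sqrt (2 * y2 u)) has_real_derivative d) (at u) \<and> d < 0"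
      by blast
  qed
  then show False using le[of b] a ab by simp
qed

text \<open>
  The gap \<open>D = P1 - P2\<close> satisfies \<open>D' = g D / (P1 P2)\<close>, and \<open>g / (P1 P2) \<le> (K / e\<^sup>2) w\<close> since both
  momenta lie above \<open>e u\<close>. Hence \<open>D\<close> shrinks towards \<open>0\<close> by at most the factor
  \<open>exp (- (K / e\<^sup>2) W u0)\<close>. The lemma is applied with \<open>w = A' u / u\<close>, where
  \<open>W = \<Lambda>\<close>.
\<close>
lemma profile_gap_survives:
  assumes y1: "energy_profile g c 0 b y1" and y2: "energy_profile g c 0 b y2"
    and e: "0 < e" and K: "0 \<le> K"
    and below: "\<And>u. 0 < u \<Longrightarrow> u < b \<Longrightarrow> e * u \<le> sqrt (2 * y2 u)"
    and le: "\<And>u. 0 < u \<Longrightarrow> u < b \<Longrightarrow> y2 u \<le> y1 u"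
    and g: "\<And>u. 0 < u \<Longrightarrow> u < b \<Longrightarrow> g u \<le> K * u\<^sup>2 * w u"
    and w: "\<And>u. 0 < u \<Longrightarrow> u < b \<Longrightarrow> 0 \<le> w u"
    and W: "\<And>u. 0 < u \<Longrightarrow> u < b \<Longrightarrow> (W has_real_derivative w u) (at u)"
    and W0: "\<And>u. 0 < u \<Longrightarrow> u < b \<Longrightarrow> 0 \<le> W u"
    and u0: "0 < u0" "u0 < b" "y2 u0 < y1 u0"
  shows "0 < y1 0"
proof -
  define k where "k = K / e\<^sup>2"
  define D where "D u = sqrt (2 * y1 u) - sqrt (2 * y2 u)" for u
  \<comment> \<open>The integrating factor for \<open>D' \<le> k w D\<close>.\<close>
  define E where "E u = D u * exp (- k * W u)" for u
  have E0: "0 < E u0" using u0 by (simp add: E_def D_def)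
  have Dge: "E u0 \<le> D u" if u: "0 < u" "u \<le> u0" for u
  proof -
    have "E u \<ge> E u0"
    proof (rule DERIV_nonpos_imp_nonincreasing[where f = E, OF u(2)])
      fix v assume v: "u \<le> v" "v \<le> u0"
      then have v': "0 < v" "v < b" using u u0 by auto
      define P1 P2 where "P1 = sqrt (2 * y1 v)" and "P2 = sqrt (2 * y2 v)"
      have ev: "0 < e * v" using e v' by simp
      have P2: "e * v \<le> P2" "0 < P2" using below[OF v'] ev unfolding P2_def by linarith+
      have P12: "P2 \<le> P1" using le[OF v'] by (simp add: P1_def P2_def)
      have yp: "0 < y2 v" "0 < y1 v" using P2(2) P12 by (auto simp: P1_def P2_def)
      have "(e * v) * (e * v) \<le> P1 * P2" using P2 P12 ev by (intro mult_mono) auto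
      then have ee: "e\<^sup>2 * v\<^sup>2 \<le> P1 * P2" by (simp add: power2_eq_square ac_simps)
      have kw: "0 \<le> k * w v" using K w[OF v'] by (simp add: k_def)
      have "g v \<le> (k * w v) * (e\<^sup>2 * v\<^sup>2)" using g[OF v'] e by (simp add: k_def ac_simps)
      also have "\<dots> \<le> (k * w v) * (P1 * P2)" by (rule mult_left_mono[OF ee kw])
      finally have "g v / (P1 * P2) \<le> k * w v" using P2 P12 by (simp add: divide_le_eq)
      then have "g v / (P1 * P2) * D v \<le> k * w v * D v"
        by (rule mult_right_mono) (use P12 in \<open>simp add: D_def P1_def P2_def\<close>)
      moreover have "g v / (P1 * P2) * D v = (c - g v / P1) - (c - g v / P2)"
        using P2 P12 unfolding D_def P1_def[symmetric] P2_def[symmetric] by (simp add: field_simps)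
      ultimately have neg: "(c - g v / P1) - (c - g v / P2) - k * w v * D v \<le> 0" by simp
      have "(D has_real_derivative (c - g v / P1) - (c - g v / P2)) (at v)"
        unfolding D_def[abs_def] P1_def P2_def
        by (intro DERIV_diff momentum_deriv[OF y1] momentum_deriv[OF y2] v' yp)
      then have "(E has_real_derivative ((c - g v / P1) - (c - g v / P2) - k * w v * D v) * exp (- k * W v)) (at v)"
        unfolding E_def[abs_def] using W[OF v'] by (auto intro!: derivative_eq_intros simp: algebra_simps)
      then show "\<exists>d. (E has_real_derivative d) (at v) \<and> d \<le> 0"
        using neg by (intro exI[of _ "((c - g v / P1) - (c - g v / P2) - k * w v * D v) * exp (- k * W v)"] conjI
            mult_nonpos_nonneg) auto
    qed
    moreover have "E u \<le> D u"
    proof -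
      have "0 \<le> D u" using le[of u] u u0 by (simp add: D_def)
      moreover have "exp (- k * W u) \<le> 1" using W0[of u] u u0 K by (simp add: k_def)
      ultimately show ?thesis unfolding E_def by (metis mult_left_mono mult.right_neutral)
    qed
    ultimately show ?thesis by linarith
  qed
  have cont: "continuous_on {0..b} D"
    using y1 y2 by (auto simp: energy_profile_def D_def intro!: continuous_intros)
  have "(D \<longlongrightarrow> D 0) (at_right 0)"
    using cont u0 by (intro continuous_on_Icc_at_rightD[where b=b]) auto
  moreover have "eventually (\<lambda>u. E u0 \<le> D u) (at_right 0)"
    using eventually_at_right_less[of 0] eventually_at_rightI[of 0 u0 "\<lambda>u. u < u0"] u0
    by (auto intro!: eventually_at_rightI[of 0 u0] Dge)
  ultimately have "E u0 \<le> D 0"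
    by (intro tendsto_lowerbound[of D _ "at_right 0"]) auto
  moreover have "0 \<le> y2 0"
  proof -
    have c2: "continuous_on {0..b} y2" using y2 by (simp add: energy_profile_def)
    have "eventually (\<lambda>u. 0 \<le> y2 u) (at_right 0)"
    proof (rule eventually_at_rightI[of 0 b])
      fix u assume "u \<in> {0<..<b}"
      then have "0 < e * u" "e * u \<le> sqrt (2 * y2 u)" using e below[of u] by auto
      then have "0 < sqrt (2 * y2 u)" by linarith
      then show "0 \<le> y2 u" by simp
    qed (use u0 in auto)
    then show ?thesis
      using continuous_on_Icc_at_rightD[OF c2] u0 by (intro tendsto_lowerbound[of y2 _ "at_right 0"]) auto
  qed
  ultimately have "0 < sqrt (2 * y1 0)" using E0 unfolding D_def
    by (smt (verit) real_sqrt_ge_zero mult_nonneg_nonneg)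
  then show ?thesis by simp
qed

text \<open>
  Below the threshold the curves start above the origin and cannot cross the ray of slope \<open>cs / 3\<close>
  downwards near \<open>0\<close>; the threshold curve inherits this as a limit. Then \<open>g / P \<longlonglongrightarrow> 0\<close>, so the
  slope \<open>P'\<close> tends to \<open>cs\<close>.
\<close>
lemma threshold_momentum_slope:
  assumes Y: "\<And>c. c0 \<le> c \<Longrightarrow> c \<le> cs \<Longrightarrow> energy_profile g c 0 b (Y c)"
    and c0: "0 \<le> c0" "c0 < cs" and b: "0 < b"
    and pos: "\<And>c u. c0 \<le> c \<Longrightarrow> c \<le> cs \<Longrightarrow> 0 < u \<Longrightarrow> u < b \<Longrightarrow> 0 < Y c u"
    and below: "\<And>c. c0 \<le> c \<Longrightarrow> c < cs \<Longrightarrow> 0 < Y c 0"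
    and thr: "Y cs 0 = 0"
    and cont: "\<And>u. 0 < u \<Longrightarrow> u < b \<Longrightarrow> ((\<lambda>c. Y c u) \<longlongrightarrow> Y cs u) (at_left cs)"
    and g: "((\<lambda>u. g u / u) \<longlongrightarrow> 0) (at_right 0)"
  shows "((\<lambda>u. sqrt (2 * Y cs u) / u) \<longlongrightarrow> cs) (at_right 0)"
proof -
  \<comment> \<open>Speeds of at least \<open>2 cs / 3\<close> leave room: on the ray \<open>P = e u\<close> one has
    \<open>P' \<ge> 2 e - g / (e u) > e\<close> as soon as \<open>g u < e\<^sup>2 u / 2\<close>.\<close>
  define e where "e = cs / 3"
  have e: "0 < e" using c0 by (simp add: e_def)
  have "eventually (\<lambda>u. g u / u < e\<^sup>2 / 2) (at_right 0)"
    using e by (intro order_tendstoD(2)[OF g]) auto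
  then obtain d0 where d0: "0 < d0" "\<And>u. 0 < u \<Longrightarrow> u < d0 \<Longrightarrow> g u / u < e\<^sup>2 / 2"
    by (auto simp: eventually_at_right_field)
  define d where "d = min d0 b"
  have d: "0 < d" "d \<le> b" using d0 b by (auto simp: d_def)
  have gs: "g u < e\<^sup>2 / 2 * u" if "0 < u" "u < d" for u
    using d0(2)[of u] that by (simp add: d_def field_simps)
  have low: "e\<^sup>2 * u\<^sup>2 / 2 \<le> Y c u" if c: "max c0 (2 * cs / 3) \<le> c" "c < cs" and u: "0 < u" "u < d" for c u
  proof -
    have yc: "energy_profile g c 0 d (Y c)"
      by (rule energy_profile_subinterval[OF Y]) (use c d in auto)
    have "0 < Y c u - e\<^sup>2 * u\<^sup>2 / 2"
    proof (rule no_downcrossing[where z = "\<lambda>u. Y c u - e\<^sup>2 * u\<^sup>2 / 2" and a = 0 and b = d])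
      show "continuous_on {0..d} (\<lambda>u. Y c u - e\<^sup>2 * u\<^sup>2 / 2)"
        using yc by (auto simp: energy_profile_def intro!: continuous_intros)
      fix v assume v: "0 < v" "v < d" "Y c v - e\<^sup>2 * v\<^sup>2 / 2 = 0"
      then have yv: "2 * max (Y c v) 0 = (e * v)\<^sup>2"
        proof -
        have "Y c v = (e * v)\<^sup>2 / 2" using v(3) by (simp add: power_mult_distrib)
        moreover have "0 \<le> (e * v)\<^sup>2 / 2" by simp
        ultimately show ?thesis by (simp only: max.absorb1)
      qed
      have sq: "sqrt (2 * max (Y c v) 0) = e * v" unfolding yv using e v by simp
      define p where "p = c * (e * v) - g v - e\<^sup>2 * v"
      have "2 * e \<le> c" using c by (simp add: e_def)
      then have "2 * e * (e * v) \<le> c * (e * v)" using e v by (intro mult_right_mono) auto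
      then have "e\<^sup>2 / 2 * v \<le> c * (e * v) - e\<^sup>2 / 2 * v - e\<^sup>2 * v"
        by (simp add: power2_eq_square algebra_simps)
      moreover have "0 < e\<^sup>2 / 2 * v" using e v by simp
      ultimately have "0 < p" using gs[OF v(1,2)] unfolding p_def by linarith
      moreover have "(Y c has_real_derivative c * (e * v) - g v) (at v)"
        using energy_profile_deriv[OF yc v(1,2)] sq by simp
      then have "((\<lambda>u. Y c u - e\<^sup>2 * u\<^sup>2 / 2) has_real_derivative p) (at v)"
        unfolding p_def by (intro DERIV_diff) (auto simp: power2_eq_square intro!: derivative_eq_intros)
      ultimately show "\<exists>d>0. ((\<lambda>u. Y c u - e\<^sup>2 * u\<^sup>2 / 2) has_real_derivative d) (at v)" by blast
    qed (use below c u in auto)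
    then show ?thesis by simp
  qed
  have low_cs: "e * u \<le> sqrt (2 * Y cs u)" if u: "0 < u" "u < d" for u
  proof -
    have "eventually (\<lambda>c. e\<^sup>2 * u\<^sup>2 / 2 \<le> Y c u) (at_left cs)"
      by (rule eventually_at_leftI[of "max c0 (2 * cs / 3)"]) (use low u c0 in auto)
    then have "e\<^sup>2 * u\<^sup>2 / 2 \<le> Y cs u"
      using cont[of u] u d by (intro tendsto_lowerbound[of _ _ "at_left cs"]) auto
    then have "(e * u)\<^sup>2 \<le> 2 * Y cs u" by (simp add: power_mult_distrib)
    then show ?thesis by (rule real_le_rsqrt)
  qed
  have ycs: "energy_profile g cs 0 b (Y cs)" using Y c0 by simp
  have ev: "eventually (\<lambda>u. 0 < u \<and> u < d) (at_right 0)"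
    by (rule eventually_at_rightI[of 0 d]) (use d in auto)
  show ?thesis
  proof (rule lhopital_right_0[where f' = "\<lambda>u. cs - g u / sqrt (2 * Y cs u)" and g' = "\<lambda>u. 1"])
    have "continuous_on {0..b} (\<lambda>u. sqrt (2 * Y cs u))"
      using ycs by (auto simp: energy_profile_def intro!: continuous_intros)
    then show "((\<lambda>u. sqrt (2 * Y cs u)) \<longlongrightarrow> 0) (at_right 0)"
      using continuous_on_Icc_at_rightD[of 0 b] b thr by fastforce
    show "((\<lambda>u::real. u) \<longlongrightarrow> 0) (at_right 0)" by (rule tendsto_ident_at)
    show "eventually (\<lambda>u::real. u \<noteq> 0) (at_right 0)" using ev by eventually_elim auto
    show "eventually (\<lambda>u::real. (1::real) \<noteq> 0) (at_right 0)" by simp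
    show "eventually (\<lambda>u. ((\<lambda>u. sqrt (2 * Y cs u)) has_real_derivative cs - g u / sqrt (2 * Y cs u)) (at u)) (at_right 0)"
      using ev by eventually_elim (use d pos[of cs] c0 in \<open>auto intro!: momentum_deriv[OF ycs]\<close>)
    show "eventually (\<lambda>u::real. ((\<lambda>u. u) has_real_derivative 1) (at u)) (at_right 0)" by simp
    have "((\<lambda>u. g u / sqrt (2 * Y cs u)) \<longlongrightarrow> 0) (at_right 0)"
    proof (rule Lim_null_comparison)
      show "((\<lambda>u. \<bar>g u / u\<bar> / e) \<longlongrightarrow> 0) (at_right 0)"
        using tendsto_divide[OF tendsto_rabs[OF g] tendsto_const, of e] e by simp
      show "eventually (\<lambda>u. norm (g u / sqrt (2 * Y cs u)) \<le> \<bar>g u / u\<bar> / e) (at_right 0)"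
        using ev
      proof eventually_elim
        case (elim u)
        then have "0 < e * u" using e by simp
        then have "\<bar>g u\<bar> / sqrt (2 * Y cs u) \<le> \<bar>g u\<bar> / (e * u)"
          using low_cs[of u] elim e by (intro divide_left_mono mult_pos_pos less_le_trans[OF _ low_cs]) auto
        moreover have P0: "0 \<le> sqrt (2 * Y cs u)" using low_cs[of u] elim \<open>0 < e * u\<close> by linarith
        have "norm (g u / sqrt (2 * Y cs u)) = \<bar>g u\<bar> / sqrt (2 * Y cs u)"
          by (simp only: real_norm_def abs_divide abs_of_nonneg[OF P0])
        moreover have "\<bar>g u\<bar> / (e * u) = \<bar>g u / u\<bar> / e"
          using elim e by (simp add: abs_divide field_simps)
        ultimately show ?case by (simp only:)
      qed
    qed
    then show "((\<lambda>u. (cs - g u / sqrt (2 * Y cs u)) / 1) \<longlongrightarrow> cs) (at_right 0)"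
      using tendsto_diff[OF tendsto_const, of "\<lambda>u. g u / sqrt (2 * Y cs u)" 0 "at_right 0" cs] by simp
  qed
qed

section \<open>Smooth bumps and the weak formulation\<close>

text \<open>
  Existence of derivatives up to a given order, in a form that allows inductive proofs of closure
  properties without mentioning iterated derivatives.
\<close>
primrec times_differentiable :: "nat \<Rightarrow> (real \<Rightarrow> real) \<Rightarrow> bool" where
  "times_differentiable 0 f \<longleftrightarrow> True"
| "times_differentiable (Suc n) f \<longleftrightarrow>
     (\<exists>f'. (\<forall>x. (f has_real_derivative f' x) (at x)) \<and> times_differentiable n f')"

lemma times_differentiable_SucI:
  "(\<And>x. (f has_real_derivative f' x) (at x)) \<Longrightarrow> times_differentiable n f' \<Longrightarrow> times_differentiable (Suc n) f"
  by auto

lemma times_differentiable_Suc_D: "times_differentiable (Suc n) f \<Longrightarrow> times_differentiable n f"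
  by (induction n arbitrary: f) auto

lemma times_differentiable_add:
  "times_differentiable n f \<Longrightarrow> times_differentiable n g \<Longrightarrow> times_differentiable n (\<lambda>x. f x + g x)"
proof (induction n arbitrary: f g)
  case (Suc n)
  then obtain f' g' where d: "\<And>x. (f has_real_derivative f' x) (at x)" "\<And>x. (g has_real_derivative g' x) (at x)"
    and t: "times_differentiable n f'" "times_differentiable n g'" by auto
  show ?case by (rule times_differentiable_SucI[OF DERIV_add[OF d] Suc.IH[OF t]])
qed auto

lemma times_differentiable_mult:
  "times_differentiable n f \<Longrightarrow> times_differentiable n g \<Longrightarrow> times_differentiable n (\<lambda>x. f x * g x)"
proof (induction n arbitrary: f g)
  case (Suc n)
  then obtain f' g' where d: "\<And>x. (f has_real_derivative f' x) (at x)" "\<And>x. (g has_real_derivative g' x) (at x)"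
    and t: "times_differentiable n f'" "times_differentiable n g'" by auto
  note fg = Suc.prems[THEN times_differentiable_Suc_D]
  show ?case
    by (rule times_differentiable_SucI[OF DERIV_mult[OF d]
          times_differentiable_add[OF Suc.IH[OF t(1) fg(2)] Suc.IH[OF t(2) fg(1)]]])
qed auto

lemma times_differentiable_const: "times_differentiable n (\<lambda>x. k)"
proof (induction n arbitrary: k)
  case (Suc n)
  show ?case by (rule times_differentiable_SucI[OF DERIV_const Suc])
qed auto

lemma times_differentiable_affine:
  "times_differentiable n f \<Longrightarrow> times_differentiable n (\<lambda>x. f (r * x + s))"
proof (induction n arbitrary: f)
  case (Suc n)
  then obtain f' where d: "\<And>x. (f has_real_derivative f' x) (at x)"
    and t: "times_differentiable n f'" by auto
  have "((\<lambda>x. f (r * x + s)) has_real_derivative f' (r * x + s) * r) (at x)" for x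
    by (rule DERIV_chain2[OF d]) (auto intro!: derivative_eq_intros)
  then show ?case
    by (rule times_differentiable_SucI)
       (intro times_differentiable_mult Suc.IH[OF t] times_differentiable_const)
qed auto

lemma times_differentiable_deriv_within:
  assumes "times_differentiable (Suc n) f"
  shows "f differentiable_on UNIV" "times_differentiable n (deriv_within UNIV f)"
proof -
  obtain f' where d: "\<And>x. (f has_real_derivative f' x) (at x)"
    and t: "times_differentiable n f'" using assms by auto
  show "f differentiable_on UNIV"
    using d by (auto simp: differentiable_on_def real_differentiable_def)
  have "deriv_within UNIV f = f'"
    using d by (auto simp: deriv_within_def fun_eq_iff has_real_derivative_iff_has_vector_derivative
        intro!: vector_derivative_at)
  then show "times_differentiable n (deriv_within UNIV f)" using t by simp
qed

lemma smooth_on_UNIV_I: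
  assumes "\<And>n. times_differentiable n f"
  shows "smooth_on UNIV f"
proof -
  have t: "times_differentiable n ((deriv_within UNIV ^^ k) f)" for n k
  proof (induction k arbitrary: n)
    case (Suc k)
    show ?case using times_differentiable_deriv_within(2)[OF Suc[of "Suc n"]] by simp
  qed (use assms in auto)
  have "(deriv_within UNIV ^^ k) f differentiable_on UNIV" for k
    using times_differentiable_deriv_within(1)[OF t] .
  then show ?thesis
    by (auto simp: smooth_on_def Ck_on_def intro: differentiable_imp_continuous_on)
qed

text \<open>
  The derivative of \<open>exp (- 1 / x) / x ^ k\<close> is a combination of functions of the same kind, so this
  family shows the smoothness of the flat exponential \<open>flat_exp 0\<close> by one induction.
\<close>
definition flat_exp :: "nat \<Rightarrow> real \<Rightarrow> real" where
  "flat_exp k x = (if x > 0 then exp (- 1 / x) / x ^ k else 0)"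

lemma flat_exp_tendsto_0: "(flat_exp k \<longlongrightarrow> 0) (at 0)"
proof -
  have "((\<lambda>x. inverse x ^ k / exp (inverse x)) \<longlongrightarrow> (0::real)) (at_right 0)"
    using filterlim_compose[OF tendsto_power_div_exp_0 filterlim_inverse_at_top_right] .
  moreover have "eventually (\<lambda>x. inverse x ^ k / exp (inverse x) = flat_exp k x) (at_right 0)"
    by (rule eventually_at_rightI[of 0 1])
       (auto simp: flat_exp_def exp_minus field_simps inverse_eq_divide)
  ultimately have "(flat_exp k \<longlongrightarrow> 0) (at_right 0)" by (rule Lim_transform_eventually)
  moreover have "eventually (\<lambda>x. 0 = flat_exp k x) (at_left 0)"
    by (rule eventually_at_leftI[of "-1"]) (auto simp: flat_exp_def)
  then have "(flat_exp k \<longlongrightarrow> 0) (at_left 0)"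
    by (rule Lim_transform_eventually[OF tendsto_const])
  ultimately show ?thesis by (simp add: filterlim_at_split)
qed

lemma flat_exp_deriv:
  "(flat_exp k has_real_derivative (flat_exp (k + 2) x + (- real k) * flat_exp (k + 1) x)) (at x)"
proof -
  consider "x > 0" | "x < 0" | "x = 0" by linarith
  then show ?thesis
  proof cases
    case 1
    have e: "((\<lambda>x. exp (- 1 / x)) has_real_derivative exp (- 1 / x) / x\<^sup>2) (at x)"
      using 1 by (auto intro!: derivative_eq_intros simp: power2_eq_square)
    have "((\<lambda>x. exp (- 1 / x) / x ^ k) has_real_derivative
       (flat_exp (k + 2) x + (- real k) * flat_exp (k + 1) x)) (at x)"
      by (rule DERIV_cong[OF DERIV_quotient[OF e DERIV_pow]])
         (use 1 in \<open>cases k; auto simp: flat_exp_def field_simps power2_eq_square\<close>)+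
    then show ?thesis
      by (rule has_field_derivative_transform_within_open[OF _ open_greaterThan[of 0]])
         (use 1 in \<open>auto simp: flat_exp_def\<close>)
  next
    case 2
    have "((\<lambda>x. 0) has_real_derivative 0) (at x)" by simp
    then have "(flat_exp k has_real_derivative 0) (at x)"
      by (rule has_field_derivative_transform_within_open[OF _ open_lessThan[of 0]])
         (use 2 in \<open>auto simp: flat_exp_def\<close>)
    then show ?thesis using 2 by (simp add: flat_exp_def)
  next
    case 3
    \<comment> \<open>At zero the difference quotient is again a member of the family.\<close>
    have "eventually (\<lambda>y. flat_exp (k + 1) y = (flat_exp k y - flat_exp k 0) / (y - 0)) (at 0)"
      by (auto simp: eventually_at_filter flat_exp_def)
    then have "((\<lambda>y. (flat_exp k y - flat_exp k 0) / (y - 0)) \<longlongrightarrow> 0) (at 0)"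
      by (rule Lim_transform_eventually[OF flat_exp_tendsto_0])
    then have "(flat_exp k has_real_derivative 0) (at 0)"
      by (simp add: has_field_derivative_iff)
    then show ?thesis using 3 by (simp add: flat_exp_def)
  qed
qed

lemma times_differentiable_flat_exp: "times_differentiable n (flat_exp k)"
proof (induction n arbitrary: k)
  case (Suc n)
  show ?case
    by (rule times_differentiable_SucI[OF flat_exp_deriv])
       (intro times_differentiable_add times_differentiable_mult times_differentiable_const Suc)
qed auto

definition bump :: "real \<Rightarrow> real \<Rightarrow> real \<Rightarrow> real" where
  "bump p q x = flat_exp 0 (x - p) * flat_exp 0 (q - x)"

lemma times_differentiable_bump: "times_differentiable n (bump p q)"
proof -
  have "times_differentiable n (\<lambda>x. flat_exp 0 (1 * x + (- p)) * flat_exp 0 ((-1) * x + q))"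
    by (intro times_differentiable_mult times_differentiable_affine times_differentiable_flat_exp)
  then show ?thesis by (simp add: bump_def[abs_def] add.commute)
qed

lemma bump_outside: "x \<le> p \<or> q \<le> x \<Longrightarrow> bump p q x = 0"
  by (auto simp: bump_def flat_exp_def)

lemma bump_nonneg: "0 \<le> bump p q x" by (auto simp: bump_def flat_exp_def)

lemma bump_pos: "p < x \<Longrightarrow> x < q \<Longrightarrow> 0 < bump p q x"
  by (auto simp: bump_def flat_exp_def)

lemma times_differentiable_continuous:
  "times_differentiable (Suc 0) f \<Longrightarrow> continuous_on UNIV f"
  using times_differentiable_deriv_within(1) differentiable_imp_continuous_on by blast

lemma bump_continuous: "continuous_on S (bump p q)"
  using continuous_on_subset[OF times_differentiable_continuous[OF times_differentiable_bump]] by blast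

lemma antiderivative_on_line:
  fixes f :: "real \<Rightarrow> real"
  assumes "continuous_on UNIV f"
  obtains F where "\<And>x. (F has_real_derivative f x) (at x)"
proof -
  have "\<exists>F. \<forall>x::real. (-\<infinity>::ereal) < ereal x \<longrightarrow> ereal x < \<infinity> \<longrightarrow> (F has_vector_derivative f x) (at x)"
    by (rule einterval_antiderivative) (use assms in \<open>auto simp: continuous_on_eq_continuous_at\<close>)
  then show ?thesis using that by (auto simp: has_real_derivative_iff_has_vector_derivative)
qed

text \<open>
  Integrating a bump twice from the left gives a function that is zero to the left of the bump and
  affine to the right of it. Its second difference has compact support.
\<close>
lemma test_function_with_second_difference:
  assumes pq: "p < q"
  obtains \<phi> where "test_function \<phi>"
    "\<And>x. deriv (deriv \<phi>) x = bump p q (x + t) - 2 * bump p q x + bump p q (x - t)"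
proof -
  obtain F where F: "\<And>x. (F has_real_derivative bump p q x) (at x)"
    using antiderivative_on_line[OF bump_continuous] by blast
  define B1 where "B1 x = F x - F p" for x
  have B1: "(B1 has_real_derivative bump p q x) (at x)" for x
    using DERIV_diff[OF F DERIV_const] by (simp add: B1_def[abs_def])
  have const: "k x = k y" if "convex S" "x \<in> S" "y \<in> S" "\<And>x. x \<in> S \<Longrightarrow> (k has_real_derivative 0) (at x)"
    for k :: "real \<Rightarrow> real" and S x y
    using has_field_derivative_zero_constant[OF that(1), of k] that(2-4)
    by (metis has_field_derivative_at_within)
  have B1_left: "B1 x = 0" if "x \<le> p" for x
    using const[of "{..p}" x p B1] that B1 bump_outside[of _ p q]
    by (metis B1_def atMost_iff convex_real_interval(2) diff_self order_refl)
  have B1_right: "B1 x = B1 q" if "q \<le> x" for x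
    using const[of "{q..}" x q B1] that B1 bump_outside[of _ p q]
    by (metis atLeast_iff convex_real_interval(1) order_refl)
  have "continuous_on UNIV B1" by (rule DERIV_continuous_on) (use B1 in auto)
  then obtain G where G: "\<And>x. (G has_real_derivative B1 x) (at x)"
    using antiderivative_on_line by blast
  define B2 where "B2 x = G x - G p" for x
  have B2: "(B2 has_real_derivative B1 x) (at x)" for x
    using DERIV_diff[OF G DERIV_const] by (simp add: B2_def[abs_def])
  have B2_left: "B2 x = 0" if "x \<le> p" for x
    using const[of "{..p}" x p B2] that B2 B1_left
    by (metis B2_def atMost_iff convex_real_interval(2) diff_self order_refl)
  have B2_right: "B2 x = B2 q + B1 q * (x - q)" if "q \<le> x" for x
  proof -
    have "B2 x - B1 q * x = B2 q - B1 q * q"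
    proof (rule const[of "{q..}" x q "\<lambda>x. B2 x - B1 q * x"])
      fix v assume "v \<in> {q..}"
      then have "B1 v - B1 q * 1 = 0" using B1_right[of v] by simp
      then show "((\<lambda>x. B2 x - B1 q * x) has_real_derivative 0) (at v)"
        using DERIV_diff[OF B2[of v] DERIV_cmult[OF DERIV_ident, of "B1 q" v UNIV]] by metis
    qed (use that in \<open>auto intro: convex_real_interval\<close>)
    then show ?thesis by (simp add: algebra_simps)
  qed
  have shift: "((\<lambda>x. k (x + s)) has_real_derivative k' (x + s)) (at x)"
    if "\<And>x. (k has_real_derivative k' x) (at x)" for k k' :: "real \<Rightarrow> real" and s x
    using that[of "x + s"] by (simp add: DERIV_shift)
  have diff2: "((\<lambda>x. k (x + t) - 2 * k x + k (x - t)) has_real_derivative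
      k' (x + t) - 2 * k' x + k' (x - t)) (at x)"
    if "\<And>x. (k has_real_derivative k' x) (at x)" for k k' :: "real \<Rightarrow> real" and x
    using shift[OF that, of "t" x] shift[OF that, of "-t" x]
    by (intro DERIV_add DERIV_diff DERIV_cmult that) auto
  define \<phi> where "\<phi> x = B2 (x + t) - 2 * B2 x + B2 (x - t)" for x
  have d1: "deriv \<phi> = (\<lambda>x. B1 (x + t) - 2 * B1 x + B1 (x - t))"
    unfolding \<phi>_def using diff2[OF B2] by (auto intro!: DERIV_imp_deriv)
  have d2: "deriv (deriv \<phi>) x = bump p q (x + t) - 2 * bump p q x + bump p q (x - t)" for x
    unfolding d1 using diff2[OF B1] by (auto intro!: DERIV_imp_deriv)
  have smB2: "times_differentiable n B2" for n
    by (rule times_differentiable_Suc_D, rule times_differentiable_SucI[OF B2],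
        rule times_differentiable_Suc_D, rule times_differentiable_SucI[OF B1],
        rule times_differentiable_bump)
  have "times_differentiable n (\<lambda>x. B2 (1 * x + t) + (-2) * B2 (1 * x + 0) + B2 (1 * x + (-t)))" for n
    by (intro times_differentiable_add times_differentiable_mult times_differentiable_const
        times_differentiable_affine[OF smB2])
  then have "smooth_on UNIV \<phi>"
    by (intro smooth_on_UNIV_I) (simp add: \<phi>_def[abs_def])
  moreover have "\<phi> x = 0" if out: "x \<notin> {p - \<bar>t\<bar>..q + \<bar>t\<bar>}" for x
  proof -
    consider "x < p - \<bar>t\<bar>" | "x > q + \<bar>t\<bar>" using out by (metis atLeastAtMost_iff not_le)
    then show ?thesis
    proof cases
      case 1
      then have "x + t \<le> p" "x \<le> p" "x - t \<le> p" by linarith+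
      then show ?thesis by (simp add: \<phi>_def B2_left)
    next
      case 2
      then have "q \<le> x + t" "q \<le> x" "q \<le> x - t" by linarith+
      from this[THEN B2_right] show ?thesis unfolding \<phi>_def by (simp add: algebra_simps)
    qed
  qed
  then have "{x. \<phi> x \<noteq> 0} \<subseteq> {p - \<bar>t\<bar>..q + \<bar>t\<bar>}" by blast
  then have "compact (closure {x. \<phi> x \<noteq> 0})"
    using bounded_subset bounded_closed_interval by (metis compact_closure)
  ultimately have "test_function \<phi>" by (simp add: test_function_def)
  then show ?thesis using that d2 by blast
qed

lemma test_function_derivs:
  assumes "test_function \<phi>"
  shows "(\<phi> has_real_derivative deriv \<phi> x) (at x)"
    "(deriv \<phi> has_real_derivative deriv (deriv \<phi>) x) (at x)"
proof -
  have "Ck_on 2 UNIV \<phi>" using assms by (simp add: test_function_def smooth_on_def)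
  then have d: "(deriv_within UNIV ^^ j) \<phi> differentiable_on UNIV" if "j < 2" for j
    using that unfolding Ck_on_def by blast
  have d0: "\<phi> differentiable (at x)" for x using d[of 0] by (auto simp: differentiable_on_def)
  have e: "deriv_within UNIV \<phi> = deriv \<phi>"
    using d0 by (auto simp: fun_eq_iff intro!: deriv_within_interior)
  have d1: "deriv \<phi> differentiable (at x)" for x
    using d[of 1] by (auto simp: differentiable_on_def e)
  show "(\<phi> has_real_derivative deriv \<phi> x) (at x)"
    using d0 DERIV_deriv_iff_real_differentiable by blast
  show "(deriv \<phi> has_real_derivative deriv (deriv \<phi>) x) (at x)"
    using d1 DERIV_deriv_iff_real_differentiable by blast
qed

lemma test_function_support:
  assumes "test_function \<phi>"
  obtains M where "0 < M" "\<And>x. M \<le> \<bar>x\<bar> \<Longrightarrow> \<phi> x = 0 \<and> deriv \<phi> x = 0 \<and> deriv (deriv \<phi>) x = 0"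
proof -
  have "bounded {\<xi>. \<phi> \<xi> \<noteq> 0}"
    using assms unfolding test_function_def
    by (meson bounded_subset closure_subset compact_imp_bounded)
  then obtain M0 where M0: "\<And>x. \<phi> x \<noteq> 0 \<Longrightarrow> \<bar>x\<bar> \<le> M0" by (auto simp: bounded_iff)
  define U where "U = {x::real. x < - M0} \<union> {x. M0 < x}"
  have opU: "open U" unfolding U_def by (intro open_Un) (auto simp: lessThan_def[symmetric] greaterThan_def[symmetric])
  have z0: "\<phi> x = 0" if "x \<in> U" for x proof (rule ccontr)
    assume "\<phi> x \<noteq> 0"
    then have "\<bar>x\<bar> \<le> M0" by (rule M0)
    then show False using that by (auto simp: U_def)
  qed
  have loc: "deriv h x = 0" if "x \<in> U" "\<And>y. y \<in> U \<Longrightarrow> h y = 0" for h :: "real \<Rightarrow> real" and x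
  proof -
    have "(h has_real_derivative 0) (at x)"
      by (rule has_field_derivative_transform_within_open[OF DERIV_const opU that(1)]) (use that(2) in auto)
    then show ?thesis by (rule DERIV_imp_deriv)
  qed
  have z1: "deriv \<phi> x = 0" if "x \<in> U" for x using loc[OF that z0] .
  have z2: "deriv (deriv \<phi>) x = 0" if "x \<in> U" for x using loc[OF that z1] .
  show ?thesis
  proof (rule that[of "\<bar>M0\<bar> + 1"])
    fix x assume "\<bar>M0\<bar> + 1 \<le> \<bar>x\<bar>"
    then have "x \<in> U" by (auto simp: U_def)
    then show "\<phi> x = 0 \<and> deriv \<phi> x = 0 \<and> deriv (deriv \<phi>) x = 0" using z0 z1 z2 by auto
  qed simp
qed

lemma has_integral_total_derivative:
  fixes G k :: "real \<Rightarrow> real"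
  assumes cont: "continuous_on UNIV G" and fin: "finite S"
    and der: "\<And>x. x \<notin> S \<Longrightarrow> (G has_real_derivative k x) (at x)"
    and M: "0 < M" and out: "\<And>x. M \<le> \<bar>x\<bar> \<Longrightarrow> G x = 0 \<and> k x = 0"
  shows "(k has_integral 0) UNIV"
proof -
  have "(k has_integral (G M - G (- M))) {-M..M}"
  proof (rule fundamental_theorem_of_calculus_interior_strong[OF fin])
    show "continuous_on {-M..M} G" using cont continuous_on_subset by blast
  qed (use M der in \<open>auto simp: has_real_derivative_iff_has_vector_derivative[symmetric]\<close>)
  moreover have "G M - G (- M) = 0" using out[of M] out[of "-M"] M by simp
  ultimately have "(k has_integral 0) {-M..M}" by simp
  then show ?thesis
  proof (rule has_integral_on_superset)
    fix x assume "x \<notin> {-M..M}"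
    then have "M \<le> \<bar>x\<bar>" by auto
    then show "k x = 0" using out by blast
  qed simp
qed

text \<open>
  The integrand is the derivative of \<open>A(Q) \<phi>' - (V + c Q) \<phi>\<close>, which has compact support. The
  exceptional set \<open>S\<close> takes in the front of a sharp wave, where only continuity is known.
\<close>
lemma weak_form_of_first_order_system:
  fixes A f Q V :: "real \<Rightarrow> real"
  assumes cU: "continuous_on UNIV (\<lambda>\<xi>. A (Q \<xi>))" and cN: "continuous_on UNIV (\<lambda>\<xi>. V \<xi> + c * Q \<xi>)"
    and fin: "finite S"
    and dU: "\<And>\<xi>. \<xi> \<notin> S \<Longrightarrow> ((\<lambda>\<xi>. A (Q \<xi>)) has_real_derivative V \<xi>) (at \<xi>)"
    and dN: "\<And>\<xi>. \<xi> \<notin> S \<Longrightarrow> ((\<lambda>\<xi>. V \<xi> + c * Q \<xi>) has_real_derivative - f (Q \<xi>)) (at \<xi>)"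
    and \<phi>: "test_function \<phi>"
  shows "((\<lambda>\<xi>. A (Q \<xi>) * deriv (deriv \<phi>) \<xi> - c * Q \<xi> * deriv \<phi> \<xi> + f (Q \<xi>) * \<phi> \<xi>)
          has_integral 0) UNIV"
proof -
  note d = test_function_derivs[OF \<phi>]
  obtain M where M: "0 < M" "\<And>x. M \<le> \<bar>x\<bar> \<Longrightarrow> \<phi> x = 0 \<and> deriv \<phi> x = 0 \<and> deriv (deriv \<phi>) x = 0"
    using test_function_support[OF \<phi>] by blast
  have c: "continuous_on UNIV \<phi>" "continuous_on UNIV (deriv \<phi>)"
    by (rule DERIV_continuous_on, use d in blast)+
  show ?thesis
  proof (rule has_integral_total_derivative[where G = "\<lambda>\<xi>. A (Q \<xi>) * deriv \<phi> \<xi> - (V \<xi> + c * Q \<xi>) * \<phi> \<xi>", OF _ fin _ M(1)])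
    show "continuous_on UNIV (\<lambda>\<xi>. A (Q \<xi>) * deriv \<phi> \<xi> - (V \<xi> + c * Q \<xi>) * \<phi> \<xi>)"
      by (intro continuous_on_diff continuous_on_mult cU cN c)
    fix \<xi> assume S: "\<xi> \<notin> S"
    show "((\<lambda>\<xi>. A (Q \<xi>) * deriv \<phi> \<xi> - (V \<xi> + c * Q \<xi>) * \<phi> \<xi>) has_real_derivative
       A (Q \<xi>) * deriv (deriv \<phi>) \<xi> - c * Q \<xi> * deriv \<phi> \<xi> + f (Q \<xi>) * \<phi> \<xi>) (at \<xi>)"
      by (rule DERIV_cong[OF DERIV_diff[OF DERIV_mult[OF dU[OF S] d(2)] DERIV_mult[OF dN[OF S] d(1)]]])
         (simp add: algebra_simps)
  qed (use M(2) in auto)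
qed

text \<open>
  Test with a function whose second derivative is the second difference of a bump, and shift the
  differences onto \<open>h\<close>: the second difference of \<open>h\<close> has integral zero against every bump.
\<close>
lemma second_difference_vanishes:
  fixes h :: "real \<Rightarrow> real"
  assumes h: "continuous_on UNIV h"
    and weak: "\<And>\<phi>. test_function \<phi> \<Longrightarrow> ((\<lambda>x. h x * deriv (deriv \<phi>) x) has_integral 0) UNIV"
  shows "h (y + t) - 2 * h y + h (y - t) = 0"
proof -
  define D where "D x = h (x - t) - 2 * h x + h (x + t)" for x
  have hc: "continuous_on S (\<lambda>x. h (x + r))" for r S
    by (rule continuous_on_compose2[OF h]) (auto intro!: continuous_intros)
  have Dc: "continuous_on S D" for S
    using hc[of S "-t"] hc[of S t] hc[of S 0] unfolding D_def by (auto intro!: continuous_intros)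
  have int0: "((\<lambda>x. D x * bump p q x) has_integral 0) {p..q}" if pq: "p < q" for p q
  proof -
    let ?b = "bump p q"
    have I: "((\<lambda>x. h (x + r) * ?b x) has_integral integral {p..q} (\<lambda>x. h (x + r) * ?b x)) {p..q}" for r
      by (intro integrable_integral integrable_continuous_real continuous_on_mult hc bump_continuous)
    define J where "J r = integral {p..q} (\<lambda>x. h (x + r) * ?b x)" for r
    have sh: "((\<lambda>x. h x * ?b (x - r)) has_integral J r) UNIV" for r
    proof -
      have "((\<lambda>x. h (x + (- r) + r) * ?b (x + (- r))) has_integral J r) {p - (- r)..q - (- r)}"
        using has_integral_shift_real_ivl[OF I[of r], of "- r"] by (simp add: J_def)
      then have "((\<lambda>x. h x * ?b (x - r)) has_integral J r) {p + r..q + r}" by simp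
      then show ?thesis
        by (rule has_integral_on_superset) (auto intro!: bump_outside)
    qed
    obtain \<phi> where \<phi>: "test_function \<phi>" "\<And>x. deriv (deriv \<phi>) x = ?b (x + t) - 2 * ?b x + ?b (x - t)"
      using test_function_with_second_difference[OF pq, of t] by blast
    have "((\<lambda>x. h x * ?b (x - (-t)) - 2 * (h x * ?b (x - 0)) + h x * ?b (x - t))
        has_integral J (-t) - 2 * J 0 + J t) UNIV"
      by (intro has_integral_add has_integral_diff has_integral_mult_right sh)
    moreover have "(\<lambda>x. h x * ?b (x - (-t)) - 2 * (h x * ?b (x - 0)) + h x * ?b (x - t)) =
        (\<lambda>x. h x * deriv (deriv \<phi>) x)"
      by (auto simp: \<phi>(2) algebra_simps)
    ultimately have "J (-t) - 2 * J 0 + J t = 0"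
      using weak[OF \<phi>(1)] has_integral_unique by metis
    moreover have "((\<lambda>x. h (x + (-t)) * ?b x - 2 * (h (x + 0) * ?b x) + h (x + t) * ?b x)
        has_integral J (-t) - 2 * J 0 + J t) {p..q}"
      unfolding J_def by (intro has_integral_add has_integral_diff has_integral_mult_right I)
    moreover have "(\<lambda>x. h (x + (-t)) * ?b x - 2 * (h (x + 0) * ?b x) + h (x + t) * ?b x) =
        (\<lambda>x. D x * ?b x)" by (auto simp: D_def algebra_simps)
    ultimately show ?thesis by simp
  qed
  have "D y = 0"
  proof (rule ccontr)
    assume ne: "D y \<noteq> 0"
    define \<sigma> where "\<sigma> = sgn (D y)"
    have "isCont (\<lambda>x. \<sigma> * D x) y"
      using Dc[of UNIV] by (auto simp: continuous_on_eq_continuous_at intro!: continuous_intros)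
    moreover have "0 < \<sigma> * D y" using ne by (simp add: \<sigma>_def sgn_if)
    ultimately have "eventually (\<lambda>x. 0 < \<sigma> * D x) (nhds y)"
      by (metis isCont_def order_tendstoD(1) tendsto_nhds_iff)
    then obtain d where d: "d > 0" "\<And>x. dist x y < d \<Longrightarrow> 0 < \<sigma> * D x"
      by (auto simp: eventually_nhds_metric)
    define p q where "p = y - d/2" and "q = y + d/2"
    have pq: "p < q" using d by (simp add: p_def q_def)
    have pos: "0 < \<sigma> * D x" if "x \<in> {p..q}" for x
      using that d(1) by (intro d(2)) (auto simp: p_def q_def dist_real_def abs_real_def)
    have "((\<lambda>x. \<sigma> * (D x * bump p q x)) has_integral \<sigma> * 0) {p..q}"
      by (intro has_integral_mult_right int0 pq)
    from integral_unique[OF this] have "integral {p..q} (\<lambda>x. \<sigma> * D x * bump p q x) = 0"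
      by (simp only: mult.assoc mult_zero_right)
    moreover have "continuous_on {p..q} (\<lambda>x. \<sigma> * D x * bump p q x)"
      by (intro continuous_intros Dc bump_continuous)
    ultimately have "\<forall>x\<in>{p..q}. \<sigma> * D x * bump p q x = 0"
      by (subst (asm) integral_eq_0_iff[OF _ pq]) (auto intro!: mult_nonneg_nonneg less_imp_le[OF pos] bump_nonneg)
    moreover have "0 < \<sigma> * D y * bump p q y"
      using pos[of y] d(1) by (intro mult_pos_pos[of "\<sigma> * D y"] bump_pos) (auto simp: p_def q_def)
    moreover have "y \<in> {p..q}" using d(1) by (simp add: p_def q_def)
    ultimately show False by (metis less_irrefl)
  qed
  then show ?thesis by (simp add: D_def)
qed

text \<open>
  At a maximum point the values at equal distance on both sides are maximal too; going as far as the
  nearer end point shows that the maximum is zero.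
\<close>
lemma midpoint_affine_le_chord:
  fixes k :: "real \<Rightarrow> real"
  assumes cont: "continuous_on {p..q} k"
    and mid: "\<And>y t. k (y + t) - 2 * k y + k (y - t) = 0"
    and ends: "k p = 0" "k q = 0" and x: "x \<in> {p..q}"
  shows "k x \<le> 0"
proof -
  obtain m where m: "m \<in> {p..q}" "\<And>y. y \<in> {p..q} \<Longrightarrow> k y \<le> k m"
    using continuous_attains_sup[OF compact_Icc _ cont] x by fastforce
  define t where "t = min (m - p) (q - m)"
  have "m + t \<in> {p..q}" "m - t \<in> {p..q}" using m(1) by (auto simp: t_def min_def)
  then have "k (m + t) \<le> k m" "k (m - t) \<le> k m" using m(2) by auto
  then have "k (m + t) = k m" "k (m - t) = k m" using mid[of m t] by auto
  moreover have "m - t = p \<or> m + t = q" by (auto simp: t_def min_def)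
  ultimately have "k m = 0" using ends by auto
  then show ?thesis using m(2)[OF x] by simp
qed

lemma weakly_affine_is_affine:
  fixes h :: "real \<Rightarrow> real"
  assumes h: "continuous_on UNIV h"
    and weak: "\<And>\<phi>. test_function \<phi> \<Longrightarrow> ((\<lambda>x. h x * deriv (deriv \<phi>) x) has_integral 0) UNIV"
  shows "h x = h 0 + (h 1 - h 0) * x"
proof -
  note sd = second_difference_vanishes[OF h weak]
  have chord: "h y = h p + (h q - h p) / (q - p) * (y - p)" if pq: "p < q" and y: "y \<in> {p..q}" for p q y
  proof -
    define m where "m = (h q - h p) / (q - p)"
    define l where "l x = h p + m * (x - p)" for x
    have l: "continuous_on {p..q} l" unfolding l_def by (intro continuous_intros)
    have hc: "continuous_on {p..q} h" using h continuous_on_subset by blast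
    have le: "h p = l p" "h q = l q" using pq by (auto simp: l_def m_def)
    have lm: "l (z + t) - 2 * l z + l (z - t) = 0" for z t
      unfolding l_def by (simp add: algebra_simps)
    have "h y - l y \<le> 0"
    proof (rule midpoint_affine_le_chord[of p q "\<lambda>x. h x - l x"])
      show "h (z + t) - l (z + t) - 2 * (h z - l z) + (h (z - t) - l (z - t)) = 0" for z t
        using lm[of z t] sd[of z t] by (simp add: algebra_simps)
    qed (use l hc le y in \<open>auto intro!: continuous_intros\<close>)
    moreover have "l y - h y \<le> 0"
    proof (rule midpoint_affine_le_chord[of p q "\<lambda>x. l x - h x"])
      show "l (z + t) - h (z + t) - 2 * (l z - h z) + (l (z - t) - h (z - t)) = 0" for z t
        using lm[of z t] sd[of z t] by (simp add: algebra_simps)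
    qed (use l hc le y in \<open>auto intro!: continuous_intros\<close>)
    ultimately show ?thesis by (simp add: l_def m_def)
  qed
  \<comment> \<open>The chord identity is used on the smallest interval that contains \<open>0\<close>, \<open>1\<close> and \<open>x\<close>, at the one
    of the three points that is not an end point.\<close>
  consider "x < 0" | "0 \<le> x" "x \<le> 1" | "1 < x" by linarith
  then show ?thesis
  proof cases
    case 1
    then show ?thesis using chord[of x 1 0] by (simp add: field_simps)
  next
    case 2
    then show ?thesis using chord[of 0 1 x] by simp
  next
    case 3
    then show ?thesis using chord[of 0 x 1] by (simp add: field_simps)
  qed
qed

text \<open>
  Adding to \<open>A(Q)\<close> the primitive of \<open>c Q\<close> and a second primitive of \<open>f(Q)\<close> removes the lower order
  terms from the weak equation, and what remains is weakly, hence truly, affine. In this way \<open>A(Q)\<close>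
  inherits two derivatives although no regularity of \<open>Q\<close> beyond continuity is assumed.
\<close>
lemma first_order_system_of_weak_form:
  fixes A f Q :: "real \<Rightarrow> real"
  assumes cQ: "continuous_on UNIV Q" and cU: "continuous_on UNIV (\<lambda>\<xi>. A (Q \<xi>))"
    and cf: "continuous_on UNIV (\<lambda>\<xi>. f (Q \<xi>))"
    and weak: "\<And>\<phi>. test_function \<phi> \<Longrightarrow>
       ((\<lambda>\<xi>. A (Q \<xi>) * deriv (deriv \<phi>) \<xi> - c * Q \<xi> * deriv \<phi> \<xi> + f (Q \<xi>) * \<phi> \<xi>) has_integral 0) UNIV"
  obtains V where "\<And>\<xi>. ((\<lambda>\<xi>. A (Q \<xi>)) has_real_derivative V \<xi>) (at \<xi>)"
    "\<And>\<xi>. ((\<lambda>\<xi>. V \<xi> + c * Q \<xi>) has_real_derivative - f (Q \<xi>)) (at \<xi>)"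
proof -
  obtain I where I: "\<And>x. (I has_real_derivative Q x) (at x)"
    using antiderivative_on_line[OF cQ] by blast
  obtain J' where J': "\<And>x. (J' has_real_derivative f (Q x)) (at x)"
    using antiderivative_on_line[OF cf] by blast
  have cJ': "continuous_on UNIV J'" by (rule DERIV_continuous_on) (use J' in auto)
  obtain J where J: "\<And>x. (J has_real_derivative J' x) (at x)"
    using antiderivative_on_line[OF cJ'] by blast
  have cI: "continuous_on UNIV I" by (rule DERIV_continuous_on) (use I in auto)
  have cJ: "continuous_on UNIV J" by (rule DERIV_continuous_on) (use J in auto)
  \<comment> \<open>\<open>h'' = 0\<close> in the sense of distributions is the wave equation.\<close>
  define h where "h x = A (Q x) + (c * I x + J x)" for x
  have hw: "((\<lambda>x. h x * deriv (deriv \<phi>) x) has_integral 0) UNIV" if \<phi>: "test_function \<phi>" for \<phi>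
  proof -
    note d = test_function_derivs[OF \<phi>]
    obtain M where M: "0 < M" "\<And>x. M \<le> \<bar>x\<bar> \<Longrightarrow> \<phi> x = 0 \<and> deriv \<phi> x = 0 \<and> deriv (deriv \<phi>) x = 0"
      using test_function_support[OF \<phi>] by blast
    have c: "continuous_on UNIV \<phi>" "continuous_on UNIV (deriv \<phi>)"
      by (rule DERIV_continuous_on, use d in blast)+
    let ?k = "\<lambda>x. (c * I x + J x) * deriv (deriv \<phi>) x + c * Q x * deriv \<phi> x - f (Q x) * \<phi> x"
    have "(?k has_integral 0) UNIV"
    proof (rule has_integral_total_derivative[where G = "\<lambda>x. (c * I x + J x) * deriv \<phi> x - J' x * \<phi> x" and S = "{}", OF _ _ _ M(1)])
      show "continuous_on UNIV (\<lambda>x. (c * I x + J x) * deriv \<phi> x - J' x * \<phi> x)"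
        by (intro continuous_intros c cI cJ cJ')
      fix x
      show "((\<lambda>x. (c * I x + J x) * deriv \<phi> x - J' x * \<phi> x) has_real_derivative ?k x) (at x)"
        by (rule DERIV_cong[OF DERIV_diff[OF DERIV_mult[OF DERIV_add[OF DERIV_cmult[OF I] J] d(2)]
             DERIV_mult[OF J' d(1)]]]) (simp add: algebra_simps)
    qed (use M(2) in auto)
    from has_integral_add[OF weak[OF \<phi>] this]
    show ?thesis by (simp add: h_def algebra_simps)
  qed
  have hc: "continuous_on UNIV h" unfolding h_def by (intro continuous_intros cU cI cJ)
  define s where "s = h 1 - h 0"
  have A_eq: "A (Q x) = h 0 + s * x - (c * I x + J x)" for x
    using weakly_affine_is_affine[OF hc hw, of x] by (simp add: h_def s_def)
  define V where "V x = s - (c * Q x + J' x)" for x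
  show ?thesis
  proof (rule that[of V])
    fix x
    have "((\<lambda>x. h 0 + s * x - (c * I x + J x)) has_real_derivative (0 + s * 1 - (c * Q x + J' x))) (at x)"
      by (intro DERIV_diff DERIV_add DERIV_const DERIV_cmult DERIV_ident I J)
    then show "((\<lambda>\<xi>. A (Q \<xi>)) has_real_derivative V x) (at x)" by (simp add: A_eq V_def)
    have "((\<lambda>x. s - J' x) has_real_derivative 0 - f (Q x)) (at x)"
      by (intro DERIV_diff DERIV_const J')
    then show "((\<lambda>\<xi>. V \<xi> + c * Q \<xi>) has_real_derivative - f (Q x)) (at x)"
      by (simp add: V_def)
  qed
qed

section \<open>From momentum curves to waves\<close>

lemma class_A_C1:
  assumes "class_A A"
  shows "continuous_on {0..} A" "continuous_on {0..} (hderiv A)"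
    "0 < u \<Longrightarrow> (A has_real_derivative hderiv A u) (at u)"
proof -
  have C: "Ck_on 1 {0..} A" using assms by (simp add: class_A_def)
  then have d: "A differentiable_on {0..}" unfolding Ck_on_def by (metis funpow_0 less_one)
  then show "continuous_on {0..} A" by (rule differentiable_imp_continuous_on)
  show "continuous_on {0..} (hderiv A)" using C by (simp add: Ck_on_def)
  assume u: "0 < u"
  then have "A differentiable (at u)"
    using d by (metis at_within_interior differentiable_on_def interior_real_atLeast atLeast_iff
        greaterThan_iff less_imp_le)
  moreover from this have "hderiv A u = deriv A u"
    using u by (intro deriv_within_interior) (simp_all add: interior_real_atLeast)
  ultimately show "(A has_real_derivative hderiv A u) (at u)"
    by (simp add: DERIV_deriv_iff_real_differentiable)
qed

lemma class_A_simps: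
  assumes "class_A A"
  shows "A 0 = 0" "hderiv A 0 = 0" "0 < u \<Longrightarrow> 0 < hderiv A u" "0 \<le> u \<Longrightarrow> 0 \<le> hderiv A u"
  using assms unfolding class_A_def by (auto simp: le_less)

lemma Lam_facts:
  assumes A: "class_A A"
  shows "Lam A 0 = 0" "continuous_on {0..1} (Lam A)"
    "u \<in> {0..1} \<Longrightarrow> 0 \<le> Lam A u"
    "0 < u \<Longrightarrow> u < 1 \<Longrightarrow> (Lam A has_real_derivative hderiv A u / u) (at u)"
proof -
  have i: "(\<lambda>r. hderiv A r / r) integrable_on {0..1}"
    using A unfolding class_A_def by (auto intro: set_lebesgue_integral_eq_integral(1))
  show "Lam A 0 = 0" by (simp add: Lam_def)
  show "continuous_on {0..1} (Lam A)"
    unfolding Lam_def[abs_def] by (rule indefinite_integral_continuous_1[OF i])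
  show "0 \<le> Lam A u" if "u \<in> {0..1}"
    unfolding Lam_def
    by (rule Henstock_Kurzweil_Integration.integral_nonneg)
       (use that i class_A_simps[OF A] in \<open>auto intro: integrable_on_subinterval\<close>)
  show "(Lam A has_real_derivative hderiv A u / u) (at u)" if u: "0 < u" "u < 1"
  proof -
    have "continuous (at u within {0..}) (hderiv A)"
      using class_A_C1(2)[OF A] u by (simp add: continuous_on_eq_continuous_within)
    then have "continuous (at u within {0..1}) (hderiv A)"
      by (rule continuous_within_subset) auto
    then have "continuous (at u within {0..1} - {}) (\<lambda>r. hderiv A r / r)"
      using u by (auto intro!: continuous_intros)
    from integral_has_vector_derivative_continuous_at[OF i _ _ this]
    have "((\<lambda>x. integral {0..x} (\<lambda>r. hderiv A r / r)) has_vector_derivative hderiv A u / u) (at u within {0..1})"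
      using u by auto
    moreover have "at u within {0..1} = at u"
      using u by (intro at_within_interior) auto
    ultimately show ?thesis
      unfolding Lam_def[abs_def] has_real_derivative_iff_has_vector_derivative by simp
  qed
qed

lemma antiderivative_on_open_interval:
  fixes q :: "real \<Rightarrow> real"
  assumes "a < b" "\<And>u. a < u \<Longrightarrow> u < b \<Longrightarrow> isCont q u"
  obtains F where "\<And>u. a < u \<Longrightarrow> u < b \<Longrightarrow> (F has_real_derivative q u) (at u)"
proof -
  have "\<exists>F. \<forall>x::real. ereal a < ereal x \<longrightarrow> ereal x < ereal b \<longrightarrow> (F has_vector_derivative q x) (at x)"
    by (rule einterval_antiderivative) (use assms in auto)
  then show ?thesis using that by (auto simp: has_real_derivative_iff_has_vector_derivative)
qed

text \<open>
  Comparison with \<open>k ln (b - u)\<close>.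
\<close>
lemma log_divergence_below:
  fixes X :: "real \<Rightarrow> real"
  assumes mb: "m < b" and k: "0 < k"
    and d: "\<And>u. m < u \<Longrightarrow> u < b \<Longrightarrow> \<exists>d\<le>- k / (b - u). (X has_real_derivative d) (at u)"
  shows "\<exists>u. m < u \<and> u < b \<and> X u < R"
proof -
  define m' where "m' = (m + b) / 2"
  have m': "m < m'" "m' < b" using mb by (auto simp: m'_def)
  define n where "n = max 0 ((X m' - R) / k) + 1"
  have n: "0 < n" "X m' - k * n < R"
  proof -
    show "0 < n" by (simp add: n_def)
    have "(X m' - R) / k < n" by (simp add: n_def)
    then show "X m' - k * n < R" using k by (simp add: divide_less_eq algebra_simps)
  qed
  \<comment> \<open>Chosen such that \<open>ln (b - u) = ln (b - m') - n\<close>.\<close>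
  define u where "u = b - (b - m') * exp (- n)"
  have u: "m' < u" "u < b"
  proof -
    have "(b - m') * exp (- n) < (b - m') * 1"
      using m' n by (intro mult_strict_left_mono) auto
    then show "m' < u" by (simp add: u_def)
    show "u < b" using m' by (simp add: u_def)
  qed
  have "X u - k * ln (b - u) \<le> X m' - k * ln (b - m')"
  proof (rule DERIV_nonpos_imp_nonincreasing[where f = "\<lambda>u. X u - k * ln (b - u)"])
    fix x assume x: "m' \<le> x" "x \<le> u"
    then obtain d' where d': "d' \<le> - k / (b - x)" "(X has_real_derivative d') (at x)"
      using d[of x] m' u by auto
    have "((\<lambda>u. X u - k * ln (b - u)) has_real_derivative d' + k / (b - x)) (at x)"
      using x u d'(2) by (auto intro!: derivative_eq_intros simp: field_simps)
    then show "\<exists>y. ((\<lambda>u. X u - k * ln (b - u)) has_real_derivative y) (at x) \<and> y \<le> 0"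
      using d'(1) by (intro exI[of _ "d' + k / (b - x)"]) auto
  qed (use u in auto)
  moreover have "ln (b - u) = ln (b - m') - n"
    using m' by (simp add: u_def ln_mult)
  ultimately have "X u \<le> X m' - k * n" by (simp add: algebra_simps)
  then show ?thesis using n u m' by (intro exI[of _ u]) auto
qed

lemma log_divergence_above:
  fixes X :: "real \<Rightarrow> real"
  assumes am: "a < m" and k: "0 < k"
    and d: "\<And>u. a < u \<Longrightarrow> u < m \<Longrightarrow> \<exists>d\<le>- k / (u - a). (X has_real_derivative d) (at u)"
  shows "\<exists>u. a < u \<and> u < m \<and> R < X u"
proof -
  have "\<exists>v. - m < v \<and> v < - a \<and> - X (- v) < - R"
  proof (rule log_divergence_below[where X = "\<lambda>v. - X (- v)", OF _ k])
    fix v assume "- m < v" "v < - a"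
    then obtain d' where d': "d' \<le> - k / (- v - a)" "(X has_real_derivative d') (at (- v))"
      using d[of "- v"] by auto
    then have "((\<lambda>v. X (- v)) has_real_derivative - d') (at v)"
      by (auto simp: DERIV_mirror[symmetric])
    from DERIV_minus[OF this] have "((\<lambda>v. - X (- v)) has_real_derivative d') (at v)" by simp
    then show "\<exists>d\<le>- k / (- a - v). ((\<lambda>v. - X (- v)) has_real_derivative d) (at v)"
      using d'(1) by (intro exI[of _ d']) (simp add: minus_diff_commute diff_minus_eq_add)
  qed (use am in auto)
  then obtain v where "- m < v" "v < - a" "- X (- v) < - R" by blast
  then show ?thesis by (intro exI[of _ "- v"]) auto
qed

text \<open>
  The inverse is described through brackets \<open>X u2 < \<xi> < X u1\<close> so that the range of \<open>X\<close> need not be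
  known; for a front it is a half-line, for a wave between positive states the whole line.
\<close>
lemma decreasing_inverse:
  fixes X q :: "real \<Rightarrow> real"
  assumes dX: "\<And>u. a < u \<Longrightarrow> u < b \<Longrightarrow> (X has_real_derivative - q u) (at u)"
    and q: "\<And>u. a < u \<Longrightarrow> u < b \<Longrightarrow> 0 < q u"
  obtains Q where "\<And>u. a < u \<Longrightarrow> u < b \<Longrightarrow> Q (X u) = u"
    "\<And>\<xi> u1 u2. a < u1 \<Longrightarrow> u1 < u2 \<Longrightarrow> u2 < b \<Longrightarrow> X u2 < \<xi> \<Longrightarrow> \<xi> < X u1 \<Longrightarrow>
       u1 < Q \<xi> \<and> Q \<xi> < u2 \<and> X (Q \<xi>) = \<xi> \<and> (Q has_real_derivative - 1 / q (Q \<xi>)) (at \<xi>)"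
proof -
  have dec: "X v < X u" if "a < u" "u < v" "v < b" for u v
  proof (rule DERIV_neg_imp_decreasing[OF that(2)])
    fix x assume "u \<le> x" "x \<le> v"
    then have "a < x" "x < b" using that by auto
    then show "\<exists>y. (X has_real_derivative y) (at x) \<and> y < 0"
      using dX q by (intro exI[of _ "- q x"]) simp
  qed
  have inj: "inj_on X {a<..<b}"
  proof (rule inj_onI)
    fix x y assume "x \<in> {a<..<b}" "y \<in> {a<..<b}" "X x = X y"
    then show "x = y" using dec[of x y] dec[of y x] by (cases x y rule: linorder_cases) auto
  qed
  define Q where "Q = the_inv_into {a<..<b} X"
  have QX: "Q (X u) = u" if "a < u" "u < b" for u
    unfolding Q_def by (rule the_inv_into_f_f[OF inj]) (use that in auto)
  have cX: "isCont X u" if "a < u" "u < b" for u using dX[OF that] by (rule DERIV_isCont)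
  show ?thesis
  proof (rule that[of Q, OF QX])
    fix \<xi> u1 u2 assume u: "a < u1" "u1 < u2" "u2 < b" "X u2 < \<xi>" "\<xi> < X u1"
    have onto: "\<exists>u. u1 < u \<and> u < u2 \<and> X u = y" if y: "X u2 < y" "y < X u1" for y
    proof -
      have "\<exists>u\<ge>u1. u \<le> u2 \<and> X u = y"
        by (rule IVT2') (use y u in \<open>auto intro!: continuous_at_imp_continuous_on cX\<close>)
      then show ?thesis using y by (metis less_irrefl order_le_less)
    qed
    obtain u where uu: "u1 < u" "u < u2" "X u = \<xi>" using onto u by blast
    have Q\<xi>: "Q \<xi> = u" using QX[of u] uu u by auto
    have XQ: "X (Q y) = y" if "X u2 < y" "y < X u1" for y
      using onto[OF that] QX u by (metis order_less_trans)
    have "isCont Q (X u)"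
      by (rule isCont_inverse_function2[of u1 u u2]) (use uu u QX cX in auto)
    then have "(Q has_real_derivative inverse (- q u)) (at \<xi>)"
      by (intro DERIV_inverse_function[where f = X and g = Q and a = "X u2" and b = "X u1"])
         (use dX[of u] q[of u] u uu Q\<xi> XQ in auto)
    then show "u1 < Q \<xi> \<and> Q \<xi> < u2 \<and> X (Q \<xi>) = \<xi> \<and> (Q has_real_derivative - 1 / q (Q \<xi>)) (at \<xi>)"
      using Q\<xi> uu by (simp add: inverse_eq_divide)
  qed
qed

text \<open>
  The change of variables from the phase plane back to the wave: \<open>P\<close> solves \<open>P' = c - A' f / P\<close> and
  \<open>Q' = - P(Q) / A'(Q)\<close>, so the momentum of \<open>Q\<close> is \<open>P(Q)\<close> and the wave equation holds.
\<close>
lemma composed_flux_derivs: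
  fixes A f P Q :: "real \<Rightarrow> real"
  assumes A: "class_A A" and Qp: "0 < Q \<xi>" and P: "0 < P (Q \<xi>)"
    and dP: "(P has_real_derivative c - hderiv A (Q \<xi>) * f (Q \<xi>) / P (Q \<xi>)) (at (Q \<xi>))"
    and dQ: "(Q has_real_derivative - P (Q \<xi>) / hderiv A (Q \<xi>)) (at \<xi>)"
  shows "((\<lambda>\<xi>. A (Q \<xi>)) has_real_derivative - P (Q \<xi>)) (at \<xi>)"
    "((\<lambda>\<xi>. - P (Q \<xi>) + c * Q \<xi>) has_real_derivative - f (Q \<xi>)) (at \<xi>)"
proof -
  have pos: "0 < hderiv A (Q \<xi>)" using class_A_simps(3)[OF A Qp] .
  show "((\<lambda>\<xi>. A (Q \<xi>)) has_real_derivative - P (Q \<xi>)) (at \<xi>)"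
    by (rule DERIV_cong[OF DERIV_chain2[OF class_A_C1(3)[OF A Qp] dQ]]) (use pos in simp)
  show "((\<lambda>\<xi>. - P (Q \<xi>) + c * Q \<xi>) has_real_derivative - f (Q \<xi>)) (at \<xi>)"
    by (rule DERIV_cong[OF DERIV_add[OF DERIV_minus[OF DERIV_chain2[OF dP dQ]] DERIV_cmult[OF dQ]]])
       (use pos P in \<open>simp add: field_simps\<close>)
qed

text \<open>
  The coordinate \<open>X u\<close> at which the wave takes the value \<open>u\<close>, up to an additive constant.
\<close>
lemma travel_coordinate:
  fixes A P :: "real \<Rightarrow> real"
  assumes A: "class_A A" and ab: "0 \<le> a" "a < b"
    and Pc: "continuous_on {a..b} P" and P: "\<And>u. a < u \<Longrightarrow> u < b \<Longrightarrow> 0 < P u"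
  obtains X where "\<And>u. a < u \<Longrightarrow> u < b \<Longrightarrow> (X has_real_derivative - (hderiv A u / P u)) (at u)"
    "\<And>u. a < u \<Longrightarrow> u < b \<Longrightarrow> 0 < hderiv A u / P u"
proof -
  have "isCont (\<lambda>u. - (hderiv A u / P u)) u" if u: "a < u" "u < b" for u
  proof -
    have "isCont P u" using Pc u by (intro continuous_on_interior[OF Pc]) auto
    moreover have "isCont (hderiv A) u"
      using class_A_C1(2)[OF A] ab u by (intro continuous_on_interior) (auto simp: interior_real_atLeast)
    ultimately show ?thesis using P[OF u] by (intro continuous_intros) auto
  qed
  then obtain X where "\<And>u. a < u \<Longrightarrow> u < b \<Longrightarrow> (X has_real_derivative - (hderiv A u / P u)) (at u)"
    using antiderivative_on_open_interval[OF ab(2), of "\<lambda>u. - (hderiv A u / P u)"] by blast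
  then show ?thesis using that class_A_simps(3)[OF A] P ab by (metis divide_pos_pos order_le_less_trans)
qed

lemma hderiv_lower_bound:
  assumes A: "class_A A" and ab: "0 < a" "a \<le> b"
  obtains k where "0 < k" "\<And>u. u \<in> {a..b} \<Longrightarrow> k \<le> hderiv A u"
proof -
  have "continuous_on {a..b} (hderiv A)"
    using class_A_C1(2)[OF A] by (rule continuous_on_subset) (use ab in auto)
  then obtain m where m: "m \<in> {a..b}" "\<And>u. u \<in> {a..b} \<Longrightarrow> hderiv A m \<le> hderiv A u"
    using continuous_attains_inf[OF compact_Icc, of a b "hderiv A"] ab by auto
  then show ?thesis using that[of "hderiv A m"] class_A_simps(3)[OF A, of m] ab by auto
qed

text \<open>
  A momentum that vanishes at least linearly at a nondegenerate rest state needs infinite distance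
  to reach it.
\<close>
lemma coordinate_unbounded_below:
  assumes A: "class_A A" and ab: "0 \<le> a" "a < b"
    and P: "\<And>u. a < u \<Longrightarrow> u < b \<Longrightarrow> 0 < P u"
    and bd: "\<And>u. a < u \<Longrightarrow> u < b \<Longrightarrow> P u \<le> C * (b - u)"
    and X: "\<And>u. a < u \<Longrightarrow> u < b \<Longrightarrow> (X has_real_derivative - (hderiv A u / P u)) (at u)"
    and m: "a \<le> m" "m < b"
  shows "\<exists>u. m < u \<and> u < b \<and> X u < R"
proof -
  define m' where "m' = (m + b) / 2"
  have m': "m < m'" "m' < b" using m by (auto simp: m'_def)
  obtain k where k: "0 < k" "\<And>u. u \<in> {m'..b} \<Longrightarrow> k \<le> hderiv A u"
    using hderiv_lower_bound[OF A, of m' b] m m' ab by auto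
  have "0 < C * (b - m')" using P[of m'] bd[of m'] m m' by force
  then have C: "0 < C" using m' by (simp add: zero_less_mult_iff)
  have "\<exists>u. m' < u \<and> u < b \<and> X u < R"
  proof (rule log_divergence_below[OF m'(2), of "k / C"])
    fix u assume u: "m' < u" "u < b"
    then have u': "a < u" using m m' by simp
    have "k / (C * (b - u)) \<le> hderiv A u / P u"
      using k(1) k(2)[of u] u P[OF u' u(2)] bd[OF u' u(2)] by (intro frac_le) auto
    then show "\<exists>d\<le>- (k / C) / (b - u). (X has_real_derivative d) (at u)"
      using X[OF u' u(2)] by (intro exI[of _ "- (hderiv A u / P u)"]) simp
  qed (use k C in auto)
  then show ?thesis using m' by (meson order_less_trans)
qed

lemma coordinate_unbounded_above:
  assumes A: "class_A A" and ab: "0 < a" "a < b"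
    and P: "\<And>u. a < u \<Longrightarrow> u < b \<Longrightarrow> 0 < P u"
    and bd: "\<And>u. a < u \<Longrightarrow> u < b \<Longrightarrow> P u \<le> C * (u - a)"
    and X: "\<And>u. a < u \<Longrightarrow> u < b \<Longrightarrow> (X has_real_derivative - (hderiv A u / P u)) (at u)"
    and m: "a < m" "m \<le> b"
  shows "\<exists>u. a < u \<and> u < m \<and> R < X u"
proof -
  obtain k where k: "0 < k" "\<And>u. u \<in> {a..b} \<Longrightarrow> k \<le> hderiv A u"
    using hderiv_lower_bound[OF A, of a b] ab by auto
  define m' where "m' = (a + b) / 2"
  have "0 < C * (m' - a)" using P[of m'] bd[of m'] ab unfolding m'_def by force
  then have C: "0 < C" using ab by (simp add: zero_less_mult_iff m'_def)
  show ?thesis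
  proof (rule log_divergence_above[OF m(1), of "k / C"])
    fix u assume u: "a < u" "u < m"
    then have u': "u < b" using m by simp
    have "k / (C * (u - a)) \<le> hderiv A u / P u"
      using k(1) k(2)[of u] u P[OF u(1) u'] bd[OF u(1) u'] m by (intro frac_le) auto
    then show "\<exists>d\<le>- (k / C) / (u - a). (X has_real_derivative d) (at u)"
      using X[OF u(1) u'] by (intro exI[of _ "- (hderiv A u / P u)"]) simp
  qed (use k C in auto)
qed

lemma decreasing_wave_of_momentum:
  assumes A: "class_A A" and ab: "0 < a" "a < b" and c: "0 < c"
    and Pc: "continuous_on {a..b} P" and P: "\<And>u. a < u \<Longrightarrow> u < b \<Longrightarrow> 0 < P u"
    and dP: "\<And>u. a < u \<Longrightarrow> u < b \<Longrightarrow>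
       (P has_real_derivative c - hderiv A u * f u / P u) (at u)"
    and bd_a: "\<And>u. a < u \<Longrightarrow> u < b \<Longrightarrow> P u \<le> C1 * (u - a)"
    and bd_b: "\<And>u. a < u \<Longrightarrow> u < b \<Longrightarrow> P u \<le> C2 * (b - u)"
  obtains Q where "decreasing_wave A f b a c Q" "\<And>\<xi>. a < Q \<xi> \<and> Q \<xi> < b"
    "\<And>\<xi>. (Q has_real_derivative - P (Q \<xi>) / hderiv A (Q \<xi>)) (at \<xi>)"
proof -
  obtain X where X: "\<And>u. a < u \<Longrightarrow> u < b \<Longrightarrow> (X has_real_derivative - (hderiv A u / P u)) (at u)"
    and q: "\<And>u. a < u \<Longrightarrow> u < b \<Longrightarrow> 0 < hderiv A u / P u"
    using travel_coordinate[OF A less_imp_le[OF ab(1)] ab(2) Pc P] by blast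
  obtain Q where QX: "\<And>u. a < u \<Longrightarrow> u < b \<Longrightarrow> Q (X u) = u"
    and Q: "\<And>\<xi> u1 u2. a < u1 \<Longrightarrow> u1 < u2 \<Longrightarrow> u2 < b \<Longrightarrow> X u2 < \<xi> \<Longrightarrow> \<xi> < X u1 \<Longrightarrow>
       u1 < Q \<xi> \<and> Q \<xi> < u2 \<and> X (Q \<xi>) = \<xi> \<and> (Q has_real_derivative - 1 / (hderiv A (Q \<xi>) / P (Q \<xi>))) (at \<xi>)"
    using decreasing_inverse[OF X q] by blast
  note below = coordinate_unbounded_below[OF A less_imp_le[OF ab(1)] ab(2) P bd_b X]
  note above = coordinate_unbounded_above[OF A ab P bd_a X]
  have *: "a < Q \<xi> \<and> Q \<xi> < b \<and> (Q has_real_derivative - P (Q \<xi>) / hderiv A (Q \<xi>)) (at \<xi>)" for \<xi>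
  proof -
    obtain u1 where u1: "a < u1" "u1 < b" "\<xi> < X u1" using above[of b \<xi>] ab by auto
    obtain u2 where u2: "u1 < u2" "u2 < b" "X u2 < \<xi>" using below[of u1 \<xi>] u1 by auto
    show ?thesis using Q[OF u1(1) u2(1,2,3) u1(3)] u1 u2 by simp
  qed
  have neg: "- P (Q \<xi>) / hderiv A (Q \<xi>) < 0" for \<xi>
    using *[of \<xi>] P[of "Q \<xi>"] class_A_simps(3)[OF A, of "Q \<xi>"] ab by (simp add: divide_neg_pos)
  have anti: "Q \<xi>2 < Q \<xi>1" if "\<xi>1 < \<xi>2" for \<xi>1 \<xi>2
    by (rule DERIV_neg_imp_decreasing[OF that]) (use * neg in blast)
  have fl1: "((\<lambda>\<xi>. A (Q \<xi>)) has_real_derivative - P (Q \<xi>)) (at \<xi>)"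
    and fl2: "((\<lambda>\<xi>. - P (Q \<xi>) + c * Q \<xi>) has_real_derivative - f (Q \<xi>)) (at \<xi>)" for \<xi>
    using composed_flux_derivs[OF A, of Q \<xi> P c f] *[of \<xi>] P[of "Q \<xi>"] dP[of "Q \<xi>"] ab by auto
  have tw: "traveling_wave A f c Q"
    unfolding traveling_wave_def
  proof (intro conjI allI impI)
    show "continuous_on UNIV Q" by (rule DERIV_continuous_on) (use * in blast)
    show "0 \<le> Q \<xi>" for \<xi> using *[of \<xi>] ab by simp
    fix \<phi> assume "test_function \<phi>"
    then show "((\<lambda>\<xi>. A (Q \<xi>) * deriv (deriv \<phi>) \<xi> - c * Q \<xi> * deriv \<phi> \<xi> + f (Q \<xi>) * \<phi> \<xi>) has_integral 0) UNIV"
      by (intro weak_form_of_first_order_system[where V = "\<lambda>\<xi>. - P (Q \<xi>)" and S = "{}"])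
         (use fl1 fl2 in \<open>auto intro!: DERIV_continuous_on\<close>)
  qed (use c in auto)
  moreover have "(Q \<longlongrightarrow> b) at_bot"
  proof (rule order_tendstoI)
    fix y assume y: "y < b"
    define u where "u = max y ((a + b) / 2)"
    have u: "a < u" "u < b" using y ab by (auto simp: u_def less_max_iff_disj min_less_iff_disj)
    have "y < Q \<xi>" if "\<xi> < X u" for \<xi> using anti[OF that] QX[OF u] by (auto simp: u_def)
    then show "eventually (\<lambda>\<xi>. y < Q \<xi>) at_bot"
      using eventually_gt_at_bot[of "X u"] by (auto elim!: eventually_mono simp: eventually_at_bot_dense)
  next
    fix y assume "b < y"
    then show "eventually (\<lambda>\<xi>. Q \<xi> < y) at_bot" using * by (intro always_eventually) (meson order_less_trans)
  qed
  moreover have "(Q \<longlongrightarrow> a) at_top"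
  proof (rule order_tendstoI)
    fix y assume y: "a < y"
    define u where "u = min y ((a + b) / 2)"
    have u: "a < u" "u < b" using y ab by (auto simp: u_def less_max_iff_disj min_less_iff_disj)
    have "Q \<xi> < y" if "X u < \<xi>" for \<xi> using anti[OF that] QX[OF u] by (auto simp: u_def)
    then show "eventually (\<lambda>\<xi>. Q \<xi> < y) at_top"
      by (auto simp: eventually_at_top_dense)
  next
    fix y assume "y < a"
    then show "eventually (\<lambda>\<xi>. y < Q \<xi>) at_top" using * by (intro always_eventually) (meson order_less_trans)
  qed
  moreover have "neg_deriv_on UNIV Q"
    unfolding neg_deriv_on_def using * neg by (metis DERIV_imp_deriv real_differentiable_def UNIV_I)
  ultimately have "decreasing_wave A f b a c Q" by (simp add: decreasing_wave_def)
  then show ?thesis using that * by blast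
qed

text \<open>
  Near \<open>0\<close> the momentum is at least \<open>c u / 2\<close>, so \<open>A' / P\<close> is dominated by a multiple of \<open>A' u / u\<close>
  and the coordinate \<open>X0\<close> stays bounded: the wave reaches zero at a finite point, which is moved to
  the origin. Darcy's law follows since \<open>\<Lambda>(Q)\<close> has the derivative \<open>- P(Q) / Q\<close>.
\<close>
lemma sharp_wave_of_momentum:
  assumes A: "class_A A" and b: "0 < b" "b \<le> 1" and c: "0 < c" and f0: "f 0 = 0"
    and Pc: "continuous_on {0..b} P" and P0: "P 0 = 0" and P: "\<And>u. 0 < u \<Longrightarrow> u < b \<Longrightarrow> 0 < P u"
    and dP: "\<And>u. 0 < u \<Longrightarrow> u < b \<Longrightarrow>
       (P has_real_derivative c - hderiv A u * f u / P u) (at u)"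
    and slope: "((\<lambda>u. P u / u) \<longlongrightarrow> c) (at_right 0)"
    and bd_b: "\<And>u. 0 < u \<Longrightarrow> u < b \<Longrightarrow> P u \<le> C * (b - u)"
  shows "\<exists>Q. sharp_wave A f c Q \<and> (Q \<longlongrightarrow> b) at_bot \<and> neg_deriv_on {..<0} Q \<and>
           (\<forall>\<xi>\<ge>0. Q \<xi> = 0) \<and> darcy_law A c Q"
proof -
  obtain X0 where X0: "\<And>u. 0 < u \<Longrightarrow> u < b \<Longrightarrow> (X0 has_real_derivative - (hderiv A u / P u)) (at u)"
    and q: "\<And>u. 0 < u \<Longrightarrow> u < b \<Longrightarrow> 0 < hderiv A u / P u"
    using travel_coordinate[OF A order_refl b(1) Pc P] by blast
  have dec0: "X0 v < X0 u" if "0 < u" "u < v" "v < b" for u v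
  proof (rule DERIV_neg_imp_decreasing[OF that(2)])
    fix x assume "u \<le> x" "x \<le> v"
    then have "0 < x" "x < b" using that by auto
    then show "\<exists>y. (X0 has_real_derivative y) (at x) \<and> y < 0"
      using X0 q by (intro exI[of _ "- (hderiv A x / P x)"]) simp
  qed
  have "eventually (\<lambda>u. c / 2 < P u / u) (at_right 0)"
    using c by (intro order_tendstoD(1)[OF slope]) auto
  then obtain d0 where d0: "0 < d0" "\<And>u. 0 < u \<Longrightarrow> u < d0 \<Longrightarrow> c / 2 < P u / u"
    by (auto simp: eventually_at_right_field)
  define d where "d = min d0 b / 2"
  have d: "0 < d" "d < b" "d < d0" using d0 b by (auto simp: d_def)
  have bdd_le: "X0 u \<le> X0 d + 2 / c * Lam A d" if u: "0 < u" "u \<le> d" for u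
  proof -
    have "X0 u + 2 / c * Lam A u \<le> X0 d + 2 / c * Lam A d"
    proof (rule DERIV_nonneg_imp_nondecreasing[where f = "\<lambda>u. X0 u + 2 / c * Lam A u", OF u(2)])
      fix v assume v: "u \<le> v" "v \<le> d"
      then have v': "0 < v" "v < b" "v < 1" "v < d0" using u d b by auto
      have Pv: "c / 2 * v < P v" using d0(2)[of v] v' by (simp add: field_simps)
      have "hderiv A v / P v \<le> hderiv A v / (c / 2 * v)"
        using class_A_simps(3)[OF A, of v] Pv v' c P[of v] by (intro divide_left_mono mult_pos_pos) auto
      also have "\<dots> = 2 / c * (hderiv A v / v)" by simp
      finally have "0 \<le> - (hderiv A v / P v) + 2 / c * (hderiv A v / v)" by simp
      moreover have "((\<lambda>u. X0 u + 2 / c * Lam A u) has_real_derivative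
          - (hderiv A v / P v) + 2 / c * (hderiv A v / v)) (at v)"
        by (intro DERIV_add DERIV_cmult X0 Lam_facts(4)[OF A] v')
      ultimately show "\<exists>y. ((\<lambda>u. X0 u + 2 / c * Lam A u) has_real_derivative y) (at v) \<and> 0 \<le> y"
        by blast
    qed
    moreover have "0 \<le> 2 / c * Lam A u" using Lam_facts(3)[OF A, of u] u d b c by simp
    ultimately show ?thesis by linarith
  qed
  have bdd: "bdd_above (X0 ` {0<..<b})"
  proof (rule bdd_aboveI2)
    fix u assume u: "u \<in> {0<..<b}"
    show "X0 u \<le> X0 d + 2 / c * Lam A d"
    proof (cases "u \<le> d")
      case False
      then have "X0 u < X0 d" using dec0[of d u] d u by auto
      moreover have "0 \<le> 2 / c * Lam A d" using Lam_facts(3)[OF A, of d] d b c by simp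
      ultimately show ?thesis by linarith
    qed (use bdd_le u in auto)
  qed
  \<comment> \<open>The position of the front before normalization.\<close>
  define L where "L = Sup (X0 ` {0<..<b})"
  define X where "X u = X0 u - L" for u
  have X: "(X has_real_derivative - (hderiv A u / P u)) (at u)" if "0 < u" "u < b" for u
    using DERIV_diff[OF X0[OF that] DERIV_const[of L]] by (simp add: X_def[abs_def])
  have dec: "X v < X u" if "0 < u" "u < v" "v < b" for u v using dec0[OF that] by (simp add: X_def)
  have Xneg: "X u < 0" if "0 < u" "u < b" for u
  proof -
    have "X0 (u / 2) \<le> L" unfolding L_def by (rule cSUP_upper[OF _ bdd]) (use that in auto)
    then show ?thesis using dec0[of "u/2" u] that by (simp add: X_def)
  qed
  have Xsup: "\<exists>u. 0 < u \<and> u < b \<and> \<xi> < X u" if "\<xi> < 0" for \<xi>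
  proof -
    have "\<exists>x\<in>X0 ` {0<..<b}. \<xi> + L < x"
      using less_cSup_iff[OF _ bdd, of "\<xi> + L"] b that unfolding L_def by auto
    then show ?thesis by (auto simp: X_def)
  qed
  obtain Q0 where QX: "\<And>u. 0 < u \<Longrightarrow> u < b \<Longrightarrow> Q0 (X u) = u"
    and Q0: "\<And>\<xi> u1 u2. 0 < u1 \<Longrightarrow> u1 < u2 \<Longrightarrow> u2 < b \<Longrightarrow> X u2 < \<xi> \<Longrightarrow> \<xi> < X u1 \<Longrightarrow>
       u1 < Q0 \<xi> \<and> Q0 \<xi> < u2 \<and> X (Q0 \<xi>) = \<xi> \<and> (Q0 has_real_derivative - 1 / (hderiv A (Q0 \<xi>) / P (Q0 \<xi>))) (at \<xi>)"
    using decreasing_inverse[OF X q] by blast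
  define Q where "Q \<xi> = (if \<xi> < 0 then Q0 \<xi> else 0)" for \<xi>
  have Q0': "0 < Q \<xi> \<and> Q \<xi> < b \<and> (Q has_real_derivative - P (Q \<xi>) / hderiv A (Q \<xi>)) (at \<xi>)"
    if \<xi>: "\<xi> < 0" for \<xi>
  proof -
    obtain u1 where u1: "0 < u1" "u1 < b" "\<xi> < X u1" using Xsup[OF \<xi>] by auto
    obtain u2 where u2: "u1 < u2" "u2 < b" "X u2 < \<xi>"
      using coordinate_unbounded_below[OF A order_refl b(1) P bd_b X, of u1 \<xi>] u1 by auto
    note z = Q0[OF u1(1) u2(1,2,3) u1(3)]
    have "(Q has_real_derivative - 1 / (hderiv A (Q0 \<xi>) / P (Q0 \<xi>))) (at \<xi>)"
      by (rule has_field_derivative_transform_within_open[OF _ open_lessThan[of 0]])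
         (use z \<xi> in \<open>auto simp: Q_def\<close>)
    then show ?thesis using z u1 u2 \<xi> by (simp add: Q_def)
  qed
  have Qz: "Q \<xi> = 0" if "0 \<le> \<xi>" for \<xi> using that by (simp add: Q_def)
  have QX': "Q (X u) = u" if "0 < u" "u < b" for u using QX[OF that] Xneg[OF that] by (simp add: Q_def)
  have neg: "- P (Q \<xi>) / hderiv A (Q \<xi>) < 0" if "\<xi> < 0" for \<xi>
    using Q0'[OF that] P[of "Q \<xi>"] class_A_simps(3)[OF A, of "Q \<xi>"] by (simp add: divide_neg_pos)
  have anti: "Q \<xi>2 < Q \<xi>1" if "\<xi>1 < \<xi>2" "\<xi>2 < 0" for \<xi>1 \<xi>2
    by (rule DERIV_neg_imp_decreasing[OF that(1)]) (use Q0' neg that in \<open>meson order_le_less_trans\<close>)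
  have Qr: "Q \<xi> \<in> {0..b}" for \<xi> using Q0'[of \<xi>] Qz[of \<xi>] b by (cases "\<xi> < 0") auto
  have Qlim0: "(Q \<longlongrightarrow> 0) (at_left 0)"
  proof (rule order_tendstoI)
    fix y :: real assume y: "0 < y"
    define u where "u = min y b / 2"
    have u: "0 < u" "u < b" "u < y" using y b by (auto simp: u_def)
    show "eventually (\<lambda>\<xi>. Q \<xi> < y) (at_left 0)"
    proof (rule eventually_at_leftI[OF _ Xneg[OF u(1,2)]])
      fix \<xi> assume "\<xi> \<in> {X u<..<0}"
      then have "Q \<xi> < Q (X u)" by (intro anti) auto
      then show "Q \<xi> < y" using QX'[OF u(1,2)] u(3) by simp
    qed
  next
    fix y :: real assume "y < 0"
    then show "eventually (\<lambda>\<xi>. y < Q \<xi>) (at_left 0)"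
      using Qr by (intro always_eventually) (meson atLeastAtMost_iff order_less_le_trans)
  qed
  have Qc: "isCont Q \<xi>" for \<xi>
  proof -
    consider "\<xi> < 0" | "\<xi> = 0" | "0 < \<xi>" by linarith
    then show ?thesis
    proof cases
      case 1
      then show ?thesis using Q0'[OF 1] DERIV_isCont by blast
    next
      case 2
      have "(Q \<longlongrightarrow> 0) (at_right 0)"
        by (rule tendsto_eventually, rule eventually_at_rightI[of 0 1]) (use Qz in auto)
      then show ?thesis using Qlim0 2 Qz[of 0] by (simp add: isCont_def filterlim_at_split)
    next
      case 3
      have "((\<lambda>_. 0) has_real_derivative 0) (at \<xi>)" by simp
      then have "(Q has_real_derivative 0) (at \<xi>)"
        by (rule has_field_derivative_transform_within_open[OF _ open_greaterThan[of 0]])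
           (use 3 Qz in auto)
      then show ?thesis by (rule DERIV_isCont)
    qed
  qed
  then have Qcont: "continuous_on UNIV Q" by (simp add: continuous_on_eq_continuous_at)
  have fl1: "((\<lambda>\<xi>. A (Q \<xi>)) has_real_derivative - P (Q \<xi>)) (at \<xi>)"
    and fl2: "((\<lambda>\<xi>. - P (Q \<xi>) + c * Q \<xi>) has_real_derivative - f (Q \<xi>)) (at \<xi>)" if "\<xi> < 0" for \<xi>
    using composed_flux_derivs[OF A, of Q \<xi> P c f] Q0'[OF that] P[of "Q \<xi>"] dP[of "Q \<xi>"] by auto
  have fl: "((\<lambda>\<xi>. A (Q \<xi>)) has_real_derivative - P (Q \<xi>)) (at \<xi>) \<and>
      ((\<lambda>\<xi>. - P (Q \<xi>) + c * Q \<xi>) has_real_derivative - f (Q \<xi>)) (at \<xi>)" if "\<xi> \<noteq> 0" for \<xi>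
  proof (cases "\<xi> < 0")
    case False
    with that have \<xi>: "\<xi> \<in> {0<..}" by simp
    have "((\<lambda>\<xi>. A (Q \<xi>)) has_real_derivative 0) (at \<xi>)"
      "((\<lambda>\<xi>. - P (Q \<xi>) + c * Q \<xi>) has_real_derivative 0) (at \<xi>)"
      by (rule has_field_derivative_transform_within_open[OF DERIV_const open_greaterThan \<xi>],
          use Qz in simp)+
    then show ?thesis using Qz[of \<xi>] \<xi> P0 f0 by simp
  qed (use fl1 fl2 in auto)
  have tw: "traveling_wave A f c Q"
    unfolding traveling_wave_def
  proof (intro conjI allI impI)
    show "0 \<le> Q \<xi>" for \<xi> using Qr[of \<xi>] by simp
    fix \<phi> assume \<phi>: "test_function \<phi>"
    show "((\<lambda>\<xi>. A (Q \<xi>) * deriv (deriv \<phi>) \<xi> - c * Q \<xi> * deriv \<phi> \<xi> + f (Q \<xi>) * \<phi> \<xi>) has_integral 0) UNIV"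
    proof (rule weak_form_of_first_order_system[where V = "\<lambda>\<xi>. - P (Q \<xi>)" and S = "{0}", OF _ _ _ _ _ \<phi>])
      show "continuous_on UNIV (\<lambda>\<xi>. A (Q \<xi>))"
        by (rule continuous_on_compose2[OF class_A_C1(1)[OF A] Qcont]) (use Qr in auto)
      have "continuous_on UNIV (\<lambda>\<xi>. P (Q \<xi>))"
        by (rule continuous_on_compose2[OF Pc Qcont]) (use Qr in auto)
      then show "continuous_on UNIV (\<lambda>\<xi>. - P (Q \<xi>) + c * Q \<xi>)"
        by (intro continuous_intros Qcont)
    qed (use fl in auto)
  qed (use c Qcont in auto)
  have bot: "(Q \<longlongrightarrow> b) at_bot"
  proof (rule order_tendstoI)
    fix y assume y: "y < b"
    define u where "u = max y (b / 2)"
    have u: "0 < u" "u < b" using y b by (auto simp: u_def less_max_iff_disj min_less_iff_disj)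
    have "y < Q \<xi>" if "\<xi> < X u" for \<xi>
      using anti[OF that Xneg[OF u]] QX'[OF u] by (auto simp: u_def)
    then show "eventually (\<lambda>\<xi>. y < Q \<xi>) at_bot" by (auto simp: eventually_at_bot_dense)
  next
    fix y assume "b < y"
    then show "eventually (\<lambda>\<xi>. Q \<xi> < y) at_bot"
      using Qr by (intro always_eventually) (meson atLeastAtMost_iff order_le_less_trans)
  qed
  have nd: "neg_deriv_on {..<0} Q"
    unfolding neg_deriv_on_def using Q0' neg by (metis DERIV_imp_deriv lessThan_iff real_differentiable_def)
  have dl: "darcy_law A c Q"
  proof -
    have ev: "eventually (\<lambda>\<xi>::real. \<xi> < 0) (at_left 0)"
      by (rule eventually_at_leftI[of "-1"]) auto
    have Qfl: "filterlim Q (at_right 0) (at_left 0)"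
      unfolding filterlim_at
    proof
      show "eventually (\<lambda>\<xi>. Q \<xi> \<in> {0<..} \<and> Q \<xi> \<noteq> 0) (at_left 0)"
        using ev by eventually_elim (use Q0' in force)
    qed (rule Qlim0)
    have "((\<lambda>\<xi>. Lam A (Q \<xi>) / \<xi>) \<longlongrightarrow> - c) (at_left 0)"
    proof (rule lhopital_left[where f' = "\<lambda>\<xi>. - (P (Q \<xi>) / Q \<xi>)" and g' = "\<lambda>_. 1"])
      have "(Lam A \<longlongrightarrow> Lam A 0) (at_right 0)"
        by (rule continuous_on_Icc_at_rightD[OF Lam_facts(2)[OF A]]) simp
      then show "((\<lambda>\<xi>. Lam A (Q \<xi>)) \<longlongrightarrow> 0) (at_left 0)"
        using filterlim_compose[OF _ Qfl, of "Lam A" "nhds 0"] Lam_facts(1)[OF A] by simp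
      show "((\<lambda>\<xi>::real. \<xi>) \<longlongrightarrow> 0) (at_left 0)" by (rule tendsto_ident_at)
      show "eventually (\<lambda>\<xi>::real. \<xi> \<noteq> 0) (at_left 0)" using ev by eventually_elim auto
      show "eventually (\<lambda>\<xi>. ((\<lambda>\<xi>. Lam A (Q \<xi>)) has_real_derivative - (P (Q \<xi>) / Q \<xi>)) (at \<xi>)) (at_left 0)"
        using ev
      proof eventually_elim
        case (elim \<xi>)
        note z = Q0'[OF elim]
        have h: "0 < hderiv A (Q \<xi>)" using class_A_simps(3)[OF A] z by blast
        have "(Lam A has_real_derivative hderiv A (Q \<xi>) / Q \<xi>) (at (Q \<xi>))"
          using z b by (intro Lam_facts(4)[OF A]) auto
        then have "((\<lambda>\<xi>. Lam A (Q \<xi>)) has_real_derivative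
            hderiv A (Q \<xi>) / Q \<xi> * (- P (Q \<xi>) / hderiv A (Q \<xi>))) (at \<xi>)"
          by (rule DERIV_chain2) (use z in blast)
        then show ?case using h by simp
      qed
      have "((\<lambda>\<xi>. P (Q \<xi>) / Q \<xi>) \<longlongrightarrow> c) (at_left 0)"
        using filterlim_compose[OF slope Qfl] .
      then show "((\<lambda>\<xi>. - (P (Q \<xi>) / Q \<xi>) / 1) \<longlongrightarrow> - c) (at_left 0)"
        using tendsto_minus by fastforce
    qed auto
    then show ?thesis
      unfolding darcy_law_def has_field_derivative_iff using Qz[of 0] Lam_facts(1)[OF A] by simp
  qed
  have "strict_antimono_on {..<0} Q"
    by (intro monotone_onI) (use anti in auto)
  then have "sharp_wave A f c Q"
    unfolding sharp_wave_def using tw dl Q0' Qz by blast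
  then show ?thesis using bot nd Qz dl by blast
qed

section \<open>From waves to momentum curves\<close>

lemma assumption_F_C1:
  assumes F: "assumption_F A f s1 s2"
  shows "continuous_on {0..} f"
    "\<exists>K>0. \<forall>u\<in>{0..1}. \<forall>v\<in>{0..1}. \<bar>f u - f v\<bar> \<le> K * \<bar>u - v\<bar>"
proof -
  have C: "Ck_on 2 {0..} f" using F by (simp add: assumption_F_def)
  then have d: "(deriv_within {0..} ^^ j) f differentiable_on {0..}" if "j < 2" for j
    using that unfolding Ck_on_def by blast
  have d0: "f differentiable_on {0..}" using d[of 0] by simp
  then show "continuous_on {0..} f" by (rule differentiable_imp_continuous_on)
  have "hderiv f differentiable_on {0..}" using d[of 1] by simp
  then have c1: "continuous_on {0..1} (hderiv f)"
    using differentiable_imp_continuous_on continuous_on_subset by fastforce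
  then have "bounded (hderiv f ` {0..1})"
    by (intro compact_imp_bounded compact_continuous_image) auto
  then obtain K where K: "\<And>u. u \<in> {0..1} \<Longrightarrow> \<bar>hderiv f u\<bar> \<le> K"
    unfolding bounded_iff by (metis imageI real_norm_def)
  have D: "(f has_real_derivative hderiv f u) (at u within {0..1})" if "u \<in> {0..1}" for u
  proof -
    have "f differentiable (at u within {0..})" using d0 that by (auto simp: differentiable_on_def)
    then have "(f has_vector_derivative hderiv f u) (at u within {0..})"
      unfolding deriv_within_def by (simp add: vector_derivative_works)
    then show ?thesis
      unfolding has_real_derivative_iff_has_vector_derivative
      by (rule has_vector_derivative_within_subset) auto
  qed
  have "\<bar>f u - f v\<bar> \<le> (\<bar>K\<bar> + 1) * \<bar>u - v\<bar>" if "u \<in> {0..1}" "v \<in> {0..1}" for u v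
  proof -
    have "norm (f u - f v) \<le> (\<bar>K\<bar> + 1) * norm (u - v)"
    proof (rule field_differentiable_bound[OF convex_real_interval(5) D])
      show "norm (hderiv f z) \<le> \<bar>K\<bar> + 1" if "z \<in> {0..1}" for z using K[OF that] by auto
    qed (use that in auto)
    then show ?thesis by simp
  qed
  then show "\<exists>K>0. \<forall>u\<in>{0..1}. \<forall>v\<in>{0..1}. \<bar>f u - f v\<bar> \<le> K * \<bar>u - v\<bar>"
    by (intro exI[of _ "\<bar>K\<bar> + 1"]) auto
qed

lemma assumption_F_simps:
  assumes F: "assumption_F A f s1 s2"
  shows "0 < s1" "s1 < s2" "s2 < 1" "f 0 = 0" "f s1 = 0" "f s2 = 0" "f 1 = 0"
    "0 < u \<Longrightarrow> u < s1 \<Longrightarrow> 0 < f u" "s1 < u \<Longrightarrow> u < s2 \<Longrightarrow> f u < 0" "s2 < u \<Longrightarrow> u < 1 \<Longrightarrow> 0 < f u"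
    "0 < integral {s1..1} (\<lambda>s. hderiv A s * f s)"
proof -
  have z: "{u. 0 \<le> u \<and> f u = 0} = {0, s1, s2, 1}" using F by (simp add: assumption_F_def)
  show "f 0 = 0" "f s1 = 0" "f s2 = 0" "f 1 = 0" using z by blast+
qed (use F in \<open>auto simp: assumption_F_def\<close>)

text \<open>
  The bounds on \<open>g = A' f\<close> that the phase plane needs: linear at every zero of \<open>f\<close>, because \<open>f\<close> is
  Lipschitz, and one order better at \<open>0\<close>, because \<open>A'\<close> vanishes there.
\<close>
lemma weighted_reaction_facts:
  assumes A: "class_A A" and F: "assumption_F A f s1 s2"
  defines "g \<equiv> \<lambda>u. hderiv A u * f u"
  obtains K where "0 < K" "continuous_on {0..1} g"
    "\<And>u z. u \<in> {0..1} \<Longrightarrow> z \<in> {0..1} \<Longrightarrow> f z = 0 \<Longrightarrow> \<bar>g u\<bar> \<le> K * \<bar>u - z\<bar>"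
    "\<And>u. 0 < u \<Longrightarrow> u < 1 \<Longrightarrow> g u \<le> K * u\<^sup>2 * (hderiv A u / u)"
    "((\<lambda>u. g u / u) \<longlongrightarrow> 0) (at_right 0)"
proof -
  obtain L where L: "0 < L" "\<And>u v. u \<in> {0..1} \<Longrightarrow> v \<in> {0..1} \<Longrightarrow> \<bar>f u - f v\<bar> \<le> L * \<bar>u - v\<bar>"
    using assumption_F_C1(2)[OF F] by blast
  have cA: "continuous_on {0..1} (hderiv A)"
    using class_A_C1(2)[OF A] by (rule continuous_on_subset) auto
  have cf: "continuous_on {0..1} f"
    using assumption_F_C1(1)[OF F] by (rule continuous_on_subset) auto
  have "bounded (hderiv A ` {0..1})"
    by (intro compact_imp_bounded compact_continuous_image cA) auto
  then obtain M where M: "\<And>u. u \<in> {0..1} \<Longrightarrow> \<bar>hderiv A u\<bar> \<le> M"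
    unfolding bounded_iff by (metis imageI real_norm_def)
  define K where "K = (\<bar>M\<bar> + 1) * L"
  have K: "0 < K" "L \<le> K" using L(1) by (auto simp: K_def intro: mult_right_mono[of 1, simplified])
  have fu: "\<bar>f u\<bar> \<le> L * u" if "u \<in> {0..1}" for u
    using L(2)[of u 0] that assumption_F_simps(4)[OF F] by simp
  have "\<bar>g u\<bar> \<le> K * \<bar>u - z\<bar>" if "u \<in> {0..1}" "z \<in> {0..1}" "f z = 0" for u z
  proof -
    have "\<bar>hderiv A u\<bar> * \<bar>f u\<bar> \<le> (\<bar>M\<bar> + 1) * (L * \<bar>u - z\<bar>)"
      using M[of u] L(2)[of u z] that by (intro mult_mono) auto
    then show ?thesis by (simp add: g_def abs_mult K_def ac_simps)
  qed
  moreover have "g u \<le> K * u\<^sup>2 * (hderiv A u / u)" if u: "0 < u" "u < 1" for u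
  proof -
    have h: "0 < hderiv A u" using class_A_simps(3)[OF A u(1)] .
    have "f u \<le> K * u" 
    proof -
      have "f u \<le> L * u" using fu[of u] u by simp
      also have "\<dots> \<le> K * u" using K(2) u by (intro mult_right_mono) auto
      finally show ?thesis .
    qed
    then have "g u \<le> hderiv A u * (K * u)" unfolding g_def using h by (intro mult_left_mono) auto
    then show ?thesis using u by (simp add: power2_eq_square ac_simps)
  qed
  moreover have "((\<lambda>u. g u / u) \<longlongrightarrow> 0) (at_right 0)"
  proof (rule Lim_null_comparison)
    have "(hderiv A \<longlongrightarrow> hderiv A 0) (at_right 0)"
      by (rule continuous_on_Icc_at_rightD[OF cA]) simp
    then show "((\<lambda>u. L * hderiv A u) \<longlongrightarrow> 0) (at_right 0)"
      using class_A_simps(2)[OF A] tendsto_mult_right_zero by force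
    show "eventually (\<lambda>u. norm (g u / u) \<le> L * hderiv A u) (at_right 0)"
    proof (rule eventually_at_rightI[of 0 1])
      fix u :: real assume u: "u \<in> {0<..<1}"
      have h: "0 < hderiv A u" using class_A_simps(3)[OF A] u by auto
      have "hderiv A u * \<bar>f u\<bar> \<le> hderiv A u * (L * u)"
        using fu[of u] u h by (intro mult_left_mono) auto
      then show "norm (g u / u) \<le> L * hderiv A u"
        using u h by (simp add: g_def abs_mult abs_divide divide_le_eq ac_simps)
    qed simp
  qed
  moreover have "continuous_on {0..1} g" unfolding g_def by (intro continuous_intros cA cf)
  ultimately show ?thesis using that K by blast
qed

lemma decreasing_wave_range:
  assumes W: "decreasing_wave A f b a c Q"
  shows "\<xi> < \<eta> \<Longrightarrow> Q \<eta> < Q \<xi>" "a < Q \<xi>" "Q \<xi> < b"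
    "a < u \<Longrightarrow> u < b \<Longrightarrow> \<exists>\<xi>. Q \<xi> = u"
    "(Q has_real_derivative deriv Q \<xi>) (at \<xi>)" "deriv Q \<xi> < 0"
proof -
  have lb: "(Q \<longlongrightarrow> b) at_bot" and la: "(Q \<longlongrightarrow> a) at_top" using W by (auto simp: decreasing_wave_def)
  show d: "(Q has_real_derivative deriv Q \<xi>) (at \<xi>)" and n: "deriv Q \<xi> < 0" for \<xi>
    using W DERIV_deriv_iff_real_differentiable by (auto simp: decreasing_wave_def neg_deriv_on_def)
  show anti: "Q \<eta> < Q \<xi>" if "\<xi> < \<eta>" for \<xi> \<eta>
    by (rule DERIV_neg_imp_decreasing[OF that]) (use d n in blast)
  have le: "Q \<xi> \<le> b" for \<xi>
    by (rule tendsto_lowerbound[OF lb]) (use anti in \<open>auto simp: eventually_at_bot_dense intro!: exI[of _ \<xi>] less_imp_le\<close>)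
  have ge: "a \<le> Q \<xi>" for \<xi>
    by (rule tendsto_upperbound[OF la]) (use anti in \<open>auto simp: eventually_at_top_dense intro!: exI[of _ \<xi>] less_imp_le\<close>)
  show "Q \<xi> < b" for \<xi> using anti[of "\<xi> - 1" \<xi>] le[of "\<xi> - 1"] by simp
  show "a < Q \<xi>" for \<xi> using anti[of \<xi> "\<xi> + 1"] ge[of "\<xi> + 1"] by simp
  show "\<exists>\<xi>. Q \<xi> = u" if u: "a < u" "u < b"
  proof -
    obtain x where x: "Q x < u" using order_tendstoD(2)[OF la u(1)] by (auto simp: eventually_at_top_linorder)
    obtain y where y: "u < Q y" using order_tendstoD(1)[OF lb u(2)] by (auto simp: eventually_at_bot_linorder)
    have "y \<le> x" using x y anti[of x y] by (cases "y \<le> x") auto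
    then have "\<exists>z\<ge>y. z \<le> x \<and> Q z = u"
      using x y d by (intro IVT2) (auto intro: DERIV_isCont)
    then show ?thesis by blast
  qed
qed

text \<open>
  A wave is a curve in the phase plane that ends on the axis. That the momentum \<open>- V\<close> vanishes at
  both ends follows from the mean value theorem: the increment of \<open>A(Q)\<close> over a unit interval tends
  to zero and is \<open>V\<close> at an intermediate point. It controls \<open>V\<close> itself, since near \<open>+\<infinity>\<close> the function
  \<open>V\<close> is nondecreasing, and near \<open>-\<infinity>\<close> the function \<open>V + c Q\<close> is nonincreasing while \<open>Q\<close> is almost
  constant.
\<close>
lemma energy_profile_of_wave:
  assumes A: "class_A A" and ab: "0 < a" "a < b"
    and fc: "continuous_on {0..} f"
    and fa: "a < m" "\<And>u. a < u \<Longrightarrow> u < m \<Longrightarrow> f u \<le> 0"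
    and fb: "m' < b" "\<And>u. m' < u \<Longrightarrow> u < b \<Longrightarrow> 0 \<le> f u"
    and W: "decreasing_wave A f b a c Q"
  obtains y where "energy_profile (\<lambda>u. hderiv A u * f u) c a b y" "y a = 0" "y b = 0"
    "\<And>\<xi>. (Q has_real_derivative - sqrt (2 * y (Q \<xi>)) / hderiv A (Q \<xi>)) (at \<xi>)"
    "\<And>u. a < u \<Longrightarrow> u < b \<Longrightarrow> 0 < y u"
proof -
  note R = decreasing_wave_range[OF W]
  have c: "0 < c" and Qc: "continuous_on UNIV Q"
    and weak: "\<And>\<phi>. test_function \<phi> \<Longrightarrow>
       ((\<lambda>\<xi>. A (Q \<xi>) * deriv (deriv \<phi>) \<xi> - c * Q \<xi> * deriv \<phi> \<xi> + f (Q \<xi>) * \<phi> \<xi>) has_integral 0) UNIV"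
    and lb: "(Q \<longlongrightarrow> b) at_bot" and la: "(Q \<longlongrightarrow> a) at_top"
    using W by (auto simp: decreasing_wave_def traveling_wave_def)
  have Q0: "0 < Q \<xi>" for \<xi> using R(2) ab by (meson order_less_trans)
  have "continuous_on UNIV (\<lambda>\<xi>. A (Q \<xi>))" "continuous_on UNIV (\<lambda>\<xi>. f (Q \<xi>))"
    by (rule continuous_on_compose2[OF class_A_C1(1)[OF A] Qc] continuous_on_compose2[OF fc Qc],
        use Q0 less_imp_le in force)+
  then obtain V where V: "\<And>\<xi>. ((\<lambda>\<xi>. A (Q \<xi>)) has_real_derivative V \<xi>) (at \<xi>)"
    and N: "\<And>\<xi>. ((\<lambda>\<xi>. V \<xi> + c * Q \<xi>) has_real_derivative - f (Q \<xi>)) (at \<xi>)"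
    using first_order_system_of_weak_form[OF Qc _ _ weak] by blast
  have Veq: "V \<xi> = hderiv A (Q \<xi>) * deriv Q \<xi>" for \<xi>
    by (rule DERIV_unique[OF V DERIV_chain2[OF class_A_C1(3)[OF A Q0] R(5)]])
  have hp: "0 < hderiv A (Q \<xi>)" for \<xi> using class_A_simps(3)[OF A Q0] .
  have Vneg: "V \<xi> < 0" for \<xi> using Veq[of \<xi>] hp[of \<xi>] R(6)[of \<xi>] by (simp add: mult_pos_neg)
  have dV: "(V has_real_derivative - f (Q \<xi>) - c * deriv Q \<xi>) (at \<xi>)" for \<xi>
    using DERIV_diff[OF N[of \<xi>] DERIV_cmult[OF R(5)[of \<xi>], of c]] by simp
  have cA: "isCont A u" if "0 < u" for u using class_A_C1(3)[OF A that] by (rule DERIV_isCont)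
  have Ua: "((\<lambda>\<xi>. A (Q \<xi>)) \<longlongrightarrow> A a) at_top" and Ub: "((\<lambda>\<xi>. A (Q \<xi>)) \<longlongrightarrow> A b) at_bot"
    using isCont_tendsto_compose[OF cA la] isCont_tendsto_compose[OF cA lb] ab by auto
  have Va: "(V \<longlongrightarrow> 0) at_top"
  proof -
    obtain x0 where x0: "\<And>\<xi>. x0 \<le> \<xi> \<Longrightarrow> Q \<xi> < m"
      using order_tendstoD(2)[OF la fa(1)] by (auto simp: eventually_at_top_linorder)
    have ev: "eventually (\<lambda>\<xi>. norm (V \<xi>) \<le> A (Q (\<xi> - 1)) - A (Q \<xi>)) at_top"
      unfolding eventually_at_top_linorder
    proof (intro exI[of _ "x0 + 1"] allI impI)
      fix \<xi> assume \<xi>: "x0 + 1 \<le> \<xi>"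
      have "\<exists>z>\<xi> - 1. z < \<xi> \<and> A (Q \<xi>) - A (Q (\<xi> - 1)) = (\<xi> - (\<xi> - 1)) * V z"
        by (rule MVT2) (use V in auto)
      then obtain z where z: "\<xi> - 1 < z" "z < \<xi>" "A (Q \<xi>) - A (Q (\<xi> - 1)) = V z" by auto
      have "V z \<le> V \<xi>"
      proof (rule DERIV_nonneg_imp_nondecreasing[where f = V])
        fix x assume "z \<le> x" "x \<le> \<xi>"
        then have "f (Q x) \<le> 0" using x0[of x] z \<xi> R(2)[of x] by (intro fa(2)) auto
        moreover have "c * deriv Q x < 0" using c R(6)[of x] by (rule mult_pos_neg)
        ultimately show "\<exists>y. (V has_real_derivative y) (at x) \<and> 0 \<le> y"
          using dV[of x] by (intro exI[of _ "- f (Q x) - c * deriv Q x"]) auto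
      qed (use z in auto)
      then show "norm (V \<xi>) \<le> A (Q (\<xi> - 1)) - A (Q \<xi>)" using z Vneg[of \<xi>] by simp
    qed
    have "filterlim (\<lambda>\<xi>. - 1 + \<xi>) at_top (at_top :: real filter)"
      by (rule filterlim_tendsto_add_at_top[OF tendsto_const filterlim_ident])
    then have "((\<lambda>\<xi>. A (Q (\<xi> - 1))) \<longlongrightarrow> A a) at_top"
      using filterlim_compose[OF Ua] by fastforce
    from tendsto_diff[OF this Ua] have "((\<lambda>\<xi>. A (Q (\<xi> - 1)) - A (Q \<xi>)) \<longlongrightarrow> 0) at_top" by simp
    with ev show ?thesis by (rule Lim_null_comparison)
  qed
  have Vb: "(V \<longlongrightarrow> 0) at_bot"
  proof -
    obtain x0 where x0: "\<And>\<xi>. \<xi> \<le> x0 \<Longrightarrow> m' < Q \<xi>"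
      using order_tendstoD(1)[OF lb fb(1)] by (auto simp: eventually_at_bot_linorder)
    have ev: "eventually (\<lambda>\<xi>. norm (V \<xi>) \<le> A (Q \<xi>) - A (Q (\<xi> + 1)) + c * (b - Q (\<xi> + 1))) at_bot"
      unfolding eventually_at_bot_linorder
    proof (intro exI[of _ "x0 - 1"] allI impI)
      fix \<xi> assume \<xi>: "\<xi> \<le> x0 - 1"
      have "\<exists>z>\<xi>. z < \<xi> + 1 \<and> A (Q (\<xi> + 1)) - A (Q \<xi>) = (\<xi> + 1 - \<xi>) * V z"
        by (rule MVT2) (use V in auto)
      then obtain z where z: "\<xi> < z" "z < \<xi> + 1" "A (Q (\<xi> + 1)) - A (Q \<xi>) = V z" by auto
      \<comment> \<open>\<open>V\<close> itself need not be monotone here, as \<open>f(Q)\<close> and \<open>c Q'\<close> have opposite signs.\<close>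
      have "V z + c * Q z \<le> V \<xi> + c * Q \<xi>"
      proof (rule DERIV_nonpos_imp_nonincreasing[where f = "\<lambda>\<xi>. V \<xi> + c * Q \<xi>"])
        fix x assume "\<xi> \<le> x" "x \<le> z"
        then have "0 \<le> f (Q x)" using x0[of x] z \<xi> R(3)[of x] by (intro fb(2)) auto
        then show "\<exists>y. ((\<lambda>\<xi>. V \<xi> + c * Q \<xi>) has_real_derivative y) (at x) \<and> y \<le> 0"
          using N[of x] by (intro exI[of _ "- f (Q x)"]) auto
      qed (use z in auto)
      moreover have "c * Q \<xi> \<le> c * b" "c * Q (\<xi> + 1) \<le> c * Q z"
        using c R(3)[of \<xi>] R(1)[OF z(2)] by auto
      ultimately show "norm (V \<xi>) \<le> A (Q \<xi>) - A (Q (\<xi> + 1)) + c * (b - Q (\<xi> + 1))"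
        using z Vneg[of \<xi>] by (simp add: algebra_simps)
    qed
    have sh: "filterlim (\<lambda>\<xi>. \<xi> + 1) at_bot (at_bot :: real filter)"
    proof (subst filterlim_at_bot, intro allI)
      show "eventually (\<lambda>\<xi>. \<xi> + 1 \<le> y) at_bot" for y :: real
        using eventually_le_at_bot[of "y - 1"] by eventually_elim simp
    qed
    have "((\<lambda>\<xi>. A (Q \<xi>) - A (Q (\<xi> + 1)) + c * (b - Q (\<xi> + 1))) \<longlongrightarrow> A b - A b + c * (b - b)) at_bot"
      by (intro tendsto_intros Ub filterlim_compose[OF Ub sh] filterlim_compose[OF lb sh])
    then have "((\<lambda>\<xi>. A (Q \<xi>) - A (Q (\<xi> + 1)) + c * (b - Q (\<xi> + 1))) \<longlongrightarrow> 0) at_bot" by simp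
    with ev show ?thesis by (rule Lim_null_comparison)
  qed
  have inj: "inj Q" by (rule injI) (metis R(1) less_irrefl linorder_less_linear)
  define Z where "Z = inv Q"
  have ZQ: "Z (Q \<xi>) = \<xi>" for \<xi> using inj by (simp add: Z_def)
  have QZ: "Q (Z u) = u" if "a < u" "u < b" for u
    using R(4)[OF that] ZQ by metis
  have Qcont: "isCont Q \<xi>" for \<xi> using R(5) by (rule DERIV_isCont)
  have dZ: "(Z has_real_derivative inverse (deriv Q (Z u))) (at u)" if u: "a < u" "u < b" for u
  proof (rule DERIV_inverse_function[where f = Q and a = a and b = b])
    have "isCont Z (Q (Z u))"
      by (rule isCont_inverse_function2[of "Z u - 1" _ "Z u + 1"]) (use ZQ Qcont in auto)
    then show "isCont Z u" using QZ[OF u] by simp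
  qed (use u QZ R(5) R(6)[of "Z u"] in auto)
  define y where "y u = (if a < u \<and> u < b then (V (Z u))\<^sup>2 / 2 else 0)" for u
  have sq: "sqrt (2 * y u) = - V (Z u)" if "a < u" "u < b" for u
    using that Vneg[of "Z u"] by (simp add: y_def)
  have yp: "0 < y u" if "a < u" "u < b" for u using that Vneg[of "Z u"] by (simp add: y_def)
  have dy: "(y has_real_derivative c * sqrt (2 * y u) - hderiv A u * f u) (at u)" if u: "a < u" "u < b" for u
  proof -
    define q where "q = deriv Q (Z u)"
    have q: "q < 0" using R(6) by (simp add: q_def)
    have Vq: "V (Z u) = hderiv A u * q" using Veq[of "Z u"] QZ[OF u] by (simp add: q_def)
    have "((\<lambda>u. (V (Z u))\<^sup>2 / 2) has_real_derivative V (Z u) * ((- f (Q (Z u)) - c * deriv Q (Z u)) * inverse (deriv Q (Z u)))) (at u)"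
      using DERIV_chain2[OF dV dZ[OF u]] by (auto intro!: derivative_eq_intros)
    moreover have "V (Z u) * ((- f (Q (Z u)) - c * deriv Q (Z u)) * inverse (deriv Q (Z u))) =
        c * sqrt (2 * y u) - hderiv A u * f u"
      unfolding sq[OF u] QZ[OF u] q_def[symmetric] Vq using q by (simp add: field_simps)
    ultimately have "((\<lambda>u. (V (Z u))\<^sup>2 / 2) has_real_derivative c * sqrt (2 * y u) - hderiv A u * f u) (at u)"
      by simp
    then show ?thesis
      by (rule has_field_derivative_transform_within_open[OF _ open_greaterThanLessThan[of a b]])
         (use u in \<open>auto simp: y_def\<close>)
  qed
  have Vsmall: "(V (Z u))\<^sup>2 / 2 < e" if "\<bar>V (Z u)\<bar> < sqrt (2 * e)" "0 < e" for u e
  proof -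
    have "\<bar>V (Z u)\<bar>\<^sup>2 < (sqrt (2 * e))\<^sup>2" using that by (intro power_strict_mono) auto
    then show ?thesis using that by simp
  qed
  have ya: "(y \<longlongrightarrow> y a) (at_right a)"
  proof (rule tendstoI)
    fix e :: real assume e: "0 < e"
    then have "eventually (\<lambda>\<xi>. dist (V \<xi>) 0 < sqrt (2 * e)) at_top" using Va by (intro tendstoD) auto
    then obtain x where x: "\<And>\<xi>. x \<le> \<xi> \<Longrightarrow> \<bar>V \<xi>\<bar> < sqrt (2 * e)"
      by (auto simp: eventually_at_top_linorder)
    show "eventually (\<lambda>u. dist (y u) (y a) < e) (at_right a)"
    proof (rule eventually_at_rightI[of a "Q x"])
      fix u assume u: "u \<in> {a<..<Q x}"
      then have ub: "a < u" "u < b" using R(3)[of x] by auto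
      then have "Q (Z u) < Q x" using QZ u by simp
      then have "x \<le> Z u" using R(1)[of "Z u" x] by (cases "x \<le> Z u") auto
      then show "dist (y u) (y a) < e" using Vsmall[OF x e] ub by (simp add: y_def)
    qed (rule R(2))
  qed
  have yb: "(y \<longlongrightarrow> y b) (at_left b)"
  proof (rule tendstoI)
    fix e :: real assume e: "0 < e"
    then have "eventually (\<lambda>\<xi>. dist (V \<xi>) 0 < sqrt (2 * e)) at_bot" using Vb by (intro tendstoD) auto
    then obtain x where x: "\<And>\<xi>. \<xi> \<le> x \<Longrightarrow> \<bar>V \<xi>\<bar> < sqrt (2 * e)"
      by (auto simp: eventually_at_bot_linorder)
    show "eventually (\<lambda>u. dist (y u) (y b) < e) (at_left b)"
    proof (rule eventually_at_leftI[of "Q x" b])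
      fix u assume u: "u \<in> {Q x<..<b}"
      then have ub: "a < u" "u < b" using R(2)[of x] by auto
      then have "Q x < Q (Z u)" using QZ u by simp
      then have "Z u \<le> x" using R(1)[of x "Z u"] by (cases "Z u \<le> x") auto
      then show "dist (y u) (y b) < e" using Vsmall[OF x e] ub by (simp add: y_def)
    qed (rule R(3))
  qed
  have "continuous_on {a..b} y"
  proof (rule continuous_on_IccI[OF ya yb _ ab(2)])
    fix x assume "a < x" "x < b"
    then have "isCont y x" by (intro DERIV_isCont[OF dy])
    then show "y \<midarrow>x\<rightarrow> y x" by (simp add: isCont_def)
  qed
  then have "energy_profile (\<lambda>u. hderiv A u * f u) c a b y"
    unfolding energy_profile_def
  proof (intro conjI ballI)
    fix u assume "u \<in> {a<..<b}"
    then show "(y has_real_derivative c * sqrt (2 * max (y u) 0) - hderiv A u * f u) (at u)"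
      using dy[of u] yp[of u] by (simp add: max_def)
  qed
  moreover have "(Q has_real_derivative - sqrt (2 * y (Q \<xi>)) / hderiv A (Q \<xi>)) (at \<xi>)" for \<xi>
    using R(5)[of \<xi>] sq[OF R(2,3), of \<xi>] Veq[of \<xi>] hp[of \<xi>] by (simp add: ZQ)
  ultimately show ?thesis using that[of y] yp by (simp add: y_def)
qed

text \<open>
  The coordinate \<open>X\<close> grows with unit speed along every solution of \<open>Q' = - P(Q) / A'(Q)\<close>.
\<close>
lemma autonomous_profiles_are_translates:
  fixes A P Q Q' :: "real \<Rightarrow> real"
  assumes A: "class_A A" and ab: "0 \<le> a" "a < b"
    and Pc: "continuous_on {a..b} P" and P: "\<And>u. a < u \<Longrightarrow> u < b \<Longrightarrow> 0 < P u"
    and Q: "\<And>\<xi>. a < Q \<xi> \<and> Q \<xi> < b" "\<And>\<xi>. (Q has_real_derivative - P (Q \<xi>) / hderiv A (Q \<xi>)) (at \<xi>)"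
    and Q': "\<And>\<xi>. a < Q' \<xi> \<and> Q' \<xi> < b" "\<And>\<xi>. (Q' has_real_derivative - P (Q' \<xi>) / hderiv A (Q' \<xi>)) (at \<xi>)"
  shows "\<exists>h. \<forall>\<xi>. Q' \<xi> = Q (\<xi> + h)"
proof -
  obtain X where X: "\<And>u. a < u \<Longrightarrow> u < b \<Longrightarrow> (X has_real_derivative - (hderiv A u / P u)) (at u)"
    and q: "\<And>u. a < u \<Longrightarrow> u < b \<Longrightarrow> 0 < hderiv A u / P u"
    using travel_coordinate[OF A ab Pc P] by blast
  obtain Z where Z: "\<And>u. a < u \<Longrightarrow> u < b \<Longrightarrow> Z (X u) = u"
    and "\<And>\<xi> u1 u2. a < u1 \<Longrightarrow> u1 < u2 \<Longrightarrow> u2 < b \<Longrightarrow> X u2 < \<xi> \<Longrightarrow> \<xi> < X u1 \<Longrightarrow>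
       u1 < Z \<xi> \<and> Z \<xi> < u2 \<and> X (Z \<xi>) = \<xi> \<and> (Z has_real_derivative - 1 / (hderiv A (Z \<xi>) / P (Z \<xi>))) (at \<xi>)"
    using decreasing_inverse[OF X q] by blast
  have lin: "X (R \<xi>) = \<xi> + X (R 0)"
    if R: "\<And>\<xi>. a < R \<xi> \<and> R \<xi> < b" "\<And>\<xi>. (R has_real_derivative - P (R \<xi>) / hderiv A (R \<xi>)) (at \<xi>)"
    for R and \<xi> :: real
  proof -
    have "((\<lambda>\<xi>. X (R \<xi>) - \<xi>) has_real_derivative 0) (at \<xi>)" for \<xi>
    proof -
      have "0 < hderiv A (R \<xi>)" "0 < P (R \<xi>)"
        using P[of "R \<xi>"] q[of "R \<xi>"] R(1)[of \<xi>] by (auto simp: zero_less_divide_iff)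
      then have "- (hderiv A (R \<xi>) / P (R \<xi>)) * (- P (R \<xi>) / hderiv A (R \<xi>)) - 1 = 0" by simp
      then show ?thesis
        using DERIV_diff[OF DERIV_chain2[OF X R(2)[of \<xi>]] DERIV_ident] R(1)[of \<xi>] by metis
    qed
    then have "X (R \<xi>) - \<xi> = X (R 0) - 0" by (intro DERIV_isconst_all) blast
    then show ?thesis by simp
  qed
  have "Q' \<xi> = Q (\<xi> + (X (Q' 0) - X (Q 0)))" for \<xi>
  proof -
    have "X (Q' \<xi>) = X (Q (\<xi> + (X (Q' 0) - X (Q 0))))" using lin[OF Q, of "\<xi> + (X (Q' 0) - X (Q 0))"] lin[OF Q', of \<xi>] by simp
    then show ?thesis using Z Q(1) Q'(1) by metis
  qed
  then show ?thesis by blast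
qed

section \<open>Threshold speeds\<close>

lemma first_zero:
  fixes \<phi> :: "real \<Rightarrow> real"
  assumes cont: "continuous_on {c0..c1} \<phi>" and c: "c0 \<le> c1"
    and nn: "\<And>c. c0 \<le> c \<Longrightarrow> c \<le> c1 \<Longrightarrow> 0 \<le> \<phi> c" and p: "0 < \<phi> c0" and z: "\<phi> c1 = 0"
  obtains cs where "c0 < cs" "cs \<le> c1" "\<phi> cs = 0" "\<And>c. c0 \<le> c \<Longrightarrow> c < cs \<Longrightarrow> 0 < \<phi> c"
proof -
  define S where "S = {c0..c1} \<inter> \<phi> -` {0}"
  have "closed S" unfolding S_def by (rule continuous_closed_preimage[OF cont]) auto
  moreover have "c1 \<in> S" using z c by (auto simp: S_def)
  moreover have bb: "bdd_below S" unfolding S_def by auto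
  ultimately have "Inf S \<in> S" using closed_contains_Inf by blast
  then have v: "c0 \<le> Inf S" "Inf S \<le> c1" "\<phi> (Inf S) = 0" by (auto simp: S_def)
  have "0 < \<phi> x" if "c0 \<le> x" "x < Inf S" for x
  proof -
    have "x \<notin> S" using that cInf_lower[OF _ bb, of x] by force
    then have "\<phi> x \<noteq> 0" using that v by (auto simp: S_def)
    then show ?thesis using nn[of x] that v by auto
  qed
  moreover have "c0 < Inf S" using v p by (metis order_le_less less_irrefl)
  ultimately show ?thesis using that v by blast
qed

lemma momentum_linear_bound_right:
  assumes y: "energy_profile g c a b y" and c: "0 \<le> c"
    and g: "\<And>u. a < u \<Longrightarrow> u < b \<Longrightarrow> g u \<le> K * (b - u)"
    and b: "y b \<le> 0" and u: "u \<in> {a..b}"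
  shows "sqrt (2 * y u) \<le> sqrt K * (b - u)"
proof -
  have "2 * y u \<le> K * (b - u)\<^sup>2" using energy_profile_quadratic_bound[OF y c g b u] by simp
  then have "sqrt (2 * y u) \<le> sqrt (K * (b - u)\<^sup>2)" by (rule real_sqrt_le_mono)
  then show ?thesis using u by (simp add: real_sqrt_mult)
qed

lemma tendsto_at_left_of_continuous_on_half_line:
  fixes F :: "real \<Rightarrow> real"
  assumes "continuous_on {0..} F" "0 < c"
  shows "(F \<longlongrightarrow> F c) (at_left c)"
proof -
  have "isCont F c"
    using assms by (intro continuous_on_interior[of "{0..}"]) (auto simp: interior_real_atLeast)
  then show ?thesis unfolding isCont_def by (rule filterlim_mono) (auto intro: at_le)
qed

lemma monostable_threshold_exists:
  assumes b: "0 < b" and K: "0 < K"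
    and g: "\<And>u. 0 < u \<Longrightarrow> u < b \<Longrightarrow> 0 < g u" "\<And>u. 0 < u \<Longrightarrow> u < b \<Longrightarrow> g u \<le> K * u"
    and Y: "\<And>c. 0 \<le> c \<Longrightarrow> energy_profile g c 0 b (Y c)" and Yb: "\<And>c. 0 \<le> c \<Longrightarrow> Y c b = 0"
  obtains cs where "0 < cs" "Y cs 0 = 0" "\<And>c. 0 \<le> c \<Longrightarrow> c < cs \<Longrightarrow> 0 < Y c 0"
proof -
  have nn: "0 \<le> Y c 0" if "0 \<le> c" for c
    using energy_profile_nonneg[OF Y[OF that], of 0] g(1) Yb[OF that] that b by (auto intro: less_imp_le)
  have le0: "Y (2 * sqrt K) 0 \<le> 0"
    by (rule energy_profile_hits_zero_fast[OF Y K refl]) (use K g(2) Yb b in auto)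
  have "Y 0 0 > Y 0 b"
  proof (rule DERIV_neg_imp_decreasing_open[OF b])
    show "continuous_on {0..b} (Y 0)" using energy_profile_continuous[OF Y[OF order_refl]] .
    fix u assume u: "0 < u" "u < b"
    then show "\<exists>d. (Y 0 has_real_derivative d) (at u) \<and> d < 0"
      using energy_profile_deriv[OF Y[OF order_refl] u] g(1)[OF u] by (intro exI[of _ "- g u"]) simp
  qed
  then have p: "0 < Y 0 0" using Yb[of 0] by simp
  have cont: "continuous_on {0..2 * sqrt K} (\<lambda>c. Y c 0)"
    using energy_profile_continuous_in_speed[OF Y Yb, of 0] b by (auto intro: continuous_on_subset)
  show ?thesis
    by (rule first_zero[OF cont]) (use nn le0 p K that in \<open>auto intro: antisym\<close>)
qed

text \<open>
  On the part where \<open>g < 0\<close> a profile increases, so it is positive if it starts nonnegative at \<open>a\<close>.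
\<close>
lemma bistable_profile_pos:
  assumes y: "energy_profile g c a b y" and c: "0 \<le> c" and m: "a < m" "m < b"
    and gneg: "\<And>u. a < u \<Longrightarrow> u < m \<Longrightarrow> g u < 0" and gpos: "\<And>u. m < u \<Longrightarrow> u < b \<Longrightarrow> 0 < g u"
    and ya: "0 \<le> y a" and yb: "0 \<le> y b" and u: "a < u" "u < b"
  shows "0 < y u"
proof (cases "u \<le> m")
  case True
  have "y a < y u"
  proof (rule DERIV_pos_imp_increasing_open[OF u(1)])
    show "continuous_on {a..u} y"
      using energy_profile_continuous[OF y] by (rule continuous_on_subset) (use u in auto)
    fix x assume x: "a < x" "x < u"
    have "0 \<le> c * sqrt (2 * max (y x) 0)" using c by simp
    then show "\<exists>d. (y has_real_derivative d) (at x) \<and> 0 < d"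
      using energy_profile_deriv[OF y x(1)] gneg[OF x(1)] x u True
      by (intro exI[of _ "c * sqrt (2 * max (y x) 0) - g x"]) auto
  qed
  then show ?thesis using ya by simp
next
  case False
  have ym: "energy_profile g c m b y" by (rule energy_profile_subinterval[OF y]) (use m in auto)
  show ?thesis by (rule energy_profile_pos[OF ym gpos yb c]) (use False u in auto)
qed

lemma bistable_speed_unique:
  assumes y1: "energy_profile g c1 a b y1" "y1 a = 0" "y1 b = 0" "0 \<le> c1"
    and y2: "energy_profile g c2 a b y2" "y2 a = 0" "y2 b = 0" "0 \<le> c2"
    and m: "a < m" "m < b"
    and gneg: "\<And>u. a < u \<Longrightarrow> u < m \<Longrightarrow> g u < 0" and gpos: "\<And>u. m < u \<Longrightarrow> u < b \<Longrightarrow> 0 < g u"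
  shows "c1 = c2"
proof -
  have False if y1: "energy_profile g c1 a b y1" "y1 a = 0" "y1 b = 0" "0 \<le> c1"
    and y2: "energy_profile g c2 a b y2" "y2 a = 0" "y2 b = 0" "0 \<le> c2"
    and lt: "c1 < c2" for c1 c2 y1 y2
  proof (rule speed_of_profile_vanishing_left_unique[where a = a and b = m, OF _ _ lt m(1)])
    show "energy_profile g c1 a m y1" "energy_profile g c2 a m y2"
      using y1 y2 m by (auto intro: energy_profile_subinterval)
    show "0 < y2 u" if "a < u" "u < m" for u
      by (rule bistable_profile_pos[OF y2(1,4) m gneg gpos]) (use that y2 m in auto)
    show "y2 u \<le> y1 u" if "u \<in> {a..m}" for u
      by (rule energy_profile_mono[OF y1(1) y2(1)]) (use y1 y2 lt that m in auto)
    show "g u \<le> 0" if "a < u" "u < m" for u using gneg[OF that] by simp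
  qed (use y1 y2 in auto)
  from this[OF y1 y2] this[OF y2 y1] show ?thesis by (cases c1 c2 rule: linorder_cases) auto
qed

text \<open>
  At speed zero the energy at \<open>a\<close> is the integral of \<open>g\<close>. At speed \<open>2 sqrt K\<close> it has been used up
  already at \<open>m\<close>, and where \<open>g < 0\<close> the profile becomes even smaller towards \<open>a\<close>.
\<close>
lemma bistable_speed_exists:
  assumes K: "0 < K" and m: "a < m" "m < b" and gc: "continuous_on {a..b} g"
    and gneg: "\<And>u. a < u \<Longrightarrow> u < m \<Longrightarrow> g u < 0"
    and gK: "\<And>u. m < u \<Longrightarrow> u < b \<Longrightarrow> g u \<le> K * (u - m)"
    and int: "0 < integral {a..b} g"
    and Y: "\<And>c. 0 \<le> c \<Longrightarrow> energy_profile g c a b (Y c)" and Yb: "\<And>c. 0 \<le> c \<Longrightarrow> Y c b = 0"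
  shows "\<exists>cz>0. Y cz a = 0"
proof -
  have "((\<lambda>u. - g u) has_integral (Y 0 b - Y 0 a)) {a..b}"
  proof (rule fundamental_theorem_of_calculus_interior)
    show "continuous_on {a..b} (Y 0)" using energy_profile_continuous[OF Y[OF order_refl]] .
    show "(Y 0 has_vector_derivative - g u) (at u)" if "u \<in> {a<..<b}" for u
      using energy_profile_deriv[OF Y[OF order_refl], of u] that
      by (simp add: has_real_derivative_iff_has_vector_derivative)
  qed (use m in auto)
  then have "integral {a..b} (\<lambda>u. - g u) = Y 0 b - Y 0 a" by (rule integral_unique)
  then have p: "0 < Y 0 a" using int Yb[of 0] by simp
  define c1 where "c1 = 2 * sqrt K"
  have c1: "0 \<le> c1" using K by (simp add: c1_def)
  have ym: "Y c1 m \<le> 0"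
    by (rule energy_profile_hits_zero_fast[OF energy_profile_subinterval[OF Y[OF c1]] K c1_def gK])
       (use m Yb[OF c1] in auto)
  have "Y c1 a < Y c1 m"
  proof (rule DERIV_pos_imp_increasing_open[OF m(1)])
    show "continuous_on {a..m} (Y c1)"
      using energy_profile_continuous[OF Y[OF c1]] by (rule continuous_on_subset) (use m in auto)
    fix x assume x: "a < x" "x < m"
    have "0 \<le> c1 * sqrt (2 * max (Y c1 x) 0)" using c1 by simp
    then show "\<exists>d. (Y c1 has_real_derivative d) (at x) \<and> 0 < d"
      using energy_profile_deriv[OF Y[OF c1] x(1)] gneg[OF x] x m
      by (intro exI[of _ "c1 * sqrt (2 * max (Y c1 x) 0) - g x"]) auto
  qed
  then have n: "Y c1 a \<le> 0" using ym by simp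
  have "\<exists>c\<ge>0. c \<le> c1 \<and> Y c a = 0"
  proof (rule IVT2'[of "\<lambda>c. Y c a"])
    show "continuous_on {0..c1} (\<lambda>c. Y c a)"
      using energy_profile_continuous_in_speed[OF Y Yb, of a] m by (auto intro: continuous_on_subset)
  qed (use n p c1 in auto)
  then obtain c where "0 \<le> c" "Y c a = 0" by blast
  moreover from this p have "c \<noteq> 0" by auto
  ultimately show ?thesis by (intro exI[of _ c]) auto
qed

text \<open>
  The slope at zero gives the bound near zero, compactness gives it on the rest of the interval.
\<close>
lemma momentum_lower_bound:
  assumes Pc: "continuous_on {0..b} P" and P: "\<And>u. 0 < u \<Longrightarrow> u < b \<Longrightarrow> 0 < P u"
    and c: "0 < c" and slope: "((\<lambda>u. P u / u) \<longlongrightarrow> c) (at_right 0)" and b': "0 < b'" "b' < b" 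
  obtains e where "0 < e" "\<And>u. 0 < u \<Longrightarrow> u \<le> b' \<Longrightarrow> e * u \<le> (P u :: real)"
proof -
  have "eventually (\<lambda>u. c / 2 < P u / u) (at_right 0)"
    using c by (intro order_tendstoD(1)[OF slope]) auto
  then obtain d0 where d0: "0 < d0" "\<And>u. 0 < u \<Longrightarrow> u < d0 \<Longrightarrow> c / 2 < P u / u"
    by (auto simp: eventually_at_right_field)
  define d where "d = min (d0 / 2) b'"
  have d: "0 < d" "d < d0" "d \<le> b'" using d0 b' by (auto simp: d_def)
  have "continuous_on {d..b'} P" using Pc by (rule continuous_on_subset) (use d b' in auto)
  then obtain x where x: "x \<in> {d..b'}" "\<And>u. u \<in> {d..b'} \<Longrightarrow> P x \<le> P u"
    using continuous_attains_inf[OF compact_Icc, of d b' P] d by auto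
  have Px: "0 < P x" using P x d b' by auto
  show ?thesis
  proof (rule that[of "min (c / 2) (P x / b')"])
    show "0 < min (c / 2) (P x / b')" using c Px b' by simp
    fix u assume u: "0 < u" "u \<le> b'"
    show "min (c / 2) (P x / b') * u \<le> P u"
    proof (cases "u < d")
      case True
      have "min (c / 2) (P x / b') * u \<le> c / 2 * u" using u by (intro mult_right_mono min.cobounded1) auto
      also have "\<dots> \<le> P u" using d0(2)[of u] u True d by (simp add: field_simps)
      finally show ?thesis .
    next
      case False
      have "min (c / 2) (P x / b') * u \<le> P x / b' * b'" using u Px b' by (intro mult_mono min.cobounded2) auto
      also have "\<dots> \<le> P u" using x(2)[of u] u False b' by simp
      finally show ?thesis .
    qed
  qed
qed

theorem proposition2p1:
  fixes A f :: "real \<Rightarrow> real" and s1 s2 :: real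
  assumes "class_A A"
    and "assumption_F A f s1 s2"
  shows "\<exists>cs>0. \<exists>cz>0.
      (\<exists>Q. sharp_wave A f cs Q \<and> (Q \<longlongrightarrow> s1) at_bot \<and> neg_deriv_on {..<0} Q \<and>
           (\<forall>\<xi>\<ge>0. Q \<xi> = 0) \<and> darcy_law A cs Q) \<and>
      (\<exists>Q. unique_wave_up_to_translation (decreasing_wave A f 1 s1) cz Q) \<and>
      (cs < cz \<longrightarrow>
        (\<exists>cb. cs < cb \<and> cb < cz \<and>
          (\<exists>Q. sharp_wave A f cb Q \<and> (Q \<longlongrightarrow> 1) at_bot \<and> neg_deriv_on {..<0} Q \<and>
               (\<forall>\<xi>\<ge>0. Q \<xi> = 0) \<and> darcy_law A cb Q)))"
proof -
  note A = assms(1) and F = assms(2)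
  define g where "g u = hderiv A u * f u" for u
  obtain K where K: "0 < K" and gc: "continuous_on {0..1} g"
    and gz: "\<And>u z. u \<in> {0..1} \<Longrightarrow> z \<in> {0..1} \<Longrightarrow> f z = 0 \<Longrightarrow> \<bar>g u\<bar> \<le> K * \<bar>u - z\<bar>"
    and gw: "\<And>u. 0 < u \<Longrightarrow> u < 1 \<Longrightarrow> g u \<le> K * u\<^sup>2 * (hderiv A u / u)"
    and g0: "((\<lambda>u. g u / u) \<longlongrightarrow> 0) (at_right 0)"
    using weighted_reaction_facts[OF A F] unfolding g_def[symmetric] by blast
  note s = assumption_F_simps(1-3)[OF F] and fz = assumption_F_simps(4-7)[OF F]
    and fs = assumption_F_simps(8-10)[OF F]
  have hp: "0 < hderiv A u" if "0 < u" for u using class_A_simps(3)[OF A that] .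
  have gp1: "0 < g u" if "0 < u" "u < s1" for u using hp fs(1) that by (simp add: g_def)
  have gn: "g u < 0" if "s1 < u" "u < s2" for u
    using hp[of u] fs(2)[OF that] that s by (simp add: g_def mult_pos_neg)
  have gp2: "0 < g u" if "s2 < u" "u < 1" for u using hp[of u] fs(3)[OF that] that s by (simp add: g_def)
  have gK: "g u \<le> K * (z - u)" if "0 \<le> u" "u \<le> z" "z \<le> 1" "f z = 0" for u z
    using gz[of u z] that by auto
  have gK': "\<bar>g u\<bar> \<le> K * (u - z)" if "0 \<le> z" "z \<le> u" "u \<le> 1" "f z = 0" for u z
    using gz[of u z] that by auto
  have ex: "\<exists>Y. \<forall>c\<ge>0. energy_profile g c 0 b (Y c) \<and> Y c b = 0" if b: "0 \<le> b" "b \<le> 1" for b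
  proof -
    have "continuous_on {0..b} g" using gc by (rule continuous_on_subset) (use b in auto)
    then have "\<exists>y. 0 \<le> c \<longrightarrow> energy_profile g c 0 b y \<and> y b = 0" for c
      using energy_profile_exists[OF b(1), of c g] by blast
    then show ?thesis by metis
  qed
  \<comment> \<open>\<open>S\<close> shoots from \<open>s1\<close>, \<open>T\<close> shoots from \<open>1\<close>.\<close>
  obtain S where S: "\<And>c. 0 \<le> c \<Longrightarrow> energy_profile g c 0 s1 (S c)" "\<And>c. 0 \<le> c \<Longrightarrow> S c s1 = 0"
    using ex[of s1] s by auto
  obtain T where T: "\<And>c. 0 \<le> c \<Longrightarrow> energy_profile g c 0 1 (T c)" "\<And>c. 0 \<le> c \<Longrightarrow> T c 1 = 0"
    using ex[of 1] by auto
  note sub = energy_profile_subinterval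

  have gKu: "g u \<le> K * u" if "0 < u" "u < s1" for u using gK'[of 0 u] that s fz by auto
  obtain cs where cs: "0 < cs" "S cs 0 = 0" "\<And>c. 0 \<le> c \<Longrightarrow> c < cs \<Longrightarrow> 0 < S c 0"
    using monostable_threshold_exists[OF s(1) K gp1 gKu S] by blast
  have Spos: "0 < S c u" if "0 \<le> c" "0 < u" "u < s1" for c u
    by (rule energy_profile_pos[OF S(1)[OF that(1)] gp1]) (use that S in auto)
  have slopeS: "((\<lambda>u. sqrt (2 * S cs u) / u) \<longlongrightarrow> cs) (at_right 0)"
  proof (rule threshold_momentum_slope[where b = s1 and Y = S, OF S(1) order_refl cs(1) s(1) Spos cs(3) cs(2) _ g0])
    fix u assume "0 < u" "u < s1"
    then show "((\<lambda>c. S c u) \<longlongrightarrow> S cs u) (at_left cs)"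
      using energy_profile_continuous_in_speed[OF S, of u] cs(1)
      by (intro tendsto_at_left_of_continuous_on_half_line) auto
  qed auto
  have cs0: "0 \<le> cs" using cs(1) by simp
  have i: "\<exists>Q. sharp_wave A f cs Q \<and> (Q \<longlongrightarrow> s1) at_bot \<and> neg_deriv_on {..<0} Q \<and>
           (\<forall>\<xi>\<ge>0. Q \<xi> = 0) \<and> darcy_law A cs Q"
  proof (rule sharp_wave_of_momentum[where f = f and P = "\<lambda>u. sqrt (2 * S cs u)", OF A s(1) _ cs(1) fz(1) _ _ _ _ slopeS])
    show "continuous_on {0..s1} (\<lambda>u. sqrt (2 * S cs u))"
      by (intro continuous_intros energy_profile_continuous[OF S(1)[OF cs0]])
    fix u assume u: "0 < u" "u < s1"
    show "0 < sqrt (2 * S cs u)" using Spos[OF cs0 u] by simp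
    show "((\<lambda>u. sqrt (2 * S cs u)) has_real_derivative cs - hderiv A u * f u / sqrt (2 * S cs u)) (at u)"
      using momentum_deriv[OF S(1)[OF cs0] u Spos[OF cs0 u]] by (simp add: g_def)
    show "sqrt (2 * S cs u) \<le> sqrt K * (s1 - u)"
      by (rule momentum_linear_bound_right[OF S(1)[OF cs0] cs0 gK]) (use S(2)[OF cs0] u s fz in auto)
  qed (use s cs(2) in auto)

  have T1: "energy_profile g c s1 1 (T c)" if "0 \<le> c" for c
    by (rule sub[OF T(1)[OF that]]) (use s in auto)
  have "\<exists>cz>0. T cz s1 = 0"
  proof (rule bistable_speed_exists[OF K s(2,3) _ gn _ _ T1 T(2)])
    show "continuous_on {s1..1} g" using gc by (rule continuous_on_subset) (use s in auto)
    show "g u \<le> K * (u - s2)" if "s2 < u" "u < 1" for u using gK'[of s2 u] that s fz by auto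
    show "0 < integral {s1..1} g" using assumption_F_simps(11)[OF F] by (simp add: g_def[abs_def])
  qed auto
  then obtain cz where cz: "0 < cz" "T cz s1 = 0" by blast
  have cz0: "0 \<le> cz" using cz(1) by simp
  have uniq: "c = cz" if "energy_profile g c s1 1 y" "y s1 = 0" "y 1 = 0" "0 \<le> c" for c y
    by (rule bistable_speed_unique[OF that T1[OF cz0] cz(2) T(2)[OF cz0] cz0 s(2,3) gn gp2])
  have Tpos1: "0 < T c u" if "0 \<le> c" "0 \<le> T c s1" "s1 < u" "u < 1" for c u
    by (rule bistable_profile_pos[OF T1[OF that(1)] that(1) s(2,3) gn gp2 that(2) _ that(3,4)])
       (use T(2) that in auto)
  define P where "P u = sqrt (2 * T cz u)" for u
  have Pc: "continuous_on {s1..1} P"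
    unfolding P_def by (intro continuous_intros energy_profile_continuous[OF T1[OF cz0]])
  have Pp: "0 < P u" if "s1 < u" "u < 1" for u using Tpos1[OF cz0 _ that] cz(2) by (simp add: P_def)
  have s1': "s1 < 1" using s by simp
  have "\<exists>Q. decreasing_wave A f 1 s1 cz Q \<and> (\<forall>\<xi>. s1 < Q \<xi> \<and> Q \<xi> < 1) \<and>
      (\<forall>\<xi>. (Q has_real_derivative - P (Q \<xi>) / hderiv A (Q \<xi>)) (at \<xi>))"
  proof (rule decreasing_wave_of_momentum[OF A s(1) s1' cz(1) Pc Pp])
    fix u assume u: "s1 < u" "u < 1"
    have Tu: "0 < T cz u" using Tpos1[OF cz0 _ u] cz(2) by simp
    show "(P has_real_derivative cz - hderiv A u * f u / P u) (at u)"
      unfolding P_def[abs_def] using momentum_deriv[OF T1[OF cz0] u Tu] by (simp add: g_def)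
    show "P u \<le> (cz + K + 1) * (u - s1)"
      unfolding P_def
    proof (rule momentum_linear_bound_left[OF T1[OF cz0] cz0])
      show "0 < T cz v" if "s1 < v" "v < 1" for v using Tpos1[OF cz0 _ that] cz(2) by simp
      show "- g v \<le> K * (v - s1)" if "s1 < v" "v < 1" for v using gK'[of s1 v] that s fz by auto
    qed (use K cz(2) u in auto)
    show "P u \<le> sqrt K * (1 - u)"
      unfolding P_def by (rule momentum_linear_bound_right[OF T1[OF cz0] cz0 gK])
        (use T(2)[OF cz0] u s fz in auto)
  qed auto
  then obtain Qz where Qz: "decreasing_wave A f 1 s1 cz Qz" "\<And>\<xi>. s1 < Qz \<xi> \<and> Qz \<xi> < 1"
    "\<And>\<xi>. (Qz has_real_derivative - P (Qz \<xi>) / hderiv A (Qz \<xi>)) (at \<xi>)" by blast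
  have wave_unique: "c = cz \<and> (\<exists>h. \<forall>\<xi>. Q \<xi> = Qz (\<xi> + h))" if W: "decreasing_wave A f 1 s1 c Q" for c Q
  proof -
    have c: "0 \<le> c" using W by (auto simp: decreasing_wave_def traveling_wave_def)
    have "\<exists>y. energy_profile g c s1 1 y \<and> y s1 = 0 \<and> y 1 = 0 \<and>
       (\<forall>\<xi>. (Q has_real_derivative - sqrt (2 * y (Q \<xi>)) / hderiv A (Q \<xi>)) (at \<xi>))"
      by (rule energy_profile_of_wave[OF A s(1) s1' assumption_F_C1(1)[OF F] s(2) _ s(3) _ W])
         (use fs in \<open>auto simp: g_def[abs_def] intro: less_imp_le\<close>)
    then obtain y where y: "energy_profile g c s1 1 y" "y s1 = 0" "y 1 = 0"
      and dQ: "\<And>\<xi>. (Q has_real_derivative - sqrt (2 * y (Q \<xi>)) / hderiv A (Q \<xi>)) (at \<xi>)" by blast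
    have cc: "c = cz" by (rule uniq[OF y c])
    have Qr: "s1 < Q \<xi> \<and> Q \<xi> < 1" for \<xi> using decreasing_wave_range(2,3)[OF W] by blast
    have "y u = T cz u" if "u \<in> {s1..1}" for u
      by (rule energy_profile_unique[OF y(1)[unfolded cc] T1[OF cz0] cz0 _ that])
         (use y(3) T(2)[OF cz0] in simp)
    then have "(Q has_real_derivative - P (Q \<xi>) / hderiv A (Q \<xi>)) (at \<xi>)" for \<xi>
      using dQ[of \<xi>] Qr[of \<xi>] by (simp add: P_def)
    from autonomous_profiles_are_translates[OF A less_imp_le[OF s(1)] s1' Pc Pp Qz(2,3) Qr this] cc
    show ?thesis by blast
  qed
  have ii: "unique_wave_up_to_translation (decreasing_wave A f 1 s1) cz Qz"
    unfolding unique_wave_up_to_translation_def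
  proof (intro conjI allI impI)
    fix c Q assume W: "decreasing_wave A f 1 s1 c Q"
    show "c = cz" "\<exists>h. \<forall>\<xi>. Q \<xi> = Qz (\<xi> + h)" using wave_unique[OF W] by auto
  qed (rule Qz(1))

  have iii: "\<exists>cb. cs < cb \<and> cb < cz \<and>
          (\<exists>Q. sharp_wave A f cb Q \<and> (Q \<longlongrightarrow> 1) at_bot \<and> neg_deriv_on {..<0} Q \<and>
               (\<forall>\<xi>\<ge>0. Q \<xi> = 0) \<and> darcy_law A cb Q)" if lt: "cs < cz"
  proof -
    have T0: "energy_profile g c 0 s1 (T c)" if "0 \<le> c" for c
      by (rule sub[OF T(1)[OF that]]) (use s in auto)
    have Ts1: "0 \<le> T c s1" if "0 \<le> c" "c \<le> cz" for c
    proof -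
      have "T cz s1 \<le> T c s1"
        by (rule energy_profile_mono[OF T1[OF that(1)] T1[OF cz0] that])
           (use T(2)[OF that(1)] T(2)[OF cz0] s in auto)
      then show ?thesis using cz(2) by simp
    qed
    have Ts1': "0 < T c s1" if "0 \<le> c" "c < cz" for c
    proof -
      have "T c s1 \<noteq> 0" using uniq[OF T1[OF that(1)] _ T(2)[OF that(1)] that(1)] that(2) by blast
      then show ?thesis using Ts1[of c] that by simp
    qed
    have Tpos0: "0 < T c u" if "0 \<le> c" "c \<le> cz" "0 < u" "u < s1" for c u
      by (rule energy_profile_pos[OF T0[OF that(1)] gp1 Ts1[OF that(1,2)] that(1,3,4)])
    have T00: "0 \<le> T c 0" if "0 \<le> c" "c \<le> cz" for c
      by (rule energy_profile_nonneg[OF T0[OF that(1)] less_imp_le[OF gp1] Ts1[OF that] that(1)])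
         (use s in auto)
    have le: "T cz u \<le> S cs u" if "u \<in> {0..s1}" for u
      by (rule energy_profile_mono[OF S(1)[OF cs0] T0[OF cz0] cs0 _ _ that])
         (use lt cz(2) S(2)[OF cs0] in auto)
    have Tcz: "T cz 0 = 0" using le[of 0] cs(2) T00[OF cz0 order_refl] s by simp
    \<comment> \<open>At speed \<open>cs\<close> the curve from \<open>1\<close> lies above the first wave and strictly so near \<open>s1\<close>.\<close>
    have Tcs: "0 < T cs 0"
    proof -
      have ge: "S cs u \<le> T cs u" if "u \<in> {0..s1}" for u
        by (rule energy_profile_mono[OF T0[OF cs0] S(1)[OF cs0] cs0 order_refl _ that])
           (use Ts1'[OF cs0 lt] S(2)[OF cs0] in auto)
      have "continuous_on {0..s1} (\<lambda>u. T cs u - S cs u)"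
        by (intro continuous_intros energy_profile_continuous[OF T0[OF cs0]] energy_profile_continuous[OF S(1)[OF cs0]])
      then have "((\<lambda>u. T cs u - S cs u) \<longlongrightarrow> T cs s1 - S cs s1) (at_left s1)"
        by (rule continuous_on_Icc_at_leftD) (rule s(1))
      moreover have "0 < T cs s1 - S cs s1" using Ts1'[OF cs0 lt] S(2)[OF cs0] by simp
      ultimately have "eventually (\<lambda>u. 0 < T cs u - S cs u) (at_left s1)"
        by (rule order_tendstoD(1))
      then obtain v where v: "v < s1" "\<And>u. v < u \<Longrightarrow> u < s1 \<Longrightarrow> 0 < T cs u - S cs u"
        by (auto simp: eventually_at_left_field)
      define u0 where "u0 = (max v 0 + s1) / 2"
      have u0: "0 < u0" "u0 < s1" "S cs u0 < T cs u0"
        using v(1) v(2)[of u0] s by (auto simp: u0_def)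
      \<comment> \<open>The first wave vanishes at \<open>s1\<close>, so the linear lower bound is available only on \<open>{0..b'}\<close>.\<close>
      define b' where "b' = (u0 + s1) / 2"
      have b': "u0 < b'" "b' < s1" using u0 by (auto simp: b'_def)
      have "continuous_on {0..s1} (\<lambda>u. sqrt (2 * S cs u))"
        by (intro continuous_intros energy_profile_continuous[OF S(1)[OF cs0]])
      then obtain e where e: "0 < e" "\<And>u. 0 < u \<Longrightarrow> u \<le> b' \<Longrightarrow> e * u \<le> sqrt (2 * S cs u)"
        using momentum_lower_bound[of s1 "\<lambda>u. sqrt (2 * S cs u)" cs b'] slopeS cs(1) b' u0 Spos[OF cs0]
        by auto
      show ?thesis
      proof (rule profile_gap_survives[where b = b' and g = g and c = cs and K = K and e = e and w = "\<lambda>u. hderiv A u / u" and W = "Lam A", OF _ _ e(1)])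
        show "energy_profile g cs 0 b' (T cs)" "energy_profile g cs 0 b' (S cs)"
          using sub[OF T0[OF cs0]] sub[OF S(1)[OF cs0]] b' by auto
        fix u assume u: "0 < u" "u < b'"
        then have u1: "u < 1" "u < s1" using b' s by auto
        show "e * u \<le> sqrt (2 * S cs u)" using e(2) u by simp
        show "S cs u \<le> T cs u" using ge[of u] u u1 by simp
        show "g u \<le> K * u\<^sup>2 * (hderiv A u / u)" by (rule gw) (use u u1 in auto)
        show "0 \<le> hderiv A u / u" using hp[OF u(1)] u by simp
        show "(Lam A has_real_derivative hderiv A u / u) (at u)" by (rule Lam_facts(4)[OF A u(1) u1(1)])
        show "0 \<le> Lam A u" by (rule Lam_facts(3)[OF A]) (use u u1 in auto)
      qed (use K u0 b' in auto)
    qed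
    have contT: "continuous_on {0..} (\<lambda>c. T c u)" if "u \<in> {0..1}" for u
      by (rule energy_profile_continuous_in_speed[OF T that])
    have contT0: "continuous_on {cs..cz} (\<lambda>c. T c 0)"
      by (rule continuous_on_subset[OF contT]) (use cs0 in auto)
    obtain cb where cb: "cs < cb" "cb \<le> cz" "T cb 0 = 0" "\<And>c. cs \<le> c \<Longrightarrow> c < cb \<Longrightarrow> 0 < T c 0"
      by (rule first_zero[OF contT0 less_imp_le[OF lt] _ Tcs Tcz]) (use T00 cs0 in auto)
    have cb0: "0 < cb" "0 \<le> cb" using cb(1) cs(1) by auto
    have slopeT: "((\<lambda>u. sqrt (2 * T cb u) / u) \<longlongrightarrow> cb) (at_right 0)"
    proof (rule threshold_momentum_slope[where b = s1 and Y = T, OF _ cs0 cb(1) s(1) _ cb(4) cb(3) _ g0])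
      fix c assume c: "cs \<le> c" "c \<le> cb"
      show "energy_profile g c 0 s1 (T c)" by (rule T0) (use c cs0 in auto)
      show "0 < T c u" if "0 < u" "u < s1" for u by (rule Tpos0) (use c cs0 cb(2) that in auto)
    next
      fix u assume "0 < u" "u < s1"
      then show "((\<lambda>c. T c u) \<longlongrightarrow> T cb u) (at_left cb)"
        using s by (intro tendsto_at_left_of_continuous_on_half_line contT cb0) auto
    qed auto
    \<comment> \<open>Otherwise the curve at \<open>cz\<close> has slope \<open>cz\<close> at zero and lies below the first wave, of slope
      \<open>cs < cz\<close>.\<close>
    have "cb \<noteq> cz"
    proof
      assume eq: "cb = cz"
      have "cz \<le> cs"
      proof (rule tendsto_le[OF _ slopeS slopeT[unfolded eq]])
        show "eventually (\<lambda>u. sqrt (2 * T cz u) / u \<le> sqrt (2 * S cs u) / u) (at_right 0)"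
          by (rule eventually_at_rightI[of 0 s1]) (use le s in \<open>auto intro: divide_right_mono\<close>)
      qed simp
      then show False using lt by simp
    qed
    then have cbz: "cb < cz" using cb(2) by simp
    have Tpos: "0 < T cb u" if "0 < u" "u < 1" for u
    proof -
      consider "u < s1" | "u = s1" | "s1 < u" by linarith
      then show ?thesis
        using Tpos0[OF cb0(2) cb(2), of u] Ts1'[OF cb0(2) cbz] Tpos1[OF cb0(2), of u] that
        by cases auto
    qed
    have "\<exists>Q. sharp_wave A f cb Q \<and> (Q \<longlongrightarrow> 1) at_bot \<and> neg_deriv_on {..<0} Q \<and>
           (\<forall>\<xi>\<ge>0. Q \<xi> = 0) \<and> darcy_law A cb Q"
    proof (rule sharp_wave_of_momentum[where f = f and P = "\<lambda>u. sqrt (2 * T cb u)", OF A _ _ cb0(1) fz(1) _ _ _ _ slopeT])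
      show "continuous_on {0..1} (\<lambda>u. sqrt (2 * T cb u))"
        by (intro continuous_intros energy_profile_continuous[OF T(1)[OF cb0(2)]])
      fix u :: real assume u: "0 < u" "u < 1"
      show "0 < sqrt (2 * T cb u)" using Tpos[OF u] by simp
      show "((\<lambda>u. sqrt (2 * T cb u)) has_real_derivative cb - hderiv A u * f u / sqrt (2 * T cb u)) (at u)"
        using momentum_deriv[OF T(1)[OF cb0(2)] u Tpos[OF u]] by (simp add: g_def)
      show "sqrt (2 * T cb u) \<le> sqrt K * (1 - u)"
        by (rule momentum_linear_bound_right[OF T(1)[OF cb0(2)] cb0(2) gK]) (use T(2)[OF cb0(2)] u fz in auto)
    qed (use cb(3) in auto)
    then show ?thesis using cb(1) cbz by blast
  qed
  show ?thesis using cs(1) cz(1) i ii iii by blast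
qed

end
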